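(* For any multicharge $\boldsymbol\kappa$ we have $\mathcal{W}^{\boldsymbol\kappa}(\mathcal{UL}) = \mathcal{MP}_{\mathrm{K}}^{\boldsymbol\kappa}$, and the maps $$\mathcal{W}^{\boldsymbol\kappa}: \mathcal{UL} \to \mathcal{MP}_{\mathrm{K}}^{\boldsymbol\kappa} \qquad\text{and}\qquad \mathcal{Z}^{\boldsymbol\kappa}: \mathcal{MP}_{\mathrm{K}}^{\boldsymbol\kappa} \to \mathcal{UL}$$ are mutually inverse crystal isomorphisms.
   Context: Write $\hat i=i+1$ for $i\in\mathbb{Z}_2$; $\alpha_0,\alpha_1$ are the simple roots of type ${\tt A}_1^{(1)}$, $\langle\alpha_i,\alpha_i^\vee\rangle=2$, $\langle\alpha_{\hat i},\alpha_i^\vee\rangle=-2$. A crystal isomorphism is a bijection commuting with $e_i,f_i,\mathrm{wt},\varepsilon_i,\varphi_i$ for $i\in\mathbb{Z}_2$; in each crystal below $\varphi_i=\varepsilon_i+\langle\mathrm{wt},\alpha_i^\vee\rangle$. Kleshchev multipartitions: a multicharge $\boldsymbol\kappa=(\kappa_1,\kappa_2,\ldots)$ is a sequence in $\mathbb{Z}_2$ containing infinitely many $0$'s and infinitely many $1$'s. A $\boldsymbol\kappa$-multipartition $\boldsymbol\lambda=(\lambda^{(1)},\lambda^{(2)},\ldots)$ is a sequence of partitions, all but finitely many empty; the box in row $r$, column $c$ of $\lambda^{(t)}$ has residue $\kappa_t+c-r\in\mathbb{Z}_2$. $\mathcal{MP}^{\boldsymbol\kappa}$ is the set of these; the content is $\#\{\text{residue-}0\text{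 boxes}\}\alpha_0+\#\{\text{residue-}1\text{ boxes}\}\alpha_1$. Young diagrams follow the English convention, and components are arranged vertically with $\lambda^{(1)}$ at the bottom. A box $u\in\boldsymbol\lambda$ of residue $i$ is $i$-removable if $\boldsymbol\lambda\setminus u\in\mathcal{MP}^{\boldsymbol\kappa}$; a box $u\notin\boldsymbol\lambda$ of residue $i$ is $i$-addable if $\boldsymbol\lambda\sqcup u\in\mathcal{MP}^{\boldsymbol\kappa}$. The $i$-arc arrangement $\boldsymbol\lambda[i]$: reading top to bottom, whenever an $i$-removable box is followed by an $i$-addable box with no unarced $i$-removable or $i$-addable boxes between them, draw an arc; repeat until impossible. $f_i\boldsymbol\lambda$ adds the bottommost unarced $i$-addable box; $e_i\boldsymbol\lambda$ deletes the topmost unarced $i$-removable box (and is $0$ if none). $\boldsymbol\lambda$ is Kleshchev if $\boldsymbol\lambda=f_{i_m}\cdots f_{i_1}\varnothing$ for some $(i_1,\ldots,i_m)\in\mathbb{Z}_2^m$; $\mathcal{MP}_{\mathrm{K}}^{\boldsymbol\kappa}$ is the set of Kleshchev multipartitions, a crystal under $e_i,f_i$, $\mathrm{wt}=-\mathrm{cont}$, $\varepsilon_i(\boldsymbol\lambda)$ = number of unarced $i$-removable boxes in $\boldsymbol\lambda[i]$. Upper ledge diagrams: a ledge diagram is a left-aligned arrangement of boxes with row lengths $(d_1,\ldots,d_m)\in\mathbb{Z}_{>0}^m$ from top to bottom ($m=0$ allowed), boxes colored by $\mathbb{Z}_2$, such that for some $t$, $(d_1,\ldots,d_t)$ is weakly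 increasing and $(d_t,\ldots,d_m)$ weakly decreasing, each row has a single color, and colors alternate down columns. It is upper (resp. lower) ledge if $(d_1,\ldots,d_t)$ is strictly increasing (resp. $(d_t,\ldots,d_m)$ is strictly decreasing). $\mathcal{UL}$ (resp. $\mathcal{LL}$) is the set of upper (resp. lower) ledge diagrams. A peak row is a row of maximal length; an $i$-peak row is a longest $i$-colored row; an $i$-colored box is $i$-bottom if there is no box directly below it. $\mathrm{cont}(\mathsf{D})=\#\{0\text{-boxes}\}\alpha_0+\#\{1\text{-boxes}\}\alpha_1$. The arrangement $\mathsf{D}[i]$: reading right to left, whenever an $i$-bottom box is followed by an $\hat i$-bottom box with no unarced bottom boxes between them, draw an arc; repeat until impossible. Crystal structure: $\mathrm{wt}=-\mathrm{cont}$, $\varepsilon_i$ = number of unarced $i$-bottom boxes in $\mathsf{D}[i]$; $e_i$ deletes the rightmost unarced $i$-bottom box ($0$ if none); $f_i$ adds an $i$-colored box directly below the leftmost unarced $\hat i$-bottom box, or if none exists appends an $i$-colored box to the uppermost $i$-peak row (for $\varnothing$: gives the one-box diagram of color $i$). Given a lower ledge diagram there is a unique way to rearrange it into an upper ledge diagram by shifting its columns vertically in increments of two (so box colors are preserved); this bijection is $\mathrm{float}:\mathcal{LL}\to\mathcal{UL}$. The map $\mathrm{split}^i:\mathcal{UL}\to\mathcal{UL}\times\mathcal{UL}$, $\mathsf{D}\mapsto(\mathrm{split}^i(\mathsf{D})_\downarrow,\mathrm{split}^i(\mathsf{D})_\uparrow)$: let $u$ be the uppermost box of color $i$ in the first column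 of $\mathsf{D}$; if none, $\mathrm{split}^i(\mathsf{D})=(\varnothing,\mathsf{D})$. Otherwise, extend a ray southeast at $-45^\circ$ from the centroid of $u$; let $\mathsf{L}$ be the boxes whose centroid lies weakly below the ray and $\mathsf{U}$ those strictly above (if $u$ is in row $a$, the box in row $r$, column $c$ is in $\mathsf{L}$ iff $r-c\ge a-1$). Then $\mathsf{L}$ is upper ledge, and left-justifying the rows of $\mathsf{U}$ gives a lower ledge diagram $\mathsf{U}'$; $\mathrm{split}^i(\mathsf{D})_\downarrow=\mathsf{L}$ and $\mathrm{split}^i(\mathsf{D})_\uparrow=\mathrm{float}(\mathsf{U}')$. Put $\mathrm{split}^{\boldsymbol\kappa}(\mathsf{D})=(\mathsf{D}_1,\mathsf{D}_2,\ldots)$ with $\mathsf{D}_1=\mathrm{split}^{\kappa_1}(\mathsf{D})_\downarrow$ and $(\mathsf{D}_2,\mathsf{D}_3,\ldots)=\mathrm{split}^{(\kappa_2,\kappa_3,\ldots)}(\mathrm{split}^{\kappa_1}(\mathsf{D})_\uparrow)$. Define $\mathcal{W}^{\boldsymbol\kappa}(\mathsf{D})=(\lambda^{(1)},\lambda^{(2)},\ldots)$, where $\lambda^{(t)}$ is the partition constructed by top-aligning every column of $\mathsf{D}_t$. Gluing: for $\mathsf{D}_1,\mathsf{D}_2\in\mathcal{UL}$, $\mathrm{glue}(\mathsf{D}_1,\mathsf{D}_2)\in\mathcal{UL}$ is defined thus (with $\mathrm{glue}(\mathsf{D},\varnothing)=\mathrm{glue}(\varnothing,\mathsf{D})=\mathsf{D}$):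 set $\mathsf{D}_2$ to the right of $\mathsf{D}_1$ with top rows aligned if they have matching color, or with the top row of $\mathsf{D}_2$ one notch higher otherwise. Starting from the leftmost column of $\mathsf{D}_2$ whose bottom box is above the uppermost peak row of $\mathsf{D}_1$ (if such exists), work to the right, shifting columns down as far as possible in steps of two so that the bottom box is still (a) not below the uppermost peak row of $\mathsf{D}_1$ and (b) not below the bottom box in the column directly to its left. Then combine the diagrams, left-justifying all rows. For $\underline{\mathsf{D}}=(\mathsf{D}_1,\mathsf{D}_2,\ldots)$ with $\mathsf{D}_k=\varnothing$ for $k\gg0$, let $M$ be maximal with $\mathsf{D}_M\neq\varnothing$ (if all are empty, $\mathrm{glue}(\underline{\mathsf{D}})=\varnothing$), put $\mathsf{D}'_{M+1}=\varnothing$, $\mathsf{D}'_t=\mathrm{glue}(\mathsf{D}_t,\mathsf{D}'_{t+1})$ for $t=M,\ldots,1$, and $\mathrm{glue}(\underline{\mathsf{D}})=\mathsf{D}'_1$. For $\boldsymbol\lambda\in\mathcal{MP}^{\boldsymbol\kappa}$, let $\mathsf{D}_t$ be obtained from $\lambda^{(t)}$ by shifting, for all $k$, the $k$th column down by $k-1$ notches and then left-aligning all rows, the color of each box being its pre-shift residue; set $\mathcal{Z}^{\boldsymbol\kappa}(\boldsymbol\lambda)=\mathrm{glue}(\mathsf{D}_1,\mathsf{D}_2,\ldots)$. *)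

theory Defs
  imports "HOL-Library.Z2"
begin

text \<open>
  Colours and residues live in the type \<^typ>\<open>bit\<close> of integers modulo 2, so that the other colour
  than \<open>i\<close> is \<open>i + 1\<close>.  Rows, columns, components and charges are numbered from 0.
  An element of the root lattice is the function \<open>bit \<Rightarrow> int\<close> of its
  coefficients with respect to the simple roots.
\<close>

section \<open>Crystals\<close>

definition coroot_pairing :: "(bit \<Rightarrow> int) \<Rightarrow> bit \<Rightarrow> int" where
  "coroot_pairing \<beta> i = 2 * \<beta> i - 2 * \<beta> (i + 1)"

text \<open>The value \<open>None\<close> of an operator stands for the extra element 0.\<close>

record 'b crystal =
  elems :: "'b set"
  wt :: "'b \<Rightarrow> bit \<Rightarrow> int"
  eps :: "bit \<Rightarrow> 'b \<Rightarrow> int"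
  phi :: "bit \<Rightarrow> 'b \<Rightarrow> int"
  e_op :: "bit \<Rightarrow> 'b \<Rightarrow> 'b option"
  f_op :: "bit \<Rightarrow> 'b \<Rightarrow> 'b option"

definition ops_closed :: "'b crystal \<Rightarrow> bool" where
  "ops_closed B \<longleftrightarrow> (\<forall>i. \<forall>b \<in> elems B.
     set_option (e_op B i b) \<subseteq> elems B \<and> set_option (f_op B i b) \<subseteq> elems B)"

definition crystal_iso :: "'b crystal \<Rightarrow> 'c crystal \<Rightarrow> ('b \<Rightarrow> 'c) \<Rightarrow> bool" where
  "crystal_iso B C h \<longleftrightarrow> ops_closed B \<and> ops_closed C \<and> bij_betw h (elems B) (elems C) \<and>
     (\<forall>b \<in> elems B. wt C (h b) = wt B b \<and>
        (\<forall>i. eps C i (h b) = eps B i b \<and> phi C i (h b) = phi B i b \<and>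
             e_op C i (h b) = map_option h (e_op B i b) \<and>
             f_op C i (h b) = map_option h (f_op B i b)))"


section \<open>Arc arrangements\<close>

text \<open>
  The boxes in \<open>A \<union> B\<close> are read in the order \<open>prec\<close>, and arcs lead from \<open>A\<close> to \<open>B\<close>.  The predicate
  \<open>drawn\<close> describes the sets of arcs that occur in the course of the drawing procedure; the boxes
  arced at such a stage \<open>E\<close> are those in \<^term>\<open>Field E\<close>.  A box is arced in the final arrangement iff
  it is arced at some stage; in this form the definition also applies when \<open>B\<close> is infinite.
\<close>

inductive drawn :: "('b \<Rightarrow> 'b \<Rightarrow> bool) \<Rightarrow> 'b set \<Rightarrow> 'b set \<Rightarrow> ('b \<times> 'b) set \<Rightarrow> bool"
  for prec A B where
  start: "drawn prec A B {}"
| arc: "drawn prec A B E \<Longrightarrow> u \<in> A - Field E \<Longrightarrow> v \<in> B - Field E \<Longrightarrow> prec u v \<Longrightarrow>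
    (\<And>w. w \<in> A \<union> B \<Longrightarrow> prec u w \<Longrightarrow> prec w v \<Longrightarrow> w \<in> Field E) \<Longrightarrow>
    drawn prec A B (insert (u, v) E)"

definition unarced :: "('b \<Rightarrow> 'b \<Rightarrow> bool) \<Rightarrow> 'b set \<Rightarrow> 'b set \<Rightarrow> 'b set" where
  "unarced prec A B = (A \<union> B) - \<Union>{Field E | E. drawn prec A B E}"

definition first_box :: "('b \<Rightarrow> 'b \<Rightarrow> bool) \<Rightarrow> 'b set \<Rightarrow> 'b" where
  "first_box prec X = (THE u. u \<in> X \<and> (\<forall>v \<in> X - {u}. prec u v))"

definition last_box :: "('b \<Rightarrow> 'b \<Rightarrow> bool) \<Rightarrow> 'b set \<Rightarrow> 'b" where
  "last_box prec X = (THE u. u \<in> X \<and> (\<forall>v \<in> X - {u}. prec v u))"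


section \<open>Kleshchev multipartitions\<close>

text \<open>
  Partitions are identified with their Young diagrams (English convention), consisting of boxes
  \<open>(r, c)\<close>.  A box \<open>(t, r, c)\<close> of a multipartition is the box \<open>(r, c)\<close> of its component \<open>t\<close>.
\<close>

definition young :: "(nat \<times> nat) set \<Rightarrow> bool" where
  "young Y \<longleftrightarrow> finite Y \<and> (\<forall>r c r' c'. (r, c) \<in> Y \<and> r' \<le> r \<and> c' \<le> c \<longrightarrow> (r', c') \<in> Y)"

type_synonym multipartition = "nat \<Rightarrow> (nat \<times> nat) set"
type_synonym node = "nat \<times> nat \<times> nat"

definition multicharge :: "(nat \<Rightarrow> bit) \<Rightarrow> bool" where
  "multicharge \<kappa> \<longleftrightarrow> infinite {t. \<kappa> t = 0} \<and> infinite {t. \<kappa> t = 1}"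

definition MP :: "multipartition set" where
  "MP = {\<mu>. (\<forall>t. young (\<mu> t)) \<and> finite {t. \<mu> t \<noteq> {}}}"

definition empty_mp :: multipartition where
  "empty_mp = (\<lambda>t. {})"

definition mp_boxes :: "multipartition \<Rightarrow> node set" where
  "mp_boxes \<mu> = {(t, b). b \<in> \<mu> t}"

fun residue :: "(nat \<Rightarrow> bit) \<Rightarrow> node \<Rightarrow> bit" where
  "residue \<kappa> (t, r, c) = \<kappa> t + of_nat c - of_nat r"

fun add_box :: "node \<Rightarrow> multipartition \<Rightarrow> multipartition" where
  "add_box (t, b) \<mu> = \<mu>(t := insert b (\<mu> t))"

fun del_box :: "node \<Rightarrow> multipartition \<Rightarrow> multipartition" where
  "del_box (t, b) \<mu> = \<mu>(t := \<mu> t - {b})"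

definition removable :: "(nat \<Rightarrow> bit) \<Rightarrow> bit \<Rightarrow> multipartition \<Rightarrow> node set" where
  "removable \<kappa> i \<mu> = {u. u \<in> mp_boxes \<mu> \<and> residue \<kappa> u = i \<and> del_box u \<mu> \<in> MP}"

definition addable :: "(nat \<Rightarrow> bit) \<Rightarrow> bit \<Rightarrow> multipartition \<Rightarrow> node set" where
  "addable \<kappa> i \<mu> = {u. u \<notin> mp_boxes \<mu> \<and> residue \<kappa> u = i \<and> add_box u \<mu> \<in> MP}"

text \<open>
  Component 0 is at the bottom.  Two distinct boxes that are \<open>i\<close>-removable or \<open>i\<close>-addable for the
  same \<open>i\<close> never lie in the same row of the same component.
\<close>

fun above :: "node \<Rightarrow> node \<Rightarrow> bool" where
  "above (t, r, c) (t', r', c') \<longleftrightarrow> t' < t \<or> t = t' \<and> r < r'"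

definition mp_unarced :: "(nat \<Rightarrow> bit) \<Rightarrow> bit \<Rightarrow> multipartition \<Rightarrow> node set" where
  "mp_unarced \<kappa> i \<mu> = unarced above (removable \<kappa> i \<mu>) (addable \<kappa> i \<mu>)"

definition mp_f :: "(nat \<Rightarrow> bit) \<Rightarrow> bit \<Rightarrow> multipartition \<Rightarrow> multipartition" where
  "mp_f \<kappa> i \<mu> = add_box (last_box above (mp_unarced \<kappa> i \<mu> \<inter> addable \<kappa> i \<mu>)) \<mu>"

definition mp_e :: "(nat \<Rightarrow> bit) \<Rightarrow> bit \<Rightarrow> multipartition \<Rightarrow> multipartition option" where
  "mp_e \<kappa> i \<mu> =
     (let R = mp_unarced \<kappa> i \<mu> \<inter> removable \<kappa> i \<mu>
      in if R = {} then None else Some (del_box (first_box above R) \<mu>))"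

definition mp_cont :: "(nat \<Rightarrow> bit) \<Rightarrow> multipartition \<Rightarrow> bit \<Rightarrow> int" where
  "mp_cont \<kappa> \<mu> i = int (card {u \<in> mp_boxes \<mu>. residue \<kappa> u = i})"

definition mp_eps :: "(nat \<Rightarrow> bit) \<Rightarrow> bit \<Rightarrow> multipartition \<Rightarrow> int" where
  "mp_eps \<kappa> i \<mu> = int (card (mp_unarced \<kappa> i \<mu> \<inter> removable \<kappa> i \<mu>))"

definition MPK :: "(nat \<Rightarrow> bit) \<Rightarrow> multipartition set" where
  "MPK \<kappa> = {fold (mp_f \<kappa>) is empty_mp | is. True}"

definition MPK_crystal :: "(nat \<Rightarrow> bit) \<Rightarrow> multipartition crystal" where
  "MPK_crystal \<kappa> =
     \<lparr> elems = MPK \<kappa>,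
       wt = (\<lambda>\<mu> j. - mp_cont \<kappa> \<mu> j),
       eps = mp_eps \<kappa>,
       phi = (\<lambda>i \<mu>. mp_eps \<kappa> i \<mu> + coroot_pairing (\<lambda>j. - mp_cont \<kappa> \<mu> j) i),
       e_op = mp_e \<kappa>,
       f_op = (\<lambda>i \<mu>. Some (mp_f \<kappa> i \<mu>)) \<rparr>"


section \<open>Upper ledge diagrams\<close>

text \<open>A diagram is the list of its rows from top to bottom, each given by its length and colour.\<close>

type_synonym diagram = "(nat \<times> bit) list"

definition UL :: "diagram set" where
  "UL = {D. (\<forall>x \<in> set D. 0 < fst x) \<and>
            (\<forall>r. Suc r < length D \<longrightarrow> snd (D ! Suc r) \<noteq> snd (D ! r)) \<and>
            (D = [] \<or> (\<exists>t < length D. sorted_wrt (<) (take (Suc t) (map fst D)) \<and>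
                                    sorted_wrt (\<ge>) (drop t (map fst D))))}"

text \<open>
  To manipulate boxes, diagrams are placed in a grid whose row \<open>\<rho> :: int\<close> (rows are numbered
  downwards) has colour \<^term>\<open>of_int \<rho> :: bit\<close>, the top row being row 0 or row 1 according to its
  colour.  Vertical moves in the grid by an even amount are exactly those preserving colours.
  Conversely, \<open>left_justify\<close> turns a set of boxes of the grid into a diagram by left-justifying all
  rows.
\<close>

type_synonym cell = "int \<times> nat"

definition top_row :: "diagram \<Rightarrow> int" where
  "top_row D = (if snd (hd D) = 0 then 0 else 1)"

definition place :: "int \<Rightarrow> diagram \<Rightarrow> cell set" where
  "place p D = {(p + int r, c) | r c. r < length D \<and> c < fst (D ! r)}"

definition cells :: "diagram \<Rightarrow> cell set" where
  "cells D = place (top_row D) D"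

definition left_justify :: "cell set \<Rightarrow> diagram" where
  "left_justify S = map (\<lambda>\<rho>. (card {c. (\<rho>, c) \<in> S}, of_int \<rho>)) (sorted_list_of_set (fst ` S))"

definition bottom_boxes :: "bit \<Rightarrow> diagram \<Rightarrow> cell set" where
  "bottom_boxes i D = {(\<rho>, c). (\<rho>, c) \<in> cells D \<and> (\<rho> + 1, c) \<notin> cells D \<and> of_int \<rho> = i}"

fun right_of :: "cell \<Rightarrow> cell \<Rightarrow> bool" where
  "right_of (\<rho>, c) (\<rho>', c') \<longleftrightarrow> c' < c"

definition ul_unarced :: "bit \<Rightarrow> diagram \<Rightarrow> cell set" where
  "ul_unarced i D = unarced right_of (bottom_boxes i D) (bottom_boxes (i + 1) D)"

definition uppermost_peak :: "bit \<Rightarrow> diagram \<Rightarrow> nat" where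
  "uppermost_peak i D = (LEAST r. r < length D \<and> snd (D ! r) = i \<and>
      (\<forall>r' < length D. snd (D ! r') = i \<longrightarrow> fst (D ! r') \<le> fst (D ! r)))"

definition ul_f :: "bit \<Rightarrow> diagram \<Rightarrow> diagram" where
  "ul_f i D =
     (if D = [] then [(1, i)]
      else let X = ul_unarced i D \<inter> bottom_boxes (i + 1) D
           in if X \<noteq> {}
              then let (\<rho>, c) = last_box right_of X in left_justify (insert (\<rho> + 1, c) (cells D))
              else let r = uppermost_peak i D in D[r := (fst (D ! r) + 1, i)])"

definition ul_e :: "bit \<Rightarrow> diagram \<Rightarrow> diagram option" where
  "ul_e i D =
     (let R = ul_unarced i D \<inter> bottom_boxes i D
      in if R = {} then None else Some (left_justify (cells D - {first_box right_of R})))"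

definition ul_cont :: "diagram \<Rightarrow> bit \<Rightarrow> int" where
  "ul_cont D i = int (card {(\<rho>, c) \<in> cells D. of_int \<rho> = i})"

definition ul_eps :: "bit \<Rightarrow> diagram \<Rightarrow> int" where
  "ul_eps i D = int (card (ul_unarced i D \<inter> bottom_boxes i D))"

definition UL_crystal :: "diagram crystal" where
  "UL_crystal =
     \<lparr> elems = UL,
       wt = (\<lambda>D j. - ul_cont D j),
       eps = ul_eps,
       phi = (\<lambda>i D. ul_eps i D + coroot_pairing (\<lambda>j. - ul_cont D j) i),
       e_op = ul_e,
       f_op = (\<lambda>i D. Some (ul_f i D)) \<rparr>"


section \<open>Splitting\<close>

text \<open>Only used for lower ledge diagrams, for which the described diagram exists and is unique.\<close>

definition float_diag :: "diagram \<Rightarrow> diagram" where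
  "float_diag D = (THE E. E \<in> UL \<and>
     (\<exists>s. (\<forall>c. even (s c)) \<and> cells E = {(\<rho> + s c, c) | \<rho> c. (\<rho>, c) \<in> cells D}))"

text \<open>
  The uppermost box of colour \<open>i\<close> in the first column is \<open>(Min A, 0)\<close>, so the box \<open>(\<rho>, c)\<close> is weakly
  below the southeast ray from it iff \<open>\<rho> - c \<ge> Min A\<close> (column numbers start at 0).
\<close>

definition split_diag :: "bit \<Rightarrow> diagram \<Rightarrow> diagram \<times> diagram" where
  "split_diag i D =
     (let A = {\<rho>. (\<rho>, 0) \<in> cells D \<and> of_int \<rho> = i}
      in if A = {} then ([], D)
         else let L = {(\<rho>, c). (\<rho>, c) \<in> cells D \<and> \<rho> - int c \<ge> Min A}
              in (left_justify L, float_diag (left_justify (cells D - L))))"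

fun split_seq :: "(nat \<Rightarrow> bit) \<Rightarrow> diagram \<Rightarrow> nat \<Rightarrow> diagram" where
  "split_seq \<kappa> D 0 = fst (split_diag (\<kappa> 0) D)"
| "split_seq \<kappa> D (Suc t) = split_seq (\<kappa> \<circ> Suc) (snd (split_diag (\<kappa> 0) D)) t"

definition top_align :: "diagram \<Rightarrow> (nat \<times> nat) set" where
  "top_align D = {(r, c). r < card {\<rho>. (\<rho>, c) \<in> cells D}}"

definition W_map :: "(nat \<Rightarrow> bit) \<Rightarrow> diagram \<Rightarrow> multipartition" where
  "W_map \<kappa> D = (\<lambda>t. top_align (split_seq \<kappa> D t))"


section \<open>Gluing\<close>

definition width :: "diagram \<Rightarrow> nat" where
  "width D = Max (fst ` set D)"

definition uppermost_peak_row :: "diagram \<Rightarrow> nat" where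
  "uppermost_peak_row D = (LEAST r. r < length D \<and> fst (D ! r) = width D)"

definition column_bottom :: "cell set \<Rightarrow> nat \<Rightarrow> int" where
  "column_bottom S c = Max {\<rho>. (\<rho>, c) \<in> S}"

text \<open>
  For a diagram placed on the cells \<open>S\<close> to the right of a diagram with uppermost peak row \<open>P\<close>,
  \<open>shifted_bottom P S c\<close> is the bottom row of column \<open>c\<close> after the columns have been shifted.
  Column 0 needs no condition on its left neighbour: this is the last column of the other diagram,
  whose bottom box is not above row \<open>P\<close>.
\<close>

fun shifted_bottom :: "int \<Rightarrow> cell set \<Rightarrow> nat \<Rightarrow> int" where
  "shifted_bottom P S 0 =
     (let b = column_bottom S 0
      in if b < P then Max {x \<in> {b..P}. even (x - b)} else b)"
| "shifted_bottom P S (Suc c) =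
     (let b = column_bottom S (Suc c)
      in if \<exists>c' \<le> Suc c. column_bottom S c' < P
         then Max {x \<in> {b..P}. even (x - b) \<and> x \<le> shifted_bottom P S c} else b)"

definition glue :: "diagram \<Rightarrow> diagram \<Rightarrow> diagram" where
  "glue D1 D2 =
     (if D1 = [] then D2 else if D2 = [] then D1
      else let p1 = top_row D1;
               p2 = (if snd (hd D1) = snd (hd D2) then p1 else p1 - 1);
               P = p1 + int (uppermost_peak_row D1);
               S = place p2 D2
           in left_justify (place p1 D1 \<union>
                {(\<rho> + (shifted_bottom P S c - column_bottom S c), width D1 + c) | \<rho> c. (\<rho>, c) \<in> S}))"

definition glue_seq :: "(nat \<Rightarrow> diagram) \<Rightarrow> diagram" where
  "glue_seq Ds =
     (if \<forall>t. Ds t = [] then []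
      else foldr glue (map Ds [0..<Suc (Max {t. Ds t \<noteq> []})]) [])"

text \<open>
  Moving column \<open>c\<close> down by \<open>c\<close> notches takes the box \<open>(r, c)\<close> to row \<open>r + c\<close>.  Its residue
  \<open>\<kappa> t + c - r = \<kappa> t + (r + c)\<close> is the colour of the grid row used below.
\<close>

definition shear :: "bit \<Rightarrow> (nat \<times> nat) set \<Rightarrow> diagram" where
  "shear k Y = left_justify {((if k = 0 then 0 else 1) + int r + int c, c) | r c. (r, c) \<in> Y}"

definition Z_map :: "(nat \<Rightarrow> bit) \<Rightarrow> multipartition \<Rightarrow> diagram" where
  "Z_map \<kappa> \<mu> = glue_seq (\<lambda>t. shear (\<kappa> t) (\<mu> t))"

end

theory Submission
  imports Defs
begin

text \<open>
  Both crystal structures are read off from words of \<open>i\<close>-signatures.  Splitting off the boxes weakly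
  below the ray cuts the bottom boundary of a diagram in two.  Along the part above the ray,
  left-justifying makes each block of columns with bottoms in the same row one column longer; since
  the colours of consecutive blocks alternate, the new letters form adjacent pairs that cancel,
  except for one letter at the end, which is compensated by the addable box in the first empty
  column of the new partition component.  Hence the signature of a diagram is that of the upper part
  followed by that of the component, which is the tensor product rule obeyed by multipartitions, and
  \<open>\<W>\<close> commutes with the crystal operators by induction.  Floating only shifts columns by even
  amounts, so it does not change signatures.  Conversely, gluing moves the columns of the floated
  upper part back to the place they came from, so that \<open>\<Z>\<close> inverts \<open>\<W>\<close>.
\<close>

section \<open>Words with cancelling letters\<close>

text \<open>The two \<open>f\<close> operators treat missing letters \<open>True\<close>
  differently: empty components always offer an addable box, whereas a diagram may have no letter
  \<open>True\<close> left, and then the box goes to a peak row. The rules are reconciled by a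
  possible surplus letter \<open>True\<close> that the comparison of words leaves at the peak row
  and that points to the same place. For this comparison letters are labelled by grid rows, since
  splitting renumbers columns. Splitting need not shrink a diagram: if the first column lacks the
  colour of the charge, nothing is cut off. The induction therefore relies on every colour recurring
  in the multicharge, and the empty diagram needs an argument of its own. The operators
  \<open>e\<close> are never compared directly. On diagrams \<open>f\<close> undoes
  \<open>e\<close>, on multipartitions \<open>e\<close> undoes \<open>f\<close>. The former also
  shows that all diagrams are generated from the empty one, so that their images are Kleshchev.
  Diagrams are handled as functions from integers to row lengths, because even vertical shifts must
  not matter.\<close>

text \<open>
  A word lists boxes in reading order; a letter is \<open>False\<close> where an arc may start and \<open>True\<close> where
  an arc may end.  The function \<open>reduce\<close> returns the unarced boxes of both kinds, as shown in
  \<open>unarced_word\<close> below, where \<open>I\<close> accounts for the infinitely many addable boxes of a multipartition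
  in components that are empty together with all later ones.
\<close>

fun step :: "bool \<times> 'l \<Rightarrow> 'l list \<times> 'l list \<Rightarrow> 'l list \<times> 'l list" where
  "step (b, l) (As, Rs) =
     (if b then if Rs = [] then (As @ [l], []) else (As, butlast Rs) else (As, Rs @ [l]))"

definition reduce :: "(bool \<times> 'l) list \<Rightarrow> 'l list \<times> 'l list" where
  "reduce ws = fold step ws ([], [])"

text \<open>Reading \<open>ws\<close> after a stack \<open>Q\<close> of pending \<open>False\<close>
  letters has the same effect as reading its survivors: the letters \<open>As\<close> first use up
  \<open>Q\<close> from its end, and only what is left of \<open>As\<close> joins
  \<open>P\<close>.\<close>

lemma fold_step:
  assumes "reduce ws = (As, Rs)"
  shows "fold step ws (P, Q) = (P @ drop (length Q) As, take (length Q - length As) Q @ Rs)"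
  using assms
proof (induction ws arbitrary: As Rs rule: rev_induct)
  case Nil
  then show ?case by (simp add: reduce_def)
next
  case (snoc w ws)
  obtain A R where AR: "reduce ws = (A, R)" by fastforce
  obtain b l where w: "w = (b, l)" by fastforce
  have IH: "fold step ws (P, Q) = (P @ drop (length Q) A, take (length Q - length A) Q @ R)"
    using snoc.IH[OF AR] .
  have red: "step w (A, R) = (As, Rs)"
    using snoc.prems AR by (simp add: reduce_def)
  show ?case
  proof (cases "b \<and> R = []")
    case True
    then have 1: "As = A @ [l]" "Rs = []" using red w by auto
    show ?thesis
    proof (cases "length Q \<le> length A")
      case True
      then show ?thesis using 1 IH w \<open>b \<and> R = []\<close> by simp
    next
      case False
      then have "butlast (take (length Q - length A) Q) = take (length Q - Suc (length A)) Q"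
        by (simp add: butlast_take)
      then show ?thesis using 1 IH w \<open>b \<and> R = []\<close> False by auto
    qed
  next
    case False
    then show ?thesis using red IH w by (auto simp: butlast_append split: if_splits)
  qed
qed

lemma reduce_append:
  assumes "reduce u = (P, Q)" "reduce v = (As, Rs)"
  shows "reduce (u @ v) = (P @ drop (length Q) As, take (length Q - length As) Q @ Rs)"
  using fold_step[OF assms(2)] assms(1) by (simp add: reduce_def)

lemma reduce_snoc: "reduce (ws @ [w]) = step w (reduce ws)"
  by (simp add: reduce_def)

lemma reduce_Nil [simp]: "reduce [] = ([], [])"
  by (simp add: reduce_def)

lemma reduce_cancel: "reduce (u @ [(False, x), (True, y)] @ v) = reduce (u @ v)"
  by (cases "fold step u ([], [])") (simp add: reduce_def)

lemma reduce_map: "reduce (map (apsnd g) ws) = map_prod (map g) (map g) (reduce ws)"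
proof (induction ws rule: rev_induct)
  case (snoc w ws)
  then show ?case
    by (cases w; cases "reduce ws") (auto simp: reduce_snoc map_butlast)
qed simp

lemma reduce_labels:
  assumes "reduce ws = (As, Rs)"
  shows "Pair True ` set As \<subseteq> set ws" "Pair False ` set Rs \<subseteq> set ws"
proof -
  have "(\<forall>x \<in> set As. (True, x) \<in> set ws) \<and> (\<forall>x \<in> set Rs. (False, x) \<in> set ws)"
    using assms
  proof (induction ws arbitrary: As Rs rule: rev_induct)
    case (snoc w ws)
    obtain A R where AR: "reduce ws = (A, R)" by fastforce
    obtain b l where w: "w = (b, l)" by fastforce
    have sub: "set (butlast R) \<subseteq> set R" by (auto dest: in_set_butlastD)
    have IH: "\<forall>x \<in> set A. (True, x) \<in> set ws" "\<forall>x \<in> set R. (False, x) \<in> set ws"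
      using snoc.IH[OF AR] by auto
    have "set As \<subseteq> (if b then insert l (set A) else set A)"
      "set Rs \<subseteq> (if b then set R else insert l (set R))"
      using snoc.prems AR w sub by (auto simp: reduce_snoc split: if_splits)
    then show ?case using IH w by (cases b) auto
  qed simp
  then show "Pair True ` set As \<subseteq> set ws" "Pair False ` set Rs \<subseteq> set ws" by auto
qed

lemma reduce_label_set:
  assumes "reduce ws = (As, Rs)"
  shows "set As \<subseteq> snd ` set ws" "set Rs \<subseteq> snd ` set ws"
  using image_mono[OF reduce_labels(1)[OF assms], of snd] image_mono[OF reduce_labels(2)[OF assms], of snd]
  by (simp_all add: image_image)

lemma sorted_reduce:
  assumes "reduce ws = (As, Rs)" "sorted_wrt P (map snd ws)"
  shows "sorted_wrt P As \<and> sorted_wrt P Rs"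
  using assms
proof (induction ws arbitrary: As Rs rule: rev_induct)
  case (snoc w ws)
  obtain A R where AR: "reduce ws = (A, R)" by fastforce
  obtain b l where w: "w = (b, l)" by fastforce
  have *: "sorted_wrt P A \<and> sorted_wrt P R" using snoc.IH[OF AR] snoc.prems by (simp add: sorted_wrt_append)
  have "\<forall>x \<in> snd ` set ws. P x l" using snoc.prems w by (auto simp: sorted_wrt_append)
  moreover have "set A \<subseteq> snd ` set ws" "set R \<subseteq> snd ` set ws" using reduce_label_set[OF AR] by simp_all
  moreover have "sorted_wrt P (butlast R)" using *
    by (cases R rule: rev_cases) (auto simp: sorted_wrt_append)
  ultimately have "\<forall>x \<in> set A. P x l" "\<forall>x \<in> set R. P x l" "sorted_wrt P (butlast R)" by blast+
  then show ?case using * snoc.prems AR w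
    by (auto simp: reduce_snoc sorted_wrt_append split: if_splits)
qed simp

lemma reduce_cons_True:
  assumes "reduce ws = (As, Rs)"
  shows "reduce ((True, l) # ws) = (l # As, Rs)"
  using fold_step[OF assms, of "[l]" "[]"] by (simp add: reduce_def)

text \<open>Survival of \<open>l\<close> means that no \<open>False\<close> letter is pending before
  it, and being the last survivor means that nothing unmatched follows that could cancel it once
  turned around. On words this is the effect of adding a box.\<close>

lemma flip_last:
  assumes "reduce (u @ (True, l) # v) = (As, Rs)" "distinct (map snd (u @ (True, l) # v))"
    "As \<noteq> []" "last As = l"
  shows "reduce (u @ (False, l) # v) = (butlast As, l # Rs)"
proof -
  obtain P Q where u: "reduce u = (P, Q)" by fastforce
  obtain A R where v: "reduce v = (A, R)" by fastforce
  have setA: "set A \<subseteq> snd ` set v" "set P \<subseteq> snd ` set u"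
    using reduce_label_set[OF v] reduce_label_set[OF u] by simp_all
  have e: "reduce (u @ (True, l) # v) = fold step v (step (True, l) (P, Q))"
    using u by (simp add: reduce_def)
  have Q: "Q = []"
  proof (rule ccontr)
    assume "Q \<noteq> []"
    then have "As = P @ drop (length (butlast Q)) A"
      using e assms(1) fold_step[OF v, of P "butlast Q"] by simp
    then have "l \<in> set P \<union> set A"
      using assms(3,4) by (metis Un_iff in_set_dropD last_in_set set_append)
    then show False using setA assms(2) by auto
  qed
  then have As: "As = P @ [l] @ A" and "Rs = R" using e assms(1) fold_step[OF v, of "P @ [l]" "[]"] by simp_all
  have "A = []"
  proof (rule ccontr)
    assume "A \<noteq> []"
    then have "l \<in> set A" using As assms(4) by (metis last_appendR last_in_set append_is_Nil_conv)
    then show False using setA assms(2) by auto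
  qed
  then have "fold step v (P, [l]) = (P, l # R)" using fold_step[OF v, of P "[l]"] by simp
  then show ?thesis using u Q As \<open>A = []\<close> \<open>Rs = R\<close> by (simp add: reduce_def)
qed

text \<open>Dual to \<open>flip_last\<close>, for deleting a box. The second conclusion serves the
  case in which the deleted box was the only one of its column, so that the letter
  disappears.\<close>

lemma flip_first:
  assumes "reduce (u @ (False, l) # v) = (As, Rs)" "distinct (map snd (u @ (False, l) # v))"
    "Rs \<noteq> []" "hd Rs = l"
  shows "reduce (u @ (True, l) # v) = (As @ [l], tl Rs)" "reduce (u @ v) = (As, tl Rs)"
proof -
  obtain P Q where u: "reduce u = (P, Q)" by fastforce
  obtain A R where v: "reduce v = (A, R)" by fastforce
  have setA: "set R \<subseteq> snd ` set v" "set Q \<subseteq> snd ` set u"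
    using reduce_label_set[OF v] reduce_label_set[OF u] by simp_all
  have "reduce (u @ (False, l) # v) = fold step v (P, Q @ [l])"
    using u by (simp add: reduce_def)
  then have As: "As = P @ drop (Suc (length Q)) A"
    and Rs: "Rs = take (Suc (length Q) - length A) (Q @ [l]) @ R"
    using assms(1) fold_step[OF v, of P "Q @ [l]"] by simp_all
  have lA: "length A \<le> length Q"
  proof (rule ccontr)
    assume "\<not> ?thesis"
    then have "Rs = R" using Rs by simp
    then have "l \<in> set R" using assms(3,4) by auto
    then show False using setA assms(2) by auto
  qed
  have Q: "Q = []"
  proof (rule ccontr)
    assume "Q \<noteq> []"
    then have "hd Rs = hd Q" using lA Rs by (cases Q) (auto simp: Suc_diff_le)
    then have "l \<in> set Q" using \<open>Q \<noteq> []\<close> assms(4) by auto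
    then show False using setA assms(2) by auto
  qed
  then have "A = []" using lA by simp
  with Q As Rs show "reduce (u @ (True, l) # v) = (As @ [l], tl Rs)" "reduce (u @ v) = (As, tl Rs)"
    using u v fold_step[OF v, of "P @ [l]" "[]"] fold_step[OF v, of P "[]"]
    by (simp_all add: reduce_def)
qed

text \<open>If \<open>l\<close> were the last survivor, turning it around would let it cancel
  against \<open>l'\<close>, yet \<open>flip_last\<close> makes it survive. Columns ending in the
  same row are consecutive and have equal letters, so a box is only ever added at the left end of
  such a block.\<close>

lemma last_unarced_followed:
  assumes "reduce (u @ [(True, l), (True, l')] @ v) = (As, Rs)"
    "distinct (map snd (u @ [(True, l), (True, l')] @ v))" "As \<noteq> []"
  shows "last As \<noteq> l"
proof
  assume l: "last As = l"
  from flip_last[of u l "(True, l') # v" As Rs] assms l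
  have "reduce (u @ [(False, l), (True, l')] @ v) = (butlast As, l # Rs)" by simp
  then have "reduce (u @ v) = (butlast As, l # Rs)"
    using reduce_cancel[of u l l' v] by simp
  from reduce_label_set(2)[OF this] have "l \<in> snd ` (set u \<union> set v)" by auto
  then show False using assms(2) by auto
qed

text \<open>Mirror image of \<open>last_unarced_followed\<close>: a box is only deleted at the right
  end of a block, where it is the last cell of its row.\<close>

lemma first_unarced_preceded:
  assumes "reduce (u @ [(False, l'), (False, l)] @ v) = (As, Rs)"
    "distinct (map snd (u @ [(False, l'), (False, l)] @ v))" "Rs \<noteq> []"
  shows "hd Rs \<noteq> l"
proof
  assume l: "hd Rs = l"
  from flip_first(1)[of "u @ [(False, l')]" l v As Rs] assms l
  have "reduce (u @ [(False, l'), (True, l)] @ v) = (As @ [l], tl Rs)" by simp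
  then have "reduce (u @ v) = (As @ [l], tl Rs)"
    using reduce_cancel[of u l' l v] by simp
  from reduce_label_set(1)[OF this] have "l \<in> snd ` (set u \<union> set v)" by auto
  then show False using assms(2) by auto
qed

lemma word_cases:
  "(\<exists>u x y v. ws = u @ [(False, x), (True, y)] @ v) \<or> (\<exists>a r. ws = map (Pair True) a @ map (Pair False) r)"
proof (induction ws)
  case (Cons w ws)
  obtain b l where w: "w = (b, l)" by fastforce
  from Cons consider (1) u x y v where "ws = u @ [(False, x), (True, y)] @ v"
    | (2) a r where "ws = map (Pair True) a @ map (Pair False) r" by blast
  then show ?case
  proof cases
    case 1
    then have "w # ws = (w # u) @ [(False, x), (True, y)] @ v" by simp
    then show ?thesis by blast
  next
    case 2
    show ?thesis
    proof (cases b)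
      case True
      then have "w # ws = map (Pair True) (l # a) @ map (Pair False) r" using 2 w by simp
      then show ?thesis by blast
    next
      case False
      show ?thesis
      proof (cases a)
        case Nil
        then have "w # ws = map (Pair True) [] @ map (Pair False) (l # r)" using 2 w False by simp
        then show ?thesis by blast
      next
        case (Cons y a')
        then have "w # ws = [] @ [(False, l), (True, y)] @ (map (Pair True) a' @ map (Pair False) r)"
          using 2 w False by simp
        then show ?thesis by blast
      qed
    qed
  qed
qed auto

lemma reduce_sorted_word: "reduce (map (Pair True) a @ map (Pair False) r) = (a, r)"
proof -
  have "reduce (map (Pair True) a) = (a, [])" for a :: "'a list"
    by (induction a rule: rev_induct) (auto simp: reduce_snoc)
  moreover have "reduce (map (Pair False) r) = ([], r)" for r :: "'a list"
    by (induction r rule: rev_induct) (auto simp: reduce_snoc)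
  ultimately show ?thesis using reduce_append by fastforce
qed

text \<open>Erasing the letters arced so far does not change \<open>reduce\<close>, because an arc
  joins letters that are adjacent in the remaining word, and the survivors are what remains when no
  arc can be drawn. Boxes in \<open>I\<close> precede every letter, so they neither receive an arc
  nor lie under one.\<close>

lemma unarced_word:
  assumes sorted: "sorted_wrt prec (map snd ws)" and dist: "distinct (map snd ws)"
    and A: "A = {l. (False, l) \<in> set ws}" and B: "B = I \<union> {l. (True, l) \<in> set ws}"
    and I: "\<And>x y. x \<in> I \<Longrightarrow> y \<in> snd ` set ws \<Longrightarrow> prec x y \<and> x \<noteq> y"
    and asym: "\<And>x y. prec x y \<Longrightarrow> \<not> prec y x"
    and red: "reduce ws = (As, Rs)"
  shows "unarced prec A B = I \<union> set As \<union> set Rs"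
proof -
  let ?f = "\<lambda>E. filter (\<lambda>w. snd w \<notin> Field E) ws"
  have fl: "distinct (map snd (?f E))" "sorted_wrt prec (map snd (?f E))" for E :: "('a \<times> 'a) set"
    using dist sorted by (simp_all add: distinct_map_filter sorted_wrt_map sorted_wrt_filter)
  have AB: "A \<union> B = I \<union> snd ` set ws"
  proof -
    have "l \<in> snd ` set ws \<longleftrightarrow> (False, l) \<in> set ws \<or> (True, l) \<in> set ws" for l
    proof
      assume "l \<in> snd ` set ws"
      then obtain b where "(b, l) \<in> set ws" by auto
      then show "(False, l) \<in> set ws \<or> (True, l) \<in> set ws" by (cases b) auto
    qed force
    then have "snd ` set ws = {l. (False, l) \<in> set ws} \<union> {l. (True, l) \<in> set ws}" by blast
    then show ?thesis using A B by auto
  qed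
  have inv: "Field E \<subseteq> snd ` set ws \<and> reduce (?f E) = reduce ws" if "drawn prec A B E" for E
    using that
  proof induction
    case (arc E u v)
    have uw: "(False, u) \<in> set ws" using arc A by auto
    have vI: "v \<notin> I" using I[of v u] uw asym[of u v] arc.hyps(4) by force
    then have vw: "(True, v) \<in> set ws" using arc B by auto
    have "(False, u) \<in> set (?f E)" "(True, v) \<in> set (?f E)" using uw vw arc.hyps by auto
    from split_list[OF this(1)] obtain x y' where xy: "?f E = x @ (False, u) # y'" by blast
    have sx: "\<forall>w \<in> set x. prec (snd w) u" "\<forall>w \<in> set y'. prec u (snd w)"
      using fl(2)[of E] unfolding xy by (auto simp: sorted_wrt_append)
    have "(True, v) \<in> set y'"
    proof -
      have "(True, v) \<in> set x \<union> {(False, u)} \<union> set y'"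
        using \<open>(True, v) \<in> set (?f E)\<close> unfolding xy by auto
      moreover have "(True, v) \<notin> set x" using sx(1) asym arc.hyps(4) by fastforce
      ultimately show ?thesis by auto
    qed
    from split_list[OF this] obtain y z where yz: "y' = y @ (True, v) # z" by blast
    \<comment> \<open>A letter between \<open>u\<close> and \<open>v\<close> would be an unarced box
      under the new arc, so the two letters are adjacent once the arced ones are erased.\<close>
    have "y = []"
    proof (rule ccontr)
      assume "y \<noteq> []"
      then obtain w where w: "w \<in> set y" by (cases y) auto
      have "prec u (snd w)" using sx(2) w yz by auto
      moreover have "prec (snd w) v" using fl(2)[of E] w unfolding xy yz by (auto simp: sorted_wrt_append)
      moreover have wf: "w \<in> set (?f E)" using w xy yz by simp
      moreover have "snd w \<in> A \<union> B" using wf AB by auto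
      ultimately have "snd w \<in> Field E" using arc.hyps(5) by blast
      then show False using wf by simp
    qed
    then have xz: "?f E = x @ [(False, u), (True, v)] @ z" using xy yz by simp
    have "?f (insert (u, v) E) = filter (\<lambda>w. snd w \<noteq> u \<and> snd w \<noteq> v) (?f E)"
      by (auto simp: Field_def Domain_iff Range_iff intro!: filter_cong)
    also have "\<dots> = x @ z"
    proof -
      have "u \<notin> snd ` (set x \<union> set z)" "v \<notin> snd ` (set x \<union> set z)" using fl(1)[of E] unfolding xz by auto
      then have "\<forall>w \<in> set x \<union> set z. snd w \<noteq> u \<and> snd w \<noteq> v" by auto
      then show ?thesis unfolding xz by simp
    qed
    finally have "reduce (?f (insert (u, v) E)) = reduce ws"
      using arc.IH xz reduce_cancel[of x u v z] by simp
    moreover have "Field (insert (u, v) E) \<subseteq> snd ` set ws" using arc.IH uw vw by force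
    ultimately show ?case by blast
  qed simp
  have in1: "I \<union> set As \<union> set Rs \<subseteq> unarced prec A B"
  proof -
    have "x \<notin> Field E" if "drawn prec A B E" "x \<in> I \<union> set As \<union> set Rs" for x E
    proof (cases "x \<in> I")
      case True
      then show ?thesis using inv[OF that(1)] I by blast
    next
      case False
      then have "x \<in> set As \<union> set Rs" using that by auto
      moreover have "reduce (?f E) = (As, Rs)" using inv[OF that(1)] red by simp
      ultimately have "x \<in> snd ` set (?f E)" using reduce_label_set[of "?f E" As Rs] by blast
      then show ?thesis by auto
    qed
    moreover have "I \<union> set As \<union> set Rs \<subseteq> A \<union> B" using reduce_label_set[OF red] AB by blast
    ultimately show ?thesis unfolding unarced_def by blast
  qed
  \<comment> \<open>Each arc shortens the remaining word, so drawing ends, and it can only end at a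
    word in which no \<open>False\<close> is directly followed by \<open>True\<close>.\<close>
  have "\<exists>E. drawn prec A B E \<and> (\<exists>a r. ?f E = map (Pair True) a @ map (Pair False) r)"
  proof -
    have "\<exists>E'. drawn prec A B E' \<and> (\<exists>a r. ?f E' = map (Pair True) a @ map (Pair False) r)"
      if "drawn prec A B E" for E
      using that
    proof (induction "length (?f E)" arbitrary: E rule: less_induct)
      case less
      show ?case
      proof (cases "\<exists>a r. ?f E = map (Pair True) a @ map (Pair False) r")
        case True
        then show ?thesis using less by blast
      next
        case False
        then obtain x u v z where xz: "?f E = x @ [(False, u), (True, v)] @ z"
          using word_cases[of "?f E"] by blast
        have uv: "(False, u) \<in> set (?f E)" "(True, v) \<in> set (?f E)" unfolding xz by simp_all
        have puv: "prec u v" using fl(2)[of E] unfolding xz by (simp add: sorted_wrt_append)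
        have d: "drawn prec A B (insert (u, v) E)"
        proof (rule drawn.arc[OF less.prems])
          show "u \<in> A - Field E" "v \<in> B - Field E" using uv A B by auto
          show "prec u v" by fact
          fix w assume w: "w \<in> A \<union> B" "prec u w" "prec w v"
          show "w \<in> Field E"
          proof (rule ccontr)
            assume nf: "w \<notin> Field E"
            have "w \<notin> I" using I[of w u] asym[of w u] w uv by force
            then have "w \<in> snd ` set (?f E)" using w AB nf by auto
            then have "w \<in> snd ` set x \<union> {u, v} \<union> snd ` set z" unfolding xz by auto
            moreover have "\<forall>y \<in> snd ` set x. prec y u" "\<forall>y \<in> snd ` set z. prec v y"
              using fl(2)[of E] unfolding xz by (auto simp: sorted_wrt_append)
            ultimately show False using w asym by blast
          qed
        qed
        have "?f (insert (u, v) E) = filter (\<lambda>w. snd w \<noteq> u \<and> snd w \<noteq> v) (?f E)"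
          by (auto simp: Field_def Domain_iff Range_iff intro!: filter_cong)
        then have "length (?f (insert (u, v) E)) < length (?f E)"
          using uv(1) by (simp del: filter_filter add: length_filter_less[of "(False, u)"])
        from less.hyps[OF this d] show ?thesis .
      qed
    qed
    from this[OF drawn.start] show ?thesis .
  qed
  then obtain E a r where E: "drawn prec A B E" "?f E = map (Pair True) a @ map (Pair False) r" by blast
  have "(As, Rs) = (a, r)" using inv[OF E(1)] red E(2) reduce_sorted_word[of a r] by simp
  then have "snd ` set (?f E) = set As \<union> set Rs" unfolding E(2) by force
  moreover have "x \<notin> Field E" if "x \<in> unarced prec A B" for x
    using that E(1) unfolding unarced_def by blast
  moreover have "x \<in> I \<or> x \<in> snd ` set ws" if "x \<in> unarced prec A B" for x
    using that AB unfolding unarced_def by blast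
  moreover have "x \<in> snd ` set (?f E)" if "x \<notin> Field E" "x \<in> snd ` set ws" for x
    using that by auto
  ultimately have "unarced prec A B \<subseteq> I \<union> set As \<union> set Rs" by blast
  with in1 show ?thesis by blast
qed


section \<open>Colours of grid rows as parities\<close>

declare add_bit_eq_xor [simp del] mult_bit_eq_and [simp del] minus_bit_def [simp del]

lemma of_int_bit: "(of_int a :: bit) = of_bool (odd a)"
proof (cases "even a")
  case True
  then obtain b where "a = 2 * b" by blast
  then have "(of_int a :: bit) = 2 * of_int b" by (simp only: of_int_mult of_int_numeral)
  then show ?thesis using True by simp
next
  case False
  then obtain b where "a = 2 * b + 1" by (blast elim: oddE)
  then have "(of_int a :: bit) = 2 * of_int b + 1"
    by (simp only: of_int_mult of_int_add of_int_1 of_int_numeral)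
  then show ?thesis using False by simp
qed

lemma of_int_bit_eq_iff: "(of_int a :: bit) = of_int b \<longleftrightarrow> even (a - b)"
  unfolding of_int_bit by auto

lemma bit_add_one: "(0 :: bit) + 1 = 1" "(1 :: bit) + 1 = 0"
  by (simp_all only: one_add_one bit_2_eq_0 add_0)

lemma bit_neq_iff: "(x :: bit) \<noteq> i \<longleftrightarrow> x = i + 1"
  by (cases x; cases i) (simp_all add: bit_add_one)

lemma of_int_bit_succ: "(of_int (r + 1) :: bit) = of_int r + 1"
  by (simp only: of_int_add of_int_1)

lemma of_int_bit_succ_eq_iff: "(of_int (r + 1) :: bit) = i \<longleftrightarrow> of_int r \<noteq> i"
  unfolding of_int_bit by (cases i) auto

lemma of_int_bit_pred_eq_iff: "(of_int (r - 1) :: bit) = i \<longleftrightarrow> of_int r \<noteq> i"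
  unfolding of_int_bit by (cases i) auto

section \<open>Row length functions\<close>

text \<open>
  A function \<open>N\<close> assigns to each grid row its length; \<open>rows_diagram N\<close> only depends on \<open>N\<close> up to even
  vertical shifts.  The peak \<open>t\<close> in \<open>upper N t\<close> and \<open>lower N t\<close> is the uppermost respectively the
  lowermost peak row, so that truncating \<open>N\<close> along the ray preserves it.
\<close>

definition cells_of :: "(int \<Rightarrow> nat) \<Rightarrow> cell set" where
  "cells_of N = {(r, c). c < N r}"

definition rows_diagram :: "(int \<Rightarrow> nat) \<Rightarrow> diagram" where
  "rows_diagram N = map (\<lambda>r. (N r, of_int r)) (sorted_list_of_set {r. 0 < N r})"

definition shift_rows :: "int \<Rightarrow> (int \<Rightarrow> nat) \<Rightarrow> int \<Rightarrow> nat" where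
  "shift_rows d N = (\<lambda>r. N (r - d))"

definition unimodal :: "(int \<Rightarrow> nat) \<Rightarrow> int \<Rightarrow> bool" where
  "unimodal N t \<longleftrightarrow> finite {r. 0 < N r} \<and> (\<forall>r < t. N r \<le> N (r + 1)) \<and> (\<forall>r \<ge> t. N (r + 1) \<le> N r)"

definition upper :: "(int \<Rightarrow> nat) \<Rightarrow> int \<Rightarrow> bool" where
  "upper N t \<longleftrightarrow> finite {r. 0 < N r} \<and> (\<forall>r < t. N r = 0 \<or> N r < N (r + 1)) \<and> (\<forall>r \<ge> t. N (r + 1) \<le> N r)"

definition lower :: "(int \<Rightarrow> nat) \<Rightarrow> int \<Rightarrow> bool" where
  "lower N t \<longleftrightarrow> finite {r. 0 < N r} \<and> (\<forall>r < t. N r \<le> N (r + 1)) \<and> (\<forall>r \<ge> t. N (r + 1) = 0 \<or> N (r + 1) < N r)"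

definition col_top :: "(int \<Rightarrow> nat) \<Rightarrow> nat \<Rightarrow> int" where
  "col_top N c = Min {r. c < N r}"

definition col_bot :: "(int \<Rightarrow> nat) \<Rightarrow> nat \<Rightarrow> int" where
  "col_bot N c = Max {r. c < N r}"

lemma upper_unimodal: "upper N t \<Longrightarrow> unimodal N t"
  unfolding upper_def unimodal_def by fastforce

lemma lower_unimodal: "lower N t \<Longrightarrow> unimodal N t"
  unfolding lower_def unimodal_def by fastforce

lemma unimodal_finite: "unimodal N t \<Longrightarrow> finite {r. 0 < N r}"
  by (simp add: unimodal_def)

lemma unimodal_up:
  assumes "unimodal N t" "r \<le> r'" "r' \<le> t"
  shows "N r \<le> N r'"
  using assms(2,3)
proof (induction r' rule: int_ge_induct)
  case (step i)
  then have "N i \<le> N (i + 1)" using assms(1) by (simp add: unimodal_def)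
  with step show ?case by simp
qed simp

lemma unimodal_down:
  assumes "unimodal N t" "t \<le> r" "r \<le> r'"
  shows "N r' \<le> N r"
  using assms(3)
proof (induction r' rule: int_ge_induct)
  case (step i)
  then have "N (i + 1) \<le> N i" using assms(1,2) by (simp add: unimodal_def)
  with step show ?case by simp
qed simp

lemma unimodal_le: "unimodal N t \<Longrightarrow> N r \<le> N t"
  using unimodal_up[of N t r t] unimodal_down[of N t t r] by (cases "r \<le> t") auto

lemma column_finite: "unimodal N t \<Longrightarrow> finite {r. c < N r}"
  by (rule finite_subset[OF _ unimodal_finite]) auto

text \<open>Row lengths grow up to row \<open>t\<close> and shrink from there on, so every column is
  an interval through row \<open>t\<close>, described by its top and its bottom.\<close>

lemma column_iff:
  assumes N: "unimodal N t" and c: "c < N t"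
  shows "col_top N c \<le> t" "t \<le> col_bot N c" "c < N r \<longleftrightarrow> col_top N c \<le> r \<and> r \<le> col_bot N c"
proof -
  have fin: "finite {r. c < N r}" "{r. c < N r} \<noteq> {}" using column_finite[OF N] c by auto
  show 1: "col_top N c \<le> t" "t \<le> col_bot N c" unfolding col_top_def col_bot_def using fin c by auto
  have m: "c < N (col_top N c)" "c < N (col_bot N c)"
    using Min_in[OF fin] Max_in[OF fin] unfolding col_top_def col_bot_def by auto
  show "c < N r \<longleftrightarrow> col_top N c \<le> r \<and> r \<le> col_bot N c"
  proof
    assume "c < N r"
    then show "col_top N c \<le> r \<and> r \<le> col_bot N c" unfolding col_top_def col_bot_def using fin by auto
  next
    assume r: "col_top N c \<le> r \<and> r \<le> col_bot N c"
    show "c < N r"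
    proof (cases "r \<le> t")
      case True
      then show ?thesis using unimodal_up[OF N, of "col_top N c" r] r m by simp
    next
      case False
      then show ?thesis using unimodal_down[OF N, of r "col_bot N c"] r m by simp
    qed
  qed
qed

lemma bot_in: "unimodal N t \<Longrightarrow> c < N t \<Longrightarrow> c < N (col_bot N c)"
  using column_iff by fastforce

lemma top_in: "unimodal N t \<Longrightarrow> c < N t \<Longrightarrow> c < N (col_top N c)"
  using column_iff by fastforce

lemma bot_succ: "unimodal N t \<Longrightarrow> c < N t \<Longrightarrow> N (col_bot N c + 1) \<le> c"
  using column_iff(3)[of N t c "col_bot N c + 1"] by simp

lemma bot_eqI:
  assumes "unimodal N t" "c < N r" "N (r + 1) \<le> c" "t \<le> r"
  shows "col_bot N c = r"
proof -
  have c: "c < N t" using unimodal_le[OF assms(1), of r] assms(2) by simp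
  have "r \<le> col_bot N c" using column_iff(3)[OF assms(1) c, of r] assms(2) by simp
  moreover have "\<not> r + 1 \<le> col_bot N c"
    using column_iff(3)[OF assms(1) c, of "r + 1"] column_iff(1)[OF assms(1) c] assms(3,4) by auto
  ultimately show ?thesis by simp
qed

lemma bot_antimono:
  assumes "unimodal N t" "c \<le> c'" "c' < N t"
  shows "col_bot N c' \<le> col_bot N c"
  using bot_in[OF assms(1,3)] column_iff(3)[OF assms(1), of c "col_bot N c'"] assms by simp

lemma top_mono:
  assumes "unimodal N t" "c \<le> c'" "c' < N t"
  shows "col_top N c \<le> col_top N c'"
  using top_in[OF assms(1,3)] column_iff(3)[OF assms(1), of c "col_top N c'"] assms by simp

lemma unimodal_support:
  assumes "unimodal N t" "0 < N t"
  shows "{r. 0 < N r} = {col_top N 0..col_bot N 0}"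
proof (rule set_eqI)
  show "r \<in> {r. 0 < N r} \<longleftrightarrow> r \<in> {col_top N 0..col_bot N 0}" for r
    unfolding mem_Collect_eq atLeastAtMost_iff by (rule column_iff(3)[OF assms])
qed

lemma unimodal_zero:
  assumes "unimodal N t" "N t = 0"
  shows "N = (\<lambda>_. 0)"
  using unimodal_le[OF assms(1)] assms(2) by (auto simp: fun_eq_iff)

section \<open>Passing between diagrams, sets of cells and row lengths\<close>

lemma finite_cells_of: "finite {r. 0 < N r} \<Longrightarrow> finite (cells_of N)"
proof -
  assume fin: "finite {r. 0 < N r}"
  have "cells_of N = (SIGMA r:{r. 0 < N r}. {..<N r})" by (auto simp: cells_of_def)
  then show ?thesis using fin by simp
qed

lemma sorted_list_of_set_atLeastAtMost_int: "sorted_list_of_set {a..b :: int} = [a..b]"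
  using sorted_list_of_set.idem_if_sorted_distinct[of "[a..b]"] by simp

lemma rows_diagram_interval:
  assumes "{r. 0 < N r} = {a..b}"
  shows "rows_diagram N = map (\<lambda>r. (N r, of_int r)) [a..b]"
  unfolding rows_diagram_def assms sorted_list_of_set_atLeastAtMost_int ..

lemma rows_diagram_zero [simp]: "rows_diagram (\<lambda>_. 0) = []"
  by (simp add: rows_diagram_def)

lemma rows_diagram_single: "rows_diagram ((\<lambda>_. 0)(r := Suc n)) = [(Suc n, of_int r)]"
proof -
  have "{ra. 0 < ((\<lambda>_. 0)(r := Suc n)) ra} = {r..r}" by (auto split: if_splits)
  from rows_diagram_interval[OF this] show ?thesis by (simp del: fun_upd_apply) simp
qed

lemma rows_diagram_shift:
  assumes "finite {r. 0 < N r}" "even d"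
  shows "rows_diagram (shift_rows d N) = rows_diagram N"
proof -
  have s: "{r. 0 < shift_rows d N r} = (\<lambda>r. r + d) ` {r. 0 < N r}"
    by (auto simp: shift_rows_def image_iff intro!: exI[of _ "x - d" for x])
  have "sorted_list_of_set {r. 0 < shift_rows d N r} = map (\<lambda>r. r + d) (sorted_list_of_set {r. 0 < N r})"
    (is "_ = ?l")
  proof -
    have "sorted ?l" "distinct ?l"
      using assms(1) by (auto simp: sorted_map distinct_map inj_on_def intro: sorted_wrt_mono_rel[OF _ sorted_list_of_set(2)])
    moreover have "set ?l = {r. 0 < shift_rows d N r}" unfolding s using assms(1) by simp
    ultimately show ?thesis by (metis sorted_list_of_set.idem_if_sorted_distinct)
  qed
  moreover have "(of_int (r + d) :: bit) = of_int r" for r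
    unfolding of_int_bit_eq_iff using assms(2) by simp
  ultimately show ?thesis unfolding rows_diagram_def by (simp add: comp_def shift_rows_def del: of_int_add)
qed

lemma left_justify_eq:
  assumes "finite S"
  shows "left_justify S = rows_diagram (\<lambda>r. card {c. (r, c) \<in> S})"
proof -
  have fin: "finite {c. (r, c) \<in> S}" for r
    by (rule finite_subset[OF _ finite_imageI[OF assms, of snd]]) force
  have "fst ` S = {r. 0 < card {c. (r, c) \<in> S}}"
    by (force simp: card_gt_0_iff fin image_iff)
  then show ?thesis unfolding left_justify_def rows_diagram_def by simp
qed

lemma left_justify_cells_of:
  assumes "finite {r. 0 < N r}"
  shows "left_justify (cells_of N) = rows_diagram N"
  using left_justify_eq[OF finite_cells_of[OF assms]] by (simp add: cells_of_def)

definition row_lengths :: "diagram \<Rightarrow> int \<Rightarrow> nat" where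
  "row_lengths D r =
     (if top_row D \<le> r \<and> r < top_row D + int (length D) then fst (D ! nat (r - top_row D)) else 0)"

lemma place_eq: "place p D = cells_of (shift_rows (p - top_row D) (row_lengths D))"
proof -
  have "(r, c) \<in> place p D \<longleftrightarrow> c < shift_rows (p - top_row D) (row_lengths D) r" for r c
  proof
    assume "(r, c) \<in> place p D"
    then show "c < shift_rows (p - top_row D) (row_lengths D) r"
      by (auto simp: place_def shift_rows_def row_lengths_def)
  next
    assume *: "c < shift_rows (p - top_row D) (row_lengths D) r"
    then have "r = p + int (nat (r - p)) \<and> nat (r - p) < length D \<and> c < fst (D ! nat (r - p))"
      by (auto simp: shift_rows_def row_lengths_def split: if_splits)
    then show "(r, c) \<in> place p D" unfolding place_def by blast
  qed
  then show ?thesis by (auto simp: cells_of_def)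
qed

lemma cells_eq: "cells D = cells_of (row_lengths D)"
  unfolding cells_def place_eq by (simp add: shift_rows_def)

lemma row_lengths_Nil [simp]: "row_lengths [] = (\<lambda>_. 0)"
  by (simp add: row_lengths_def fun_eq_iff)

lemma finite_row_lengths: "finite {r. 0 < row_lengths D r}"
  by (rule finite_subset[of _ "{top_row D..top_row D + int (length D)}"])
    (auto simp: row_lengths_def split: if_splits)

lemma of_int_top_row: "of_int (top_row D) = snd (hd D)"
  by (cases "snd (hd D)") (simp_all add: top_row_def)

lemma UL_colour:
  assumes "D \<in> UL" "r < length D"
  shows "snd (D ! r) = of_int (top_row D + int r)"
  using assms(2)
proof (induction r)
  case 0
  then show ?case by (simp add: of_int_top_row hd_conv_nth)
next
  case (Suc r)
  then have "snd (D ! Suc r) \<noteq> snd (D ! r)" using assms(1) unfolding UL_def by blast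
  then have "snd (D ! Suc r) = snd (D ! r) + 1" unfolding bit_neq_iff .
  then show ?case using Suc of_int_bit_succ[of "top_row D + int r"] by (simp add: algebra_simps del: of_int_add)
qed

lemma UL_support:
  assumes "D \<in> UL"
  shows "{r. 0 < row_lengths D r} = {top_row D..top_row D + int (length D) - 1}"
  using assms by (auto simp: row_lengths_def UL_def split: if_splits)

lemma UL_rows_diagram:
  assumes "D \<in> UL"
  shows "rows_diagram (row_lengths D) = D"
proof -
  have "map (\<lambda>r. (row_lengths D r, of_int r)) [top_row D..top_row D + int (length D) - 1] = D"
  proof (rule nth_equalityI)
    show "length (map (\<lambda>r. (row_lengths D r, of_int r :: bit)) [top_row D..top_row D + int (length D) - 1]) = length D"
      by simp
  next
    fix i assume "i < length (map (\<lambda>r. (row_lengths D r, of_int r :: bit)) [top_row D..top_row D + int (length D) - 1])"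
    then have i: "i < length D" by simp
    then show "map (\<lambda>r. (row_lengths D r, of_int r)) [top_row D..top_row D + int (length D) - 1] ! i = D ! i"
      using UL_colour[OF assms i] by (simp add: row_lengths_def prod_eq_iff del: of_int_add)
  qed
  then show ?thesis using rows_diagram_interval[OF UL_support[OF assms]] by simp
qed

lemma UL_upper:
  assumes "D \<in> UL"
  obtains t where "upper (row_lengths D) t" "D \<noteq> [] \<Longrightarrow> top_row D \<le> t" "D \<noteq> [] \<Longrightarrow> 0 < row_lengths D t"
proof (cases "D = []")
  case True
  then show ?thesis using that[of 0] by (simp add: upper_def)
next
  case False
  then obtain t where t: "t < length D" "sorted_wrt (<) (take (Suc t) (map fst D))"
    "sorted_wrt (\<ge>) (drop t (map fst D))" using assms by (auto simp: UL_def)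
  let ?N = "row_lengths D" and ?a = "top_row D"
  have N: "?N (?a + int j) = fst (D ! j)" if "j < length D" for j using that by (simp add: row_lengths_def)
  have N0: "?N r = 0" if "r < ?a \<or> r \<ge> ?a + int (length D)" for r using that by (auto simp: row_lengths_def)
  have up: "fst (D ! j) < fst (D ! Suc j)" if "j < t" for j
    using t(1,2) that unfolding sorted_wrt_iff_nth_less by (auto dest!: spec[of _ j] spec[of _ "Suc j"])
  have down: "fst (D ! j) \<ge> fst (D ! Suc j)" if "t \<le> j" "Suc j < length D" for j
  proof -
    have "fst (D ! (t + (j - t))) \<ge> fst (D ! (t + Suc (j - t)))"
      using t(1,3) that unfolding sorted_wrt_iff_nth_less
      by (simp del: add_Suc_right Nat.add_diff_assoc le_add_diff_inverse)
    then show ?thesis using that by simp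
  qed
  have "upper ?N (?a + int t)"
    unfolding upper_def
  proof (intro conjI allI impI)
    show "finite {r. 0 < ?N r}" by (rule finite_row_lengths)
  next
    fix r assume r: "r < ?a + int t"
    show "?N r = 0 \<or> ?N r < ?N (r + 1)"
    proof (cases "r < ?a")
      case False
      then obtain j where j: "r = ?a + int j" by (metis zle_iff_zadd not_less)
      then show ?thesis using N[of j] N[of "Suc j"] up[of j] r t(1) by (simp add: algebra_simps)
    qed (simp add: N0)
  next
    fix r assume r: "?a + int t \<le> r"
    show "?N (r + 1) \<le> ?N r"
    proof (cases "r + 1 < ?a + int (length D)")
      case True
      obtain j where j: "r = ?a + int j" using r by (metis zle_iff_zadd add.assoc of_nat_add)
      then show ?thesis using N[of j] N[of "Suc j"] down[of j] r True by (simp add: algebra_simps)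
    qed (simp add: N0)
  qed
  moreover have "0 < ?N (?a + int t)" using N[OF t(1)] assms t(1) by (auto simp: UL_def)
  ultimately show ?thesis using that[of "?a + int t"] by simp
qed

lemma rows_diagram_nth:
  assumes "{r. 0 < N r} = {a..b}" "j < length (rows_diagram N)"
  shows "rows_diagram N ! j = (N (a + int j), of_int (a + int j))"
  using assms(2) unfolding rows_diagram_interval[OF assms(1)] by simp

text \<open>The list of rows forgets where \<open>N\<close> sits in the grid; the colour of the top
  row recovers its height modulo 2 only, hence the even \<open>d\<close>.\<close>

lemma row_lengths_rows_diagram:
  assumes "unimodal N t"
  shows "\<exists>d. even d \<and> row_lengths (rows_diagram N) = shift_rows d N \<and>
     (0 < N t \<longrightarrow> top_row (rows_diagram N) = col_top N 0 + d)"
proof (cases "N t = 0")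
  case True
  then have "N = (\<lambda>_. 0)" using unimodal_zero assms by blast
  then show ?thesis by (intro exI[of _ 0]) (simp add: shift_rows_def)
next
  case False
  let ?D = "rows_diagram N" and ?a = "col_top N 0" and ?b = "col_bot N 0"
  have s: "{r. 0 < N r} = {?a..?b}" using unimodal_support assms False by simp
  have ab: "?a \<le> ?b" using column_iff(1,2)[OF assms, of 0] False by simp
  have D: "?D = map (\<lambda>r. (N r, of_int r)) [?a..?b]" using rows_diagram_interval[OF s] .
  have len: "int (length ?D) = ?b - ?a + 1" unfolding D using ab by simp
  have ne: "?D \<noteq> []" using len ab by auto
  have "hd ?D = (N ?a, of_int ?a)" unfolding D using ab by (simp add: upto.simps[of ?a ?b])
  then have "of_int (top_row ?D) = (of_int ?a :: bit)" using of_int_top_row[of ?D] by simp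
  then have ev: "even (top_row ?D - ?a)" unfolding of_int_bit_eq_iff .
  have "row_lengths ?D r = shift_rows (top_row ?D - ?a) N r" for r
  proof (cases "top_row ?D \<le> r \<and> r < top_row ?D + int (length ?D)")
    case True
    then have "nat (r - top_row ?D) < length ?D" by auto
    from rows_diagram_nth[OF s this] True show ?thesis
      by (simp add: row_lengths_def shift_rows_def algebra_simps)
  next
    case False
    then have "r - (top_row ?D - ?a) \<notin> {?a..?b}" using len by auto
    then have "N (r - (top_row ?D - ?a)) = 0" unfolding s[symmetric] by simp
    then show ?thesis using False by (auto simp: row_lengths_def shift_rows_def)
  qed
  then show ?thesis using ev by (intro exI[of _ "top_row ?D - ?a"]) auto
qed

lemma upper_shift: "upper N t \<Longrightarrow> upper (shift_rows d N) (t + d)"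
proof -
  assume N: "upper N t"
  have "{r. 0 < shift_rows d N r} = (\<lambda>r. r + d) ` {r. 0 < N r}"
    by (auto simp: shift_rows_def image_iff intro!: exI[of _ "x - d" for x])
  then have "finite {r. 0 < shift_rows d N r}" using N by (simp add: upper_def)
  moreover have "r - d + 1 = r + 1 - d" for r by simp
  ultimately show ?thesis using N unfolding upper_def shift_rows_def
    by (smt (verit))
qed

lemma upper_rows_diagram:
  assumes "upper N t"
  shows "rows_diagram N \<in> UL"
proof (cases "N t = 0")
  case True
  then have "N = (\<lambda>_. 0)" using unimodal_zero upper_unimodal assms by blast
  then show ?thesis by (simp add: UL_def)
next
  case False
  note uni = upper_unimodal[OF assms]
  let ?D = "rows_diagram N" and ?a = "col_top N 0" and ?b = "col_bot N 0"
  have s: "{r. 0 < N r} = {?a..?b}" using unimodal_support[OF uni] False by simp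
  have ab: "?a \<le> t" "t \<le> ?b" using column_iff(1,2)[OF uni, of 0] False by auto
  have len: "int (length ?D) = ?b - ?a + 1" unfolding rows_diagram_interval[OF s] using ab by simp
  note nth = rows_diagram_nth[OF s]
  have "\<forall>x \<in> set ?D. 0 < fst x"
    unfolding rows_diagram_interval[OF s] using s by auto
  moreover have "\<forall>r. Suc r < length ?D \<longrightarrow> snd (?D ! Suc r) \<noteq> snd (?D ! r)"
  proof (intro allI impI)
    fix r assume r: "Suc r < length ?D"
    have "(of_int (?a + int r + 1) :: bit) \<noteq> of_int (?a + int r)" unfolding of_int_bit_eq_iff by simp
    then show "snd (?D ! Suc r) \<noteq> snd (?D ! r)" using nth[OF r] nth[of r] r by (simp add: algebra_simps del: of_int_add)
  qed
  moreover have "sorted_wrt (<) (take (Suc (nat (t - ?a))) (map fst ?D))"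
    unfolding sorted_wrt_iff_nth_Suc_transp[OF transp_on_less]
  proof (intro allI impI)
    fix i assume "Suc i < length (take (Suc (nat (t - ?a))) (map fst ?D))"
    then have i: "Suc i < length ?D" "?a + int i < t" by auto
    then have "?a + int i \<in> {?a..?b}" using len by simp
    then have "0 < N (?a + int i)" unfolding s[symmetric] by simp
    then have "N (?a + int i) < N (?a + int i + 1)" using assms i(2) unfolding upper_def by fastforce
    then show "take (Suc (nat (t - ?a))) (map fst ?D) ! i < take (Suc (nat (t - ?a))) (map fst ?D) ! Suc i"
      using i nth[OF i(1)] nth[of i] by (simp add: algebra_simps)
  qed
  moreover have "sorted_wrt (\<ge>) (drop (nat (t - ?a)) (map fst ?D))"
    unfolding sorted_wrt_iff_nth_Suc_transp[OF transp_on_ge]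
  proof (intro allI impI)
    fix i assume "Suc i < length (drop (nat (t - ?a)) (map fst ?D))"
    then have i: "Suc (nat (t - ?a) + i) < length ?D" by simp
    have "N (t + int i + 1) \<le> N (t + int i)" using assms unfolding upper_def by simp
    then show "drop (nat (t - ?a)) (map fst ?D) ! i \<ge> drop (nat (t - ?a)) (map fst ?D) ! Suc i"
      using i ab(1) nth[OF i] nth[of "nat (t - ?a) + i"] by (simp add: algebra_simps)
  qed
  moreover have "nat (t - ?a) < length ?D" using len ab by linarith
  ultimately show ?thesis unfolding UL_def by blast
qed


section \<open>Reading the extremal unarced boxes off the reduced word\<close>

lemma distinct_reduce:
  assumes "reduce ws = (As, Rs)" "distinct (map snd ws)"
  shows "distinct As" "distinct Rs"
proof -
  have *: "sorted_wrt (\<noteq>) xs \<longleftrightarrow> distinct xs" for xs :: "'a list"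
    by (induction xs) auto
  show "distinct As" "distinct Rs" using sorted_reduce[OF assms(1), of "(\<noteq>)"] assms(2) unfolding * by auto
qed

lemma unarced_word_parts:
  assumes sorted: "sorted_wrt prec (map snd ws)" and dist: "distinct (map snd ws)"
    and A: "A = {l. (False, l) \<in> set ws}" and B: "B = I \<union> {l. (True, l) \<in> set ws}"
    and I: "\<And>x y. x \<in> I \<Longrightarrow> y \<in> snd ` set ws \<Longrightarrow> prec x y \<and> x \<noteq> y"
    and asym: "\<And>x y. prec x y \<Longrightarrow> \<not> prec y x"
    and red: "reduce ws = (As, Rs)"
  shows "unarced prec A B \<inter> A = set Rs" "unarced prec A B \<inter> B = I \<union> set As"
proof -
  have u: "unarced prec A B = I \<union> set As \<union> set Rs"
    by (rule unarced_word[OF sorted dist A B _ _ red]) (use I asym in blast)+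
  have *: "\<not> ((True, l) \<in> set ws \<and> (False, l) \<in> set ws)" for l
    using dist inj_onD[of snd "set ws" "(True, l)" "(False, l)"] by (auto simp: distinct_map)
  have IA: "I \<inter> A = {}" "I \<inter> snd ` set ws = {}" using I A by force+
  have As: "l \<in> B - A" if "l \<in> set As" for l
    using that reduce_labels(1)[OF red] * A B by auto
  have Rs: "l \<in> A \<and> l \<notin> B" if "l \<in> set Rs" for l
    using that reduce_labels(2)[OF red] * A B IA(1) by auto
  have "set As \<inter> A = {}" "set As \<subseteq> B" "set Rs \<subseteq> A" "set Rs \<inter> B = {}" using As Rs by auto
  moreover have "I \<subseteq> B" using B by simp
  ultimately show "unarced prec A B \<inter> A = set Rs" "unarced prec A B \<inter> B = I \<union> set As"
    using IA(1) unfolding u by auto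
qed

lemma last_box_eqI:
  assumes "\<And>x y. prec x y \<Longrightarrow> \<not> prec y x" "u \<in> X" "\<And>v. v \<in> X \<Longrightarrow> v \<noteq> u \<Longrightarrow> prec v u"
  shows "last_box prec X = u"
  unfolding last_box_def using assms by (intro the_equality) blast+

lemma first_box_eqI:
  assumes "\<And>x y. prec x y \<Longrightarrow> \<not> prec y x" "u \<in> X" "\<And>v. v \<in> X \<Longrightarrow> v \<noteq> u \<Longrightarrow> prec u v"
  shows "first_box prec X = u"
  unfolding first_box_def using assms by (intro the_equality) blast+

lemma last_box_sorted:
  assumes "\<And>x y. prec x y \<Longrightarrow> \<not> prec y x" "sorted_wrt prec xs" "xs \<noteq> []"
    "\<And>x y. x \<in> I \<Longrightarrow> y \<in> set xs \<Longrightarrow> prec x y"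
  shows "last_box prec (I \<union> set xs) = last xs"
proof (rule last_box_eqI[OF assms(1)])
  have xs: "xs = butlast xs @ [last xs]" using assms(3) by simp
  fix v assume "v \<in> I \<union> set xs" "v \<noteq> last xs"
  then have "v \<in> I \<or> v \<in> set (butlast xs)" using xs by (metis Un_iff in_set_conv_decomp rotate1.simps(2) set_ConsD set_rotate1)
  then show "prec v (last xs)" using assms(4)[of v "last xs"] assms(2,3) xs
    by (metis last_in_set list.set_intros(1) sorted_wrt_append)
qed (use assms(3) in auto)

lemma first_box_sorted:
  assumes "\<And>x y. prec x y \<Longrightarrow> \<not> prec y x" "sorted_wrt prec xs" "xs \<noteq> []"
  shows "first_box prec (set xs) = hd xs"
  by (rule first_box_eqI[OF assms(1)]) (use assms(2,3) in \<open>(cases xs; auto)+\<close>)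

section \<open>The signature of a diagram\<close>

text \<open>The \<open>i\<close>-signature of a range of columns, read from right to left: an
  \<open>i\<close>-bottom box, where arcs start, gives \<open>False\<close>. Ranges are needed
  because the ray cuts the word at a column.\<close>

definition colword :: "bit \<Rightarrow> (int \<Rightarrow> nat) \<Rightarrow> nat \<Rightarrow> nat \<Rightarrow> (bool \<times> nat) list" where
  "colword i N lo hi = map (\<lambda>c. (of_int (col_bot N c) \<noteq> i, c)) (rev [lo..<hi])"

lemma set_colword: "(b, c) \<in> set (colword i N lo hi) \<longleftrightarrow> lo \<le> c \<and> c < hi \<and> b = (of_int (col_bot N c) \<noteq> i)"
  by (auto simp: colword_def)

lemma labels_colword: "map snd (colword i N lo hi) = rev [lo..<hi]"
  by (simp add: colword_def comp_def)

lemma colword_split: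
  assumes "lo \<le> c" "c < hi"
  shows "colword i N lo hi = colword i N (Suc c) hi @ (of_int (col_bot N c) \<noteq> i, c) # colword i N lo c"
proof -
  have "[lo..<hi] = [lo..<c] @ c # [Suc c..<hi]"
    using assms upt_add_eq_append[of lo c "hi - c"] by (simp add: upt_conv_Cons)
  then show ?thesis by (simp add: colword_def)
qed

lemma colword_empty: "hi \<le> lo \<Longrightarrow> colword i N lo hi = []"
  by (simp add: colword_def)

lemma colword_append:
  assumes "lo \<le> m" "m \<le> hi"
  shows "colword i N lo hi = colword i N m hi @ colword i N lo m"
  using upt_add_eq_append[OF assms(1), of "hi - m"] assms by (simp add: colword_def)

lemma colword_cong:
  assumes "\<And>c. lo \<le> c \<Longrightarrow> c < hi \<Longrightarrow> even (col_bot N c - col_bot N' c)"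
  shows "colword i N lo hi = colword i N' lo hi"
proof -
  have "(of_int (col_bot N c) :: bit) = of_int (col_bot N' c)" if "lo \<le> c" "c < hi" for c
    using assms[OF that] unfolding of_int_bit_eq_iff .
  then show ?thesis by (simp add: colword_def)
qed

lemma right_of_asym: "right_of x y \<Longrightarrow> \<not> right_of y x"
  by (cases x; cases y) auto

lemma bottom_boxes_eq:
  assumes N: "unimodal (row_lengths D) t"
  shows "bottom_boxes i D = {(col_bot (row_lengths D) c, c) | c. c < row_lengths D t \<and> of_int (col_bot (row_lengths D) c) = i}"
proof -
  let ?N = "row_lengths D"
  have "(\<rho>, c) \<in> bottom_boxes i D \<longleftrightarrow> c < ?N t \<and> \<rho> = col_bot ?N c \<and> of_int \<rho> = i" for \<rho> c
  proof (cases "c < ?N t")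
    case True
    have "(\<rho>, c) \<in> bottom_boxes i D \<longleftrightarrow> c < ?N \<rho> \<and> \<not> c < ?N (\<rho> + 1) \<and> of_int \<rho> = i"
      unfolding bottom_boxes_def cells_eq cells_of_def by simp
    also have "(c < ?N \<rho> \<and> \<not> c < ?N (\<rho> + 1) \<and> of_int \<rho> = i) \<longleftrightarrow> \<rho> = col_bot ?N c \<and> of_int \<rho> = i"
      unfolding column_iff(3)[OF N True] using column_iff(1,2)[OF N True] by auto
    finally show ?thesis using True by blast
  next
    case False
    then have "\<not> c < ?N \<rho>" using unimodal_le[OF N, of \<rho>] by simp
    then show ?thesis unfolding bottom_boxes_def cells_eq cells_of_def using False by simp
  qed
  then show ?thesis by auto
qed

lemma ul_unarced_parts:
  assumes N: "unimodal (row_lengths D) t" and red: "reduce (colword i (row_lengths D) 0 (row_lengths D t)) = (As, Rs)"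
  shows "ul_unarced i D \<inter> bottom_boxes i D = set (map (\<lambda>c. (col_bot (row_lengths D) c, c)) Rs)"
    "ul_unarced i D \<inter> bottom_boxes (i + 1) D = set (map (\<lambda>c. (col_bot (row_lengths D) c, c)) As)"
    "sorted_wrt right_of (map (\<lambda>c. (col_bot (row_lengths D) c, c)) As)"
    "sorted_wrt right_of (map (\<lambda>c. (col_bot (row_lengths D) c, c)) Rs)"
proof -
  let ?N = "row_lengths D"
  let ?g = "\<lambda>c. (col_bot ?N c, c)"
  let ?ws = "map (apsnd ?g) (colword i ?N 0 (?N t))"
  have red': "reduce ?ws = (map ?g As, map ?g Rs)" unfolding reduce_map red by simp
  have lab: "map snd ?ws = map ?g (rev [0..<?N t])"
    unfolding labels_colword[symmetric, of 0 "?N t" i ?N] by simp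
  have s: "sorted_wrt right_of (map snd ?ws)"
    unfolding lab by (simp add: sorted_wrt_map sorted_wrt_rev)
  have d: "distinct (map snd ?ws)"
    unfolding lab by (simp add: distinct_map inj_on_def)
  have A: "bottom_boxes i D = {l. (False, l) \<in> set ?ws}"
    unfolding bottom_boxes_eq[OF N] by (auto simp: colword_def image_iff)
  have B: "bottom_boxes (i + 1) D = {} \<union> {l. (True, l) \<in> set ?ws}"
    unfolding bottom_boxes_eq[OF N] bit_neq_iff[symmetric] by (auto simp: colword_def image_iff)
  show "ul_unarced i D \<inter> bottom_boxes i D = set (map ?g Rs)"
    "ul_unarced i D \<inter> bottom_boxes (i + 1) D = set (map ?g As)"
    unfolding ul_unarced_def
    using unarced_word_parts[OF s d A B _ right_of_asym red'] by auto
  show "sorted_wrt right_of (map ?g As)" "sorted_wrt right_of (map ?g Rs)"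
    using sorted_reduce[OF red' s] by auto
qed

lemma ul_eps_eq:
  assumes N: "unimodal (row_lengths D) t" and red: "reduce (colword i (row_lengths D) 0 (row_lengths D t)) = (As, Rs)"
  shows "ul_eps i D = int (length Rs)"
proof -
  have "distinct Rs" using distinct_reduce[OF red] by (simp add: labels_colword)
  then have "distinct (map (\<lambda>c. (col_bot (row_lengths D) c, c)) Rs)" by (simp add: distinct_map inj_on_def)
  from distinct_card[OF this] show ?thesis
    unfolding ul_eps_def ul_unarced_parts(1)[OF assms] by simp
qed

section \<open>Adding a box in terms of row lengths\<close>

definition inc :: "int \<Rightarrow> (int \<Rightarrow> nat) \<Rightarrow> int \<Rightarrow> nat" where
  "inc r N = N(r := Suc (N r))"

definition dec :: "int \<Rightarrow> (int \<Rightarrow> nat) \<Rightarrow> int \<Rightarrow> nat" where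
  "dec r N = N(r := N r - 1)"

text \<open>
  The row in which \<open>f_i\<close> adds a box.  If no letter \<open>True\<close> survives and the uppermost peak row \<open>t\<close> does not
  have colour \<open>i\<close>, then row \<open>t + 1\<close> is as long as row \<open>t\<close> and hence the uppermost \<open>i\<close>-peak row.
\<close>

definition f_row :: "bit \<Rightarrow> (int \<Rightarrow> nat) \<Rightarrow> int \<Rightarrow> int" where
  "f_row i N t =
     (let As = fst (reduce (colword i N 0 (N t)))
      in if As = [] then if of_int t = i then t else t + 1 else col_bot N (last As) + 1)"

lemma finite_inc: "finite {r. 0 < N r} \<Longrightarrow> finite {r. 0 < inc \<rho> N r}"
  by (rule finite_subset[of _ "insert \<rho> {r. 0 < N r}"]) (auto simp: inc_def split: if_splits)

lemma last_column:
  assumes N: "unimodal N t" and "N (t + 1) < N t"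
  shows "col_bot N (N t - 1) = t"
  using assms by (intro bot_eqI[OF N]) auto

text \<open>Otherwise the last column would end in row \<open>t\<close>, and its letter
  \<open>True\<close>, being read first, would have nothing to cancel against.\<close>

lemma no_unarced_peak:
  assumes N: "unimodal N t" and "fst (reduce (colword i N 0 (N t))) = []" "of_int t \<noteq> i"
  shows "N (t + 1) = N t"
proof (rule ccontr)
  assume "N (t + 1) \<noteq> N t"
  then have lt: "N (t + 1) < N t" using unimodal_le[OF N, of "t + 1"] by simp
  obtain A R where AR: "reduce (colword i N 0 (N t - 1)) = (A, R)" by fastforce
  have "colword i N 0 (N t) = (True, N t - 1) # colword i N 0 (N t - 1)"
    using colword_split[of 0 "N t - 1" "N t" i N] lt last_column[OF N lt] assms(3) by (simp add: colword_def)
  then show False using assms(2) reduce_cons_True[OF AR] by simp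
qed

lemma distinct_colword: "distinct (map snd (colword i N lo hi))"
  by (simp add: labels_colword)

text \<open>If the next column to the left ended in the same row, its letter \<open>True\<close>
  would directly follow that of the last survivor, against \<open>last_unarced_followed\<close>.
  Hence the new box extends the row below without a gap. The prefix \<open>p\<close> makes room for
  the extra letter of \<open>lamword\<close>.\<close>

lemma leftmost_if_last_unarced:
  assumes N: "unimodal N t" and red: "reduce (p @ colword i N 0 hi) = (As, Rs)" and ne: "As \<noteq> []"
    and d: "distinct (map snd (p @ colword i N 0 hi))" and hi: "hi \<le> N t"
    and c: "last As < hi" "of_int (col_bot N (last As)) \<noteq> i"
  shows "N (col_bot N (last As) + 1) = last As"
proof (rule ccontr)
  let ?c = "last As"
  have ct: "?c < N t" using c(1) hi by simp
  assume "N (col_bot N ?c + 1) \<noteq> ?c"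
  with bot_succ[OF N ct] obtain c' where c': "?c = Suc c'" "N (col_bot N ?c + 1) \<le> c'" by (cases ?c) auto
  have "col_bot N c' = col_bot N ?c" using bot_in[OF N ct] c' column_iff(2)[OF N ct] by (intro bot_eqI[OF N]) auto
  then have e: "p @ colword i N 0 hi = (p @ colword i N (Suc ?c) hi) @ [(True, ?c), (True, c')] @ colword i N 0 c'"
    using colword_split[of 0 ?c hi i N] colword_split[of 0 c' ?c i N] c c'(1) by (simp add: colword_empty)
  show False using last_unarced_followed[OF red[unfolded e] d[unfolded e] ne] by simp
qed

lemma f_row_unarced:
  assumes N: "unimodal N t" and red: "reduce (colword i N 0 (N t)) = (As, Rs)" and ne: "As \<noteq> []"
  defines "c \<equiv> last As"
  shows "c < N t" "f_row i N t = col_bot N c + 1" "N (col_bot N c + 1) = c" "of_int (col_bot N c) \<noteq> i"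
proof -
  have "c \<in> set As" using ne by (simp add: c_def)
  then have "(True, c) \<in> set (colword i N 0 (N t))" using reduce_labels(1)[OF red] by auto
  then show c: "c < N t" and i: "of_int (col_bot N c) \<noteq> i" by (auto simp: set_colword)
  show "f_row i N t = col_bot N c + 1" using red ne by (simp add: f_row_def c_def)
  show "N (col_bot N c + 1) = c"
    using leftmost_if_last_unarced[OF N, of "[]"] red ne c i distinct_colword by (simp add: c_def)
qed

lemma f_row_no_unarced:
  assumes N: "unimodal N t" and "fst (reduce (colword i N 0 (N t))) = []"
  shows "f_row i N t = (if of_int t = i then t else t + 1)" "N (f_row i N t) = N t"
  using no_unarced_peak[OF assms] assms(2) by (auto simp: f_row_def)

lemma f_row_colour:
  assumes N: "unimodal N t"
  shows "of_int (f_row i N t) = i"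
proof (cases "fst (reduce (colword i N 0 (N t))) = []")
  case True
  then show ?thesis using f_row_no_unarced[OF N] of_int_bit_succ_eq_iff[of t i] by simp
next
  case False
  then obtain As Rs where "reduce (colword i N 0 (N t)) = (As, Rs)" "As \<noteq> []" by (metis fst_conv surj_pair)
  from f_row_unarced[OF N this] show ?thesis using of_int_bit_succ_eq_iff[of "col_bot N (last As)" i] by simp
qed

lemma f_row_cases:
  assumes N: "unimodal N t"
  shows "f_row i N t = t \<or> t < f_row i N t \<and> N (f_row i N t) < N (f_row i N t - 1)
     \<or> f_row i N t = t + 1 \<and> N (t + 1) = N t"
proof (cases "fst (reduce (colword i N 0 (N t))) = []")
  case True
  then show ?thesis using f_row_no_unarced[OF N True] by (auto split: if_splits)
next
  case False
  then obtain As Rs where "reduce (colword i N 0 (N t)) = (As, Rs)" "As \<noteq> []" by (metis fst_conv surj_pair)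
  note * = f_row_unarced[OF N this]
  show ?thesis using * column_iff(2)[OF N *(1)] bot_in[OF N *(1)] by simp
qed

lemma f_row_ge: "unimodal N t \<Longrightarrow> t \<le> f_row i N t"
  using f_row_cases[of N t i] by auto

text \<open>The uppermost peak row moves only when row \<open>t + 1\<close> ties with row
  \<open>t\<close> and receives the box; it is then the strictly longer one.\<close>

lemma upper_inc:
  assumes N: "upper N t"
  shows "\<exists>t' \<in> {t, t + 1}. upper (inc (f_row i N t) N) t' \<and> (f_row i N t = t \<longrightarrow> t' = t)"
proof -
  let ?r = "f_row i N t"
  have fin: "finite {r. 0 < inc ?r N r}" using N finite_inc by (auto simp: upper_def)
  have N1: "N r = 0 \<or> N r < N (r + 1)" if "r < t" for r using N that by (auto simp: upper_def)
  have N2: "N (r + 1) \<le> N r" if "t \<le> r" for r using N that by (auto simp: upper_def)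
  consider (1) "?r = t \<or> t < ?r \<and> N ?r < N (?r - 1)" | (3) "?r = t + 1" "N (t + 1) = N t"
    using f_row_cases[OF upper_unimodal[OF N], of i] by auto
  then show ?thesis
  proof cases
    case 1
    have "upper (inc ?r N) t" unfolding upper_def
    proof (intro conjI allI impI fin)
      fix r assume r: "r < t"
      show "inc ?r N r = 0 \<or> inc ?r N r < inc ?r N (r + 1)" using N1[OF r] r 1 by (auto simp: inc_def)
    next
      fix r assume r: "t \<le> r"
      have "N (?r - 1) = N r" if "r + 1 = ?r" unfolding that[symmetric] by simp
      then show "inc ?r N (r + 1) \<le> inc ?r N r" using N2[OF r] r 1 by (auto simp: inc_def)
    qed
    then show ?thesis by auto
  next
    case 3
    have "upper (inc ?r N) (t + 1)" unfolding upper_def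
    proof (intro conjI allI impI fin)
      fix r assume r: "r < t + 1"
      show "inc ?r N r = 0 \<or> inc ?r N r < inc ?r N (r + 1)"
        using N1[of r] r 3 by (cases "r = t") (auto simp: inc_def)
    next
      fix r assume r: "t + 1 \<le> r"
      show "inc ?r N (r + 1) \<le> inc ?r N r" using N2[of r] r 3 by (auto simp: inc_def)
    qed
    then show ?thesis using 3 by auto
  qed
qed

text \<open>When no letter \<open>True\<close> survives, row \<open>t\<close> or row
  \<open>t + 1\<close> has colour \<open>i\<close> and full width. Rows above \<open>t\<close> are
  strictly shorter, so this is the first \<open>i\<close>-peak row.\<close>

lemma uppermost_peak_eq:
  assumes D: "D \<in> UL" "D \<noteq> []" and N: "upper (row_lengths D) t"
    and As: "fst (reduce (colword i (row_lengths D) 0 (row_lengths D t))) = []"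
  shows "uppermost_peak i D = nat (f_row i (row_lengths D) t - top_row D)"
    "top_row D \<le> f_row i (row_lengths D) t"
    "f_row i (row_lengths D) t < top_row D + int (length D)"
proof -
  let ?N = "row_lengths D" and ?a = "top_row D"
  let ?r = "f_row i ?N t"
  note uni = upper_unimodal[OF N]
  have Nt: "0 < ?N t" using unimodal_zero[OF uni] UL_rows_diagram[OF D(1)] D(2) by (cases "?N t = 0") auto
  note fr = f_row_no_unarced[OF uni As]
  have supp: "0 < ?N r \<longleftrightarrow> ?a \<le> r \<and> r \<le> ?a + int (length D) - 1" for r
    using UL_support[OF D(1)] by (metis atLeastAtMost_iff mem_Collect_eq)
  have r: "?a \<le> ?r" "?r < ?a + int (length D)" using supp[of ?r] Nt fr(2) by auto
  then show "?a \<le> ?r" "?r < ?a + int (length D)" .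
  have ND: "fst (D ! j) = ?N (?a + int j)" if "j < length D" for j using that by (simp add: row_lengths_def)
  note col = UL_colour[OF D(1)]
  have a1: "?a + int (nat (?r - ?a)) = ?r" using r by simp
  show "uppermost_peak i D = nat (?r - ?a)"
    unfolding uppermost_peak_def
  proof (rule Least_equality)
    have "nat (?r - ?a) < length D" using r by simp
    moreover have "snd (D ! nat (?r - ?a)) = i"
      using col[of "nat (?r - ?a)"] calculation a1 f_row_colour[OF uni, of i] by (simp del: of_int_add)
    moreover have "fst (D ! r') \<le> fst (D ! nat (?r - ?a))" if "r' < length D" for r'
      using ND[OF that] ND[OF calculation(1)] a1 fr(2) unimodal_le[OF uni] by simp
    ultimately show "nat (?r - ?a) < length D \<and> snd (D ! nat (?r - ?a)) = i \<and>
        (\<forall>r'<length D. snd (D ! r') = i \<longrightarrow> fst (D ! r') \<le> fst (D ! nat (?r - ?a)))" by blast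
    have fr': "fst (D ! nat (?r - ?a)) = ?N t" "snd (D ! nat (?r - ?a)) = i" "nat (?r - ?a) < length D"
      using \<open>nat (?r - ?a) < length D\<close> \<open>snd (D ! nat (?r - ?a)) = i\<close> ND[of "nat (?r - ?a)"] a1 fr(2) by simp_all
    fix r assume *: "r < length D \<and> snd (D ! r) = i \<and>
        (\<forall>r'<length D. snd (D ! r') = i \<longrightarrow> fst (D ! r') \<le> fst (D ! r))"
    then have "?N t \<le> fst (D ! r)" using fr' by metis
    then have Nr: "?N t \<le> ?N (?a + int r)" using ND * by simp
    show "nat (?r - ?a) \<le> r"
    proof (rule ccontr)
      assume "\<not> ?thesis"
      then have lt: "?a + int r < ?r" by simp
      have ge: "t \<le> ?a + int r"
      proof (rule ccontr)
        assume "\<not> t \<le> ?a + int r"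
        then have "?N (?a + int r) < ?N (?a + int r + 1)"
          using N Nr Nt unfolding upper_def by (metis not_le less_le_trans not_less_zero)
        then show False using Nr unimodal_le[OF uni, of "?a + int r + 1"] by simp
      qed
      then have "?a + int r = t" "of_int t \<noteq> i" using lt fr(1) by (auto split: if_splits)
      then show False using * col[of r] by simp
    qed
  qed
qed

lemma ul_f_eq_normalized:
  assumes D: "D \<in> UL" and N: "upper (row_lengths D) t"
  shows "ul_f i D = rows_diagram (inc (f_row i (row_lengths D) t) (row_lengths D))"
proof (cases "D = []")
  case True
  \<comment> \<open>For the empty diagram \<open>t\<close> is arbitrary; \<open>f_row\<close> picks
    whichever of the rows \<open>t\<close> and \<open>t + 1\<close> has colour
    \<open>i\<close>.\<close>
  have "f_row i (\<lambda>_. 0) t = (if of_int t = i then t else t + 1)"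
    by (simp add: f_row_def colword_def)
  then have "of_int (f_row i (\<lambda>_. 0) t) = i" using of_int_bit_succ_eq_iff[of t i] by simp
  then show ?thesis using True rows_diagram_single[of "f_row i (\<lambda>_. 0) t" 0] by (simp add: ul_f_def inc_def)
next
  case False
  let ?N = "row_lengths D" and ?a = "top_row D"
  note uni = upper_unimodal[OF N]
  obtain As Rs where red: "reduce (colword i ?N 0 (?N t)) = (As, Rs)" by fastforce
  note parts = ul_unarced_parts[OF uni red]
  show ?thesis
  proof (cases "As = []")
    case True
    have e: "ul_f i D = D[uppermost_peak i D := (fst (D ! uppermost_peak i D) + 1, i)]"
      using parts(2) True False by (simp add: ul_f_def Let_def)
    let ?r = "f_row i ?N t"
    note up = uppermost_peak_eq[OF D False N, of i]
    have As0: "fst (reduce (colword i ?N 0 (?N t))) = []" using red True by simp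
    note up = up[OF As0]
    have s: "{r. 0 < inc ?r ?N r} = {?a..?a + int (length D) - 1}"
      using UL_support[OF D] up(2,3) unfolding inc_def set_eq_iff by auto
    have "rows_diagram (inc ?r ?N) = D[nat (?r - ?a) := (fst (D ! nat (?r - ?a)) + 1, i)]"
    proof (rule nth_equalityI)
      show l: "length (rows_diagram (inc ?r ?N)) = length (D[nat (?r - ?a) := (fst (D ! nat (?r - ?a)) + 1, i)])"
        unfolding rows_diagram_interval[OF s] by simp
      fix j assume j: "j < length (rows_diagram (inc ?r ?N))"
      then have jD: "j < length D" using l by simp
      have N: "?N (?a + int j) = fst (D ! j)" using jD by (simp add: row_lengths_def)
      show "rows_diagram (inc ?r ?N) ! j = D[nat (?r - ?a) := (fst (D ! nat (?r - ?a)) + 1, i)] ! j"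
      proof (cases "?a + int j = ?r")
        case True
        then have "j = nat (?r - ?a)" by auto
        then show ?thesis using rows_diagram_nth[OF s j] N True jD f_row_colour[OF uni, of i] by (simp add: inc_def)
      next
        case False
        then have "j \<noteq> nat (?r - ?a)" using up(2) by auto
        then show ?thesis using rows_diagram_nth[OF s j] N False UL_colour[OF D jD]
          by (simp add: inc_def prod_eq_iff del: of_int_add)
      qed
    qed
    then show ?thesis using e up(1) by simp
  next
    case ne: False
    let ?g = "\<lambda>c. (col_bot ?N c, c)"
    have "last_box right_of (set (map ?g As)) = last (map ?g As)"
      using last_box_sorted[OF right_of_asym parts(3), of "{}"] ne by simp
    then have lb: "last_box right_of (ul_unarced i D \<inter> bottom_boxes (i + 1) D) = (col_bot ?N (last As), last As)"
      unfolding parts(2) using ne by (simp add: last_map)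
    let ?c = "last As"
    note fr = f_row_unarced[OF uni red ne]
    have "ul_unarced i D \<inter> bottom_boxes (i + 1) D \<noteq> {}" unfolding parts(2) using ne by simp
    then have "ul_f i D = left_justify (insert (col_bot ?N ?c + 1, ?c) (cells D))"
      using False lb by (simp add: ul_f_def Let_def)
    also have "\<dots> = rows_diagram (inc (f_row i ?N t) ?N)"
    proof -
      have "(\<lambda>r. card {c. (r, c) \<in> insert (col_bot ?N ?c + 1, ?c) (cells D)}) = inc (f_row i ?N t) ?N"
      proof
        fix r
        have "{c. (r, c) \<in> insert (col_bot ?N ?c + 1, ?c) (cells D)} =
            (if r = col_bot ?N ?c + 1 then insert ?c {..<?N r} else {..<?N r})"
          unfolding cells_eq cells_of_def by auto
        then show "card {c. (r, c) \<in> insert (col_bot ?N ?c + 1, ?c) (cells D)} = inc (f_row i ?N t) ?N r"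
          using fr(2,3) by (simp add: inc_def)
      qed
      moreover have "finite (cells D)" unfolding cells_eq by (rule finite_cells_of[OF finite_row_lengths])
      ultimately show ?thesis using left_justify_eq[of "insert (col_bot ?N ?c + 1, ?c) (cells D)"] by simp
    qed
    finally show ?thesis .
  qed
qed

section \<open>Invariance of signatures under even vertical shifts\<close>

lemma bot_shift:
  assumes "unimodal N t" "c < N t"
  shows "col_bot (shift_rows d N) c = col_bot N c + d"
proof -
  have "{r. c < shift_rows d N r} = (\<lambda>r. r + d) ` {r. c < N r}"
    by (auto simp: shift_rows_def image_iff intro!: exI[of _ "x - d" for x])
  moreover have "mono (\<lambda>r :: int. r + d)" by (auto intro: monoI)
  moreover have "{r. c < N r} \<noteq> {}" using assms(2) by auto
  ultimately show ?thesis unfolding col_bot_def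
    using mono_Max_commute[of "\<lambda>r. r + d" "{r. c < N r}"] column_finite[OF assms(1)] by simp
qed

lemma colword_shift:
  assumes "unimodal N t" "even d" "hi \<le> N t"
  shows "colword i (shift_rows d N) lo hi = colword i N lo hi"
  by (rule colword_cong) (use bot_shift[OF assms(1)] assms in auto)

lemma f_row_shift:
  assumes N: "unimodal N t" and "even d"
  shows "f_row i (shift_rows d N) (t + d) = f_row i N t + d"
proof -
  have t: "shift_rows d N (t + d) = N t" by (simp add: shift_rows_def)
  obtain As Rs where red: "reduce (colword i N 0 (N t)) = (As, Rs)" by fastforce
  have "colword i (shift_rows d N) 0 (N t) = colword i N 0 (N t)" using colword_shift[OF assms] by simp
  moreover have "(of_int (t + d) :: bit) = of_int t" unfolding of_int_bit_eq_iff using assms by simp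
  ultimately show ?thesis
    using red f_row_unarced(1)[OF N red] bot_shift[OF N]
    by (auto simp: f_row_def t Let_def simp del: of_int_add)
qed

lemma ul_f_eq:
  assumes N: "upper N t"
  shows "ul_f i (rows_diagram N) = rows_diagram (inc (f_row i N t) N)"
proof -
  note uni = upper_unimodal[OF N]
  obtain d where d: "even d" "row_lengths (rows_diagram N) = shift_rows d N"
    using row_lengths_rows_diagram[OF uni] by blast
  have "ul_f i (rows_diagram N) = rows_diagram (inc (f_row i N t + d) (shift_rows d N))"
    using ul_f_eq_normalized[OF upper_rows_diagram[OF N], of "t + d" i] upper_shift[OF N] f_row_shift[OF uni] d by simp
  also have "inc (f_row i N t + d) (shift_rows d N) = shift_rows d (inc (f_row i N t) N)"
    by (auto simp: inc_def shift_rows_def fun_eq_iff)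
  also have "rows_diagram \<dots> = rows_diagram (inc (f_row i N t) N)"
    using rows_diagram_shift finite_inc N d(1) by (auto simp: upper_def)
  finally show ?thesis .
qed

lemma ul_f_closed: "D \<in> UL \<Longrightarrow> ul_f i D \<in> UL"
proof -
  assume D: "D \<in> UL"
  obtain t where t: "upper (row_lengths D) t" using UL_upper[OF D] by blast
  show ?thesis using upper_inc[OF t, of i] upper_rows_diagram ul_f_eq_normalized[OF D t, of i] by auto
qed

section \<open>Lowering inverts raising\<close>

lemma ul_e_eq:
  assumes D: "D \<in> UL" and N: "unimodal (row_lengths D) t"
    and red: "reduce (colword i (row_lengths D) 0 (row_lengths D t)) = (As, Rs)"
  shows "ul_e i D = (if Rs = [] then None else Some (rows_diagram (dec (col_bot (row_lengths D) (hd Rs)) (row_lengths D))))"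
proof -
  let ?N = "row_lengths D"
  let ?g = "\<lambda>c. (col_bot ?N c, c)"
  note parts = ul_unarced_parts[OF N red]
  show ?thesis
  proof (cases "Rs = []")
    case True
    then show ?thesis unfolding ul_e_def parts(1) by simp
  next
    case False
    let ?c = "hd Rs"
    have "?c \<in> set Rs" using False by simp
    then have "(False, ?c) \<in> set (colword i ?N 0 (?N t))" using reduce_labels(2)[OF red] by auto
    then have c: "?c < ?N t" by (auto simp: set_colword)
    have fb: "first_box right_of (set (map ?g Rs)) = ?g ?c"
      using first_box_sorted[OF right_of_asym parts(4)] False by (simp add: hd_map)
    have "(\<lambda>r. card {c. (r, c) \<in> cells D - {?g ?c}}) = dec (col_bot ?N ?c) ?N"
    proof
      fix r
      have "{c. (r, c) \<in> cells D - {?g ?c}} = (if r = col_bot ?N ?c then {..<?N r} - {?c} else {..<?N r})"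
        unfolding cells_eq cells_of_def by auto
      then show "card {c. (r, c) \<in> cells D - {?g ?c}} = dec (col_bot ?N ?c) ?N r"
        using bot_in[OF N c] by (simp add: dec_def)
    qed
    moreover have "finite (cells D - {?g ?c})"
      unfolding cells_eq using finite_cells_of[OF finite_row_lengths] by simp
    ultimately have "left_justify (cells D - {?g ?c}) = rows_diagram (dec (col_bot ?N ?c) ?N)"
      using left_justify_eq[of "cells D - {?g ?c}"] by simp
    then show ?thesis unfolding ul_e_def parts(1) using fb False by (simp add: Let_def)
  qed
qed

text \<open>The cases differ in what the deletion leaves behind. Below the peak row the column
  becomes shorter, and by \<open>flip_first\<close> its letter turns into the last surviving
  \<open>True\<close>, so the box comes back. A box deleted from row \<open>t\<close> is a whole
  column, whose letter vanishes, and the box comes back by the peak rule.\<close>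

lemma dec_f_row:
  assumes N: "upper N t" and red: "reduce (colword i N 0 (N t)) = (As, Rs)" and ne: "Rs \<noteq> []"
  defines "r \<equiv> col_bot N (hd Rs)"
  shows "\<exists>t'. upper (dec r N) t' \<and> f_row i (dec r N) t' = r" "0 < N r"
proof -
  let ?c = "hd Rs" and ?M = "dec r N"
  note uni = upper_unimodal[OF N]
  have "?c \<in> set Rs" using ne by simp
  then have "(False, ?c) \<in> set (colword i N 0 (N t))" using reduce_labels(2)[OF red] by auto
  then have c: "?c < N t" and i: "of_int r = i" by (auto simp: set_colword r_def)
  have tr: "t \<le> r" using column_iff(2)[OF uni c] by (simp add: r_def)
  have cr: "?c < N r" using bot_in[OF uni c] by (simp add: r_def)
  then show "0 < N r" by simp
  have cr1: "N (r + 1) \<le> ?c" using bot_succ[OF uni c] by (simp add: r_def)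
  have Nr: "N r = Suc ?c"
  proof (rule ccontr)
    assume "N r \<noteq> Suc ?c"
    then have c1: "Suc ?c < N r" using cr by simp
    then have c2: "Suc ?c < N t" using unimodal_le[OF uni, of r] by simp
    have "col_bot N (Suc ?c) = r" using c1 cr1 tr by (intro bot_eqI[OF uni]) auto
    then have "colword i N 0 (N t) = colword i N (Suc (Suc ?c)) (N t) @ [(False, Suc ?c), (False, ?c)] @ colword i N 0 ?c"
      using colword_split[of 0 "Suc ?c" "N t" i N] colword_split[of 0 ?c "Suc ?c" i N] c2 i
      by (simp add: r_def colword_empty)
    with first_unarced_preceded[of "colword i N (Suc (Suc ?c)) (N t)" "Suc ?c" ?c "colword i N 0 ?c" As Rs] red ne
      distinct_colword[of i N 0 "N t"] show False by simp
  qed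
  have M: "c < ?M r' \<longleftrightarrow> c < N r'" if "c \<noteq> ?c" for c r'
    using that Nr by (auto simp: dec_def)
  have split: "colword i N 0 (N t) = colword i N (Suc ?c) (N t) @ (False, ?c) # colword i N 0 ?c"
    using colword_split[of 0 ?c "N t" i N] c i by (simp add: r_def)
  have flip: "reduce (colword i N (Suc ?c) (N t) @ (True, ?c) # colword i N 0 ?c) = (As @ [?c], tl Rs)"
    "reduce (colword i N (Suc ?c) (N t) @ colword i N 0 ?c) = (As, tl Rs)"
    using flip_first[of "colword i N (Suc ?c) (N t)" ?c "colword i N 0 ?c" As Rs] red ne split
      distinct_colword[of i N 0 "N t"] by auto
  have cong: "colword i ?M lo hi = colword i N lo hi" if "hi \<le> ?c \<or> ?c < lo" for lo hi
    using that M by (intro colword_cong) (auto simp: col_bot_def)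
  have fin: "finite {x. 0 < ?M x}"
    using N by (auto simp: upper_def dec_def intro: finite_subset[of _ "{x. 0 < N x}"])
  have N1: "N r = 0 \<or> N r < N (r + 1)" if "r < t" for r using N that by (auto simp: upper_def)
  have N2: "N (r + 1) \<le> N r" if "t \<le> r" for r using N that by (auto simp: upper_def)
  show "\<exists>t'. upper ?M t' \<and> f_row i ?M t' = r"
  proof (cases "t < r")
    case True
    have u: "upper ?M t" unfolding upper_def
    proof (intro conjI allI impI fin)
      fix r' assume r: "r' < t"
      show "?M r' = 0 \<or> ?M r' < ?M (r' + 1)" using N1[OF r] r True by (auto simp: dec_def)
    next
      fix r' assume r: "t \<le> r'"
      show "?M (r' + 1) \<le> ?M r'" using N2[OF r] r True Nr cr1 by (auto simp: dec_def)
    qed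
    have Mt: "?M t = N t" using True by (simp add: dec_def)
    have "N r \<le> N (r - 1)" using N2[of "r - 1"] True by simp
    then have bc: "col_bot ?M ?c = r - 1"
      using Nr True by (intro bot_eqI[OF upper_unimodal[OF u]]) (auto simp: dec_def)
    then have "of_int (col_bot ?M ?c) \<noteq> i" using i of_int_bit_pred_eq_iff[of r i] by simp
    then have "colword i ?M 0 (N t) = colword i N (Suc ?c) (N t) @ (True, ?c) # colword i N 0 ?c"
      using colword_split[of 0 ?c "N t" i ?M] c cong by simp
    then have "f_row i ?M t = r" using flip(1) bc by (simp add: f_row_def Mt)
    then show ?thesis using u by blast
  next
    case False
    then have rt: "r = t" using tr by simp
    then have Nt: "N t = Suc ?c" using Nr by simp
    have "colword i N (Suc ?c) (N t) = []" by (simp add: Nt colword_def)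
    then have fl: "reduce ((True, ?c) # colword i N 0 ?c) = (As @ [?c], tl Rs)"
      "reduce (colword i N 0 ?c) = (As, tl Rs)" using flip by simp_all
    \<comment> \<open>The letter of \<open>?c\<close> is the first of the word, so after turning
      around it heads the survivors, whereas \<open>flip_first\<close> puts it last.\<close>
    have As: "As = []"
    proof -
      have "As @ [?c] = ?c # As" using fl(1) reduce_cons_True[OF fl(2), of ?c] by simp
      moreover have "?c \<notin> set As" using reduce_label_set(1)[OF fl(2)] by (auto simp: colword_def)
      ultimately show ?thesis by (cases As) auto
    qed
    have Mt: "?M r = ?c" using rt Nt by (simp add: dec_def)
    have cw: "colword i ?M 0 ?c = colword i N 0 ?c" using cong by simp
    \<comment> \<open>If row \<open>t - 1\<close> has length \<open>?c\<close>, shortening row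
      \<open>t\<close> makes it the uppermost peak row. For \<open>?c = 0\<close> nothing is left of
      the diagram and \<open>t\<close> may stay.\<close>
    show ?thesis
    proof (cases "N (t - 1) = ?c \<and> ?c \<noteq> 0")
      case True
      have u: "upper ?M (t - 1)" unfolding upper_def
      proof (intro conjI allI impI fin)
        fix r' assume r: "r' < t - 1"
        show "?M r' = 0 \<or> ?M r' < ?M (r' + 1)" using N1[of r'] r rt by (auto simp: dec_def)
      next
        fix r' assume r: "t - 1 \<le> r'"
        show "?M (r' + 1) \<le> ?M r'" using N2[of r'] r rt True Nt cr1 by (cases "r' = t - 1"; cases "r' = t") (auto simp: dec_def)
      qed
      have "?M (t - 1) = ?c" using True rt by (simp add: dec_def)
      then have "f_row i ?M (t - 1) = r"
        using fl(2) As cw rt i of_int_bit_pred_eq_iff[of t i] by (simp add: f_row_def)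
      then show ?thesis using u by blast
    next
      case nt: False
      have u: "upper ?M t" unfolding upper_def
      proof (intro conjI allI impI fin)
        fix r' assume r: "r' < t"
        show "?M r' = 0 \<or> ?M r' < ?M (r' + 1)"
          using N1[OF r] r rt nt Nt by (cases "r' = t - 1") (auto simp: dec_def)
      next
        fix r' assume r: "t \<le> r'"
        show "?M (r' + 1) \<le> ?M r'" using N2[OF r] r rt Nt cr1 by (auto simp: dec_def)
      qed
      have "f_row i ?M t = r"
        using fl(2) As cw i by (simp add: f_row_def Mt rt[symmetric])
      then show ?thesis using u by blast
    qed
  qed
qed

lemma ul_e_Some:
  assumes D: "D \<in> UL" and e: "ul_e i D = Some D'"
  shows "D' \<in> UL" "ul_f i D' = D"
proof -
  let ?N = "row_lengths D"
  obtain t where t: "upper ?N t" using UL_upper[OF D] by blast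
  note uni = upper_unimodal[OF t]
  obtain As Rs where red: "reduce (colword i ?N 0 (?N t)) = (As, Rs)" by fastforce
  have ne: "Rs \<noteq> []" and D': "D' = rows_diagram (dec (col_bot ?N (hd Rs)) ?N)"
    using ul_e_eq[OF D uni red] e by (auto split: if_splits)
  obtain t' where t': "upper (dec (col_bot ?N (hd Rs)) ?N) t'" "f_row i (dec (col_bot ?N (hd Rs)) ?N) t' = col_bot ?N (hd Rs)"
    using dec_f_row(1)[OF t red ne] by blast
  show "D' \<in> UL" using upper_rows_diagram[OF t'(1)] D' by simp
  have "inc (col_bot ?N (hd Rs)) (dec (col_bot ?N (hd Rs)) ?N) = ?N"
    using dec_f_row(2)[OF t red ne] by (auto simp: inc_def dec_def fun_eq_iff)
  then show "ul_f i D' = D" using ul_f_eq[OF t'(1), of i] t'(2) D' UL_rows_diagram[OF D] by simp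
qed

lemma ul_e_eq_None_iff:
  assumes D: "D \<in> UL"
  shows "ul_e i D = None \<longleftrightarrow> ul_eps i D = 0"
proof -
  let ?N = "row_lengths D"
  obtain t where t: "upper ?N t" using UL_upper[OF D] by blast
  note uni = upper_unimodal[OF t]
  obtain As Rs where red: "reduce (colword i ?N 0 (?N t)) = (As, Rs)" by fastforce
  show ?thesis using ul_e_eq[OF D uni red] ul_eps_eq[OF uni red] by simp
qed

text \<open>The first column is read last, so if \<open>i\<close> is the colour of its bottom box,
  the final letter is a \<open>False\<close> with nothing after it to cancel it.\<close>

lemma exists_ul_e:
  assumes D: "D \<in> UL" "D \<noteq> []"
  shows "\<exists>i D'. ul_e i D = Some D'"
proof -
  let ?N = "row_lengths D"
  obtain t where t: "upper ?N t" "D \<noteq> [] \<Longrightarrow> 0 < ?N t" using UL_upper[OF D(1)] by metis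
  note t = t(1) t(2)[OF D(2)]
  note uni = upper_unimodal[OF t(1)]
  define i :: bit where "i = of_int (col_bot ?N 0)"
  obtain As Rs where red: "reduce (colword i ?N 0 (?N t)) = (As, Rs)" by fastforce
  have "colword i ?N 0 (?N t) = colword i ?N 1 (?N t) @ [(False, 0)]"
    using colword_split[of 0 0 "?N t" i ?N] t(2) by (simp add: i_def colword_def)
  then have "Rs \<noteq> []"
    using red by (cases "reduce (colword i ?N 1 (?N t))") (auto simp: reduce_snoc)
  then show ?thesis using ul_e_eq[OF D(1) uni red] by auto
qed


section \<open>Shifting columns\<close>

definition sim_by :: "(nat \<Rightarrow> int) \<Rightarrow> (int \<Rightarrow> nat) \<Rightarrow> (int \<Rightarrow> nat) \<Rightarrow> bool" where
  "sim_by s N M \<longleftrightarrow> (\<forall>c. even (s c)) \<and> (\<forall>r c. c < N r \<longleftrightarrow> c < M (r + s c))"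

text \<open>The relation that specifies \<open>float_diag\<close>, in terms of rows. Among unimodal
  functions signatures depend only on the class (\<open>colword_sim\<close>), and every class
  contains exactly one upper ledge diagram (\<open>exists_upper_sim\<close>,
  \<open>sim_upper_eq\<close>).\<close>

definition col_sim :: "(int \<Rightarrow> nat) \<Rightarrow> (int \<Rightarrow> nat) \<Rightarrow> bool" where
  "col_sim N M \<longleftrightarrow> (\<exists>s. sim_by s N M)"

lemma nat_eqI_less: "(\<And>c. c < a \<longleftrightarrow> c < b) \<Longrightarrow> a = (b :: nat)"
  using linorder_neq_iff by blast

lemma col_sim_shift: "even d \<Longrightarrow> col_sim N (shift_rows d N)"
  unfolding col_sim_def sim_by_def by (intro exI[of _ "\<lambda>_. d"]) (simp add: shift_rows_def)

lemma col_sim_sym: "col_sim N M \<Longrightarrow> col_sim M N"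
  unfolding col_sim_def sim_by_def
proof -
  assume "\<exists>s. (\<forall>c. even (s c)) \<and> (\<forall>r c. c < N r \<longleftrightarrow> c < M (r + s c))"
  then obtain s where s: "\<And>c. even (s c)" "\<And>r c. c < N r \<longleftrightarrow> c < M (r + s c)" by blast
  have "c < M r \<longleftrightarrow> c < N (r + (- s c))" for r c using s(2)[of c "r - s c"] by simp
  then show "\<exists>s. (\<forall>c. even (s c)) \<and> (\<forall>r c. c < M r \<longleftrightarrow> c < N (r + s c))"
    using s(1) by (intro exI[of _ "\<lambda>c. - s c"]) auto
qed

lemma col_sim_trans:
  assumes "col_sim N M" "col_sim M K"
  shows "col_sim N K"
proof -
  obtain s where s: "\<And>c. even (s c)" "\<And>r c. c < N r \<longleftrightarrow> c < M (r + s c)"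
    using assms(1) unfolding col_sim_def sim_by_def by blast
  obtain s' where s': "\<And>c. even (s' c)" "\<And>r c. c < M r \<longleftrightarrow> c < K (r + s' c)"
    using assms(2) unfolding col_sim_def sim_by_def by blast
  show ?thesis unfolding col_sim_def sim_by_def
    by (intro exI[of _ "\<lambda>c. s c + s' c"]) (simp add: s s' add.assoc)
qed

lemma sim_width:
  assumes N: "unimodal N t" and M: "unimodal M t'" and s: "sim_by s N M"
  shows "M t' = N t"
proof -
  have "c < M t' \<longleftrightarrow> c < N t" for c
  proof
    assume "c < M t'"
    then have "c < N (t' - s c)" using s unfolding sim_by_def by (metis diff_add_cancel)
    then show "c < N t" using unimodal_le[OF N] less_le_trans by blast
  next
    assume "c < N t"
    then have "c < M (t + s c)" using s unfolding sim_by_def by blast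
    then show "c < M t'" using unimodal_le[OF M] less_le_trans by blast
  qed
  then show ?thesis by (rule nat_eqI_less)
qed

lemma sim_bot:
  assumes N: "unimodal N t" and M: "unimodal M t'" and s: "sim_by s N M" and c: "c < N t"
  shows "col_bot M c = col_bot N c + s c"
proof -
  have c': "c < M t'" using sim_width[OF N M s] c by simp
  have e: "c < N r \<longleftrightarrow> c < M (r + s c)" for r using s unfolding sim_by_def by blast
  have "col_bot N c + s c \<le> col_bot M c"
    using bot_in[OF N c] e column_iff(3)[OF M c'] by blast
  moreover have "col_bot M c - s c \<le> col_bot N c"
    using bot_in[OF M c'] e[of "col_bot M c - s c"] column_iff(3)[OF N c] by simp
  ultimately show ?thesis by simp
qed

lemma sim_top:
  assumes N: "unimodal N t" and M: "unimodal M t'" and s: "sim_by s N M" and c: "c < N t"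
  shows "col_top M c = col_top N c + s c"
proof -
  have c': "c < M t'" using sim_width[OF N M s] c by simp
  have e: "c < N r \<longleftrightarrow> c < M (r + s c)" for r using s unfolding sim_by_def by blast
  have "col_top M c \<le> col_top N c + s c"
    using top_in[OF N c] e column_iff(3)[OF M c'] by blast
  moreover have "col_top N c \<le> col_top M c - s c"
    using top_in[OF M c'] e[of "col_top M c - s c"] column_iff(3)[OF N c] by simp
  ultimately show ?thesis by simp
qed

lemma colword_sim:
  assumes N: "unimodal N t" and M: "unimodal M t'" and s: "col_sim N M" and "hi \<le> N t"
  shows "colword i M lo hi = colword i N lo hi"
proof (rule colword_cong)
  obtain s' where s': "sim_by s' N M" using s unfolding col_sim_def by blast
  fix c assume "lo \<le> c" "c < hi"
  then show "even (col_bot M c - col_bot N c)"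
    using sim_bot[OF N M s', of c] assms(4) s' by (simp add: sim_by_def)
qed

text \<open>Rows above the peak grow strictly, so the row after the top of column \<open>c\<close>
  already reaches column \<open>Suc c\<close>.\<close>

lemma upper_top_step:
  assumes N: "upper N t" and c: "Suc c < N t"
  shows "col_top N (Suc c) \<le> col_top N c + 1"
proof -
  note uni = upper_unimodal[OF N]
  have c0: "c < N t" using c by simp
  show ?thesis
  proof (cases "col_top N c < t")
    case True
    then have "N (col_top N c) < N (col_top N c + 1)"
      using N top_in[OF uni c0] unfolding upper_def by (metis less_zeroE)
    then have "Suc c < N (col_top N c + 1)" using top_in[OF uni c0] by simp
    then show ?thesis using column_iff(3)[OF uni c] by blast
  next
    case False
    then show ?thesis using column_iff(1)[OF uni c] by simp
  qed
qed

text \<open>In both diagrams the tops of neighbouring columns differ by 0 or 1, so the shifts of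
  neighbouring columns differ by at most 1. Being even, they are equal, and all columns move
  together.\<close>

lemma sim_upper_eq:
  assumes N: "upper N t" and M: "upper M t'" and sim: "col_sim N M"
  shows "rows_diagram M = rows_diagram N"
proof -
  note uN = upper_unimodal[OF N] and uM = upper_unimodal[OF M]
  obtain s where s: "sim_by s N M" using sim unfolding col_sim_def by blast
  have ev: "even (s c)" and e: "c < N r \<longleftrightarrow> c < M (r + s c)" for r c using s unfolding sim_by_def by blast+
  note w = sim_width[OF uN uM s]
  have "s c = s 0" if "c < N t" for c
    using that
  proof (induction c)
    case (Suc c)
    have c: "c < N t" using Suc by simp
    have "col_top M (Suc c) = col_top N (Suc c) + s (Suc c)" "col_top M c = col_top N c + s c"
      using sim_top[OF uN uM s] Suc.prems by auto
    moreover have "col_top M (Suc c) \<le> col_top M c + 1" "col_top N (Suc c) \<le> col_top N c + 1"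
      using upper_top_step[OF M] upper_top_step[OF N] Suc.prems w by auto
    moreover have "col_top M c \<le> col_top M (Suc c)" "col_top N c \<le> col_top N (Suc c)"
      using top_mono[OF uM, of c "Suc c"] top_mono[OF uN, of c "Suc c"] Suc.prems w by auto
    ultimately have "\<bar>s (Suc c) - s c\<bar> \<le> 1" by linarith
    moreover have "even (s (Suc c) - s c)" using ev by simp
    ultimately have "s (Suc c) = s c" by presburger
    then show ?case using Suc.IH c by simp
  qed simp
  note sc = this
  have "c < M r \<longleftrightarrow> c < shift_rows (s 0) N r" for c r
  proof (cases "c < N t")
    case True
    then show ?thesis using e[of c "r - s 0"] sc[OF True] by (simp add: shift_rows_def)
  next
    case False
    then show ?thesis using unimodal_le[OF uN, of "r - s 0"] unimodal_le[OF uM, of r] w by (simp add: shift_rows_def)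
  qed
  then have "M = shift_rows (s 0) N" by (intro ext nat_eqI_less)
  then show ?thesis using rows_diagram_shift[OF _ ev] N by (simp add: upper_def)
qed

text \<open>Tops moving down and bottoms moving up from left to right make the columns nested
  intervals, so every row is an initial segment of columns and can be recovered from its
  cardinality.\<close>

lemma rows_of_columns:
  fixes T B :: "nat \<Rightarrow> int"
  assumes TB: "\<And>c. c < w \<Longrightarrow> T c \<le> B c"
    and T: "\<And>c. Suc c < w \<Longrightarrow> T c \<le> T (Suc c) \<and> T (Suc c) \<le> T c + 1"
    and B: "\<And>c. Suc c < w \<Longrightarrow> B (Suc c) \<le> B c"
  shows "\<exists>N t. upper N t \<and> (\<forall>r c. c < N r \<longleftrightarrow> c < w \<and> T c \<le> r \<and> r \<le> B c)"
proof -
  define N where "N r = card {c. c < w \<and> T c \<le> r \<and> r \<le> B c}" for r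
  have mT: "T c \<le> T c'" if "c \<le> c'" "c' < w" for c c'
    using that by (induction c' rule: dec_induct) (use T in fastforce)+
  have mB: "B c' \<le> B c" if "c \<le> c'" "c' < w" for c c'
    using that by (induction c' rule: dec_induct) (use B in fastforce)+
  have N: "c < N r \<longleftrightarrow> c < w \<and> T c \<le> r \<and> r \<le> B c" for r c
  proof -
    let ?S = "{c. c < w \<and> T c \<le> r \<and> r \<le> B c}"
    have down: "c' \<in> ?S" if "c \<in> ?S" "c' \<le> c" for c c'
      using that mT[of c' c] mB[of c' c] by auto
    have fin: "finite ?S" by simp
    have "?S = {..<card ?S}"
    proof (cases "?S = {}")
      case False
      have "?S = {..Max ?S}"
      proof
        show "{..Max ?S} \<subseteq> ?S" using down[OF Max_in[OF fin False]] by blast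
        show "?S \<subseteq> {..Max ?S}" using Max_ge[OF fin] by blast
      qed
      then have S: "?S = {..<Suc (Max ?S)}" by (simp only: lessThan_Suc_atMost)
      then have "card ?S = card {..<Suc (Max ?S)}" by (rule arg_cong)
      then have "card ?S = Suc (Max ?S)" by (simp only: card_lessThan)
      then show ?thesis using S by (simp only:)
    next
      case True
      then show ?thesis by (simp only: card.empty lessThan_0)
    qed
    then have "c \<in> ?S \<longleftrightarrow> c \<in> {..<card ?S}" by (rule arg_cong)
    then show ?thesis unfolding N_def by simp
  qed
  show ?thesis
  proof (cases "w = 0")
    case True
    then have "N = (\<lambda>_. 0)" using N by (metis ext gr0I less_nat_zero_code)
    then have "upper N 0" by (simp add: upper_def)
    then show ?thesis using N by blast
  next
    case False
    \<comment> \<open>The rows of full width are those met by the last column, so its top is the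
      uppermost peak row.\<close>
    let ?t = "T (w - 1)"
    have Tt: "T c \<le> ?t" if "c < w" for c using mT[of c "w - 1"] that by simp
    have Bt: "?t \<le> B c" if "c < w" for c using mB[of c "w - 1"] TB[of "w - 1"] that by (simp, linarith)
    have "upper N ?t"
      unfolding upper_def
    proof (intro conjI allI impI)
      have "{r. 0 < N r} \<subseteq> {T 0..B 0}" using N by auto
      then show "finite {r. 0 < N r}" using finite_subset by blast
    next
      fix r assume r: "r < ?t"
      show "N r = 0 \<or> N r < N (r + 1)"
      proof (cases "N r")
        case (Suc n)
        then have n: "n < w" "T n \<le> r" using N[of n r] by auto
        have "Suc n < w" using n r by (metis Suc_lessI diff_Suc_1 not_le)
        moreover have "\<not> Suc n < N r" using Suc by simp
        ultimately have "r < T (Suc n)" using N[of "Suc n" r] Bt[of "Suc n"] r by auto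
        then have "T (Suc n) \<le> r + 1" "r + 1 \<le> B (Suc n)"
          using T[of n] n Bt[of "Suc n"] r \<open>Suc n < w\<close> by auto
        then have "Suc n < N (r + 1)" using N \<open>Suc n < w\<close> by blast
        then show ?thesis using Suc by simp
      qed simp
    next
      fix r assume r: "?t \<le> r"
      have "c < N r" if "c < N (r + 1)" for c
        using that N[of c] r Tt[of c] by auto
      then show "N (r + 1) \<le> N r" by (meson leI less_irrefl)
    qed
    then show ?thesis using N by blast
  qed
qed

text \<open>Each step between the tops of neighbouring columns is replaced by its remainder modulo
  2, which lifts later columns further by even amounts. Column lengths are kept, so the bottoms
  still move up from left to right.\<close>

lemma exists_upper_sim:
  assumes N: "unimodal N t"
  shows "\<exists>M t'. upper M t' \<and> col_sim N M"
proof -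
  let ?T = "col_top N" and ?B = "col_bot N"
  define T' where "T' = rec_nat (?T 0) (\<lambda>c x. x + (?T (Suc c) - ?T c) mod 2)"
  have T': "T' 0 = ?T 0" "T' (Suc c) = T' c + (?T (Suc c) - ?T c) mod 2" for c
    by (simp_all add: T'_def)
  define B' where "B' c = ?B c - (?T c - T' c)" for c
  have ev: "even (?T c - T' c)" for c
  proof (induction c)
    case (Suc c)
    have "?T (Suc c) - T' (Suc c) = (?T c - T' c) + ((?T (Suc c) - ?T c) - (?T (Suc c) - ?T c) mod 2)"
      unfolding T'(2) by simp
    moreover have "even (x - x mod 2)" for x :: int by (simp add: minus_mod_eq_mult_div)
    ultimately show ?case using Suc by (simp only: even_add)
  qed (simp add: T')
  have "\<exists>M t'. upper M t' \<and> (\<forall>r c. c < M r \<longleftrightarrow> c < N t \<and> T' c \<le> r \<and> r \<le> B' c)"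
  proof (rule rows_of_columns)
    fix c assume "c < N t"
    then show "T' c \<le> B' c" using column_iff(1,2)[OF N, of c] by (simp add: B'_def)
  next
    fix c assume c: "Suc c < N t"
    let ?d = "?T (Suc c) - ?T c"
    have "0 \<le> ?d" using top_mono[OF N, of c "Suc c"] c by simp
    then have "?d mod 2 \<le> ?d" by (simp add: zmod_le_nonneg_dividend)
    moreover have "?B (Suc c) \<le> ?B c" using bot_antimono[OF N, of c "Suc c"] c by simp
    ultimately show "B' (Suc c) \<le> B' c" by (simp add: B'_def T')
  next
    fix c show "T' c \<le> T' (Suc c) \<and> T' (Suc c) \<le> T' c + 1" by (simp add: T')
  qed
  then obtain M t' where M: "upper M t'" "\<And>r c. c < M r \<longleftrightarrow> c < N t \<and> T' c \<le> r \<and> r \<le> B' c" by blast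
  have "c < N r \<longleftrightarrow> c < M (r + (T' c - ?T c))" for r c
  proof (cases "c < N t")
    case True
    then show ?thesis using column_iff(3)[OF N True, of r] M(2)[of c] by (auto simp: B'_def)
  next
    case False
    then show ?thesis using M(2) unimodal_le[OF N, of r] by auto
  qed
  moreover have "even (T' c - ?T c)" for c using ev[of c] by simp
  ultimately have "sim_by (\<lambda>c. T' c - ?T c) N M" unfolding sim_by_def by simp
  then have "col_sim N M" unfolding col_sim_def by blast
  then show ?thesis using M(1) by blast
qed

text \<open>Mirror image of \<open>upper_top_step\<close>. Bottoms that rise by at most one are what
  allows \<open>glue\<close>, which moves columns as far down as possible in steps of two, to
  recover them.\<close>

lemma lower_bot_step:
  assumes N: "lower N t" and c: "Suc c < N t"
  shows "col_bot N c - 1 \<le> col_bot N (Suc c)"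
proof -
  note uni = lower_unimodal[OF N]
  have c0: "c < N t" using c by simp
  let ?r = "col_bot N c"
  have "Suc c < N (?r - 1)" if "?r \<noteq> t"
  proof -
    have "t \<le> ?r - 1" using that column_iff(2)[OF uni c0] by simp
    then have "N ?r = 0 \<or> N ?r < N (?r - 1)" using N unfolding lower_def by (metis diff_add_cancel)
    then show ?thesis using bot_in[OF uni c0] by auto
  qed
  moreover have "?r - 1 \<le> col_bot N (Suc c)" if "Suc c < N (?r - 1)"
    using that column_iff(3)[OF uni c, of "?r - 1"] by simp
  ultimately show ?thesis using column_iff(2)[OF uni c] by (cases "?r = t") auto
qed

lemma float_diag_eq:
  assumes N: "unimodal N t" and E: "E \<in> UL" and sim: "col_sim N (row_lengths E)"
  shows "float_diag (rows_diagram N) = E"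
proof -
  let ?D = "rows_diagram N"
  obtain d where d: "even d" "row_lengths ?D = shift_rows d N"
    using row_lengths_rows_diagram[OF N] by blast
  have simD: "col_sim N (row_lengths ?D)" unfolding d(2) by (rule col_sim_shift[OF d(1)])
  have iff: "(\<exists>s. (\<forall>c. even (s c)) \<and> cells E' = {(\<rho> + s c, c) | \<rho> c. (\<rho>, c) \<in> cells ?D})
      \<longleftrightarrow> col_sim (row_lengths ?D) (row_lengths E')" for E'
  proof -
    have "cells E' = {(\<rho> + s c, c) | \<rho> c. (\<rho>, c) \<in> cells ?D} \<longleftrightarrow>
       (\<forall>r c. c < row_lengths ?D r \<longleftrightarrow> c < row_lengths E' (r + s c))" for s :: "nat \<Rightarrow> int"
    proof
      assume "cells E' = {(\<rho> + s c, c) | \<rho> c. (\<rho>, c) \<in> cells ?D}"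
      note E' = this
      have "(r + s c, c) \<in> cells E' \<longleftrightarrow> (r, c) \<in> cells ?D" for r c
      proof -
        have "(r + s c, c) \<in> cells E' \<longleftrightarrow> (\<exists>\<rho>. r + s c = \<rho> + s c \<and> (\<rho>, c) \<in> cells ?D)"
          unfolding E' by blast
        then show ?thesis by simp
      qed
      then show "\<forall>r c. c < row_lengths ?D r \<longleftrightarrow> c < row_lengths E' (r + s c)"
        by (simp add: cells_eq cells_of_def)
    next
      assume *: "\<forall>r c. c < row_lengths ?D r \<longleftrightarrow> c < row_lengths E' (r + s c)"
      have "(r, c) \<in> cells E' \<longleftrightarrow> (r - s c, c) \<in> cells ?D" for r c
        using *[rule_format, of c "r - s c"] by (simp add: cells_eq cells_of_def)
      note E' = this
      show "cells E' = {(\<rho> + s c, c) | \<rho> c. (\<rho>, c) \<in> cells ?D}" (is "_ = ?R")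
      proof (intro set_eqI)
        fix x :: cell
        obtain r c where x: "x = (r, c)" by fastforce
        have "x \<in> ?R \<longleftrightarrow> (\<exists>\<rho>. r = \<rho> + s c \<and> (\<rho>, c) \<in> cells ?D)" unfolding x by blast
        also have "\<dots> \<longleftrightarrow> (r - s c, c) \<in> cells ?D" by (auto intro: exI[of _ "r - s c"])
        finally show "x \<in> cells E' \<longleftrightarrow> x \<in> ?R" unfolding x E' by blast
      qed
    qed
    then show ?thesis unfolding col_sim_def sim_by_def by simp
  qed
  show ?thesis unfolding float_diag_def iff
  proof (rule the_equality)
    show "E \<in> UL \<and> col_sim (row_lengths ?D) (row_lengths E)"
      using E col_sim_trans[OF col_sim_sym[OF simD] sim] by simp
    fix E' assume E': "E' \<in> UL \<and> col_sim (row_lengths ?D) (row_lengths E')"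
    then have s: "col_sim (row_lengths E) (row_lengths E')"
      using col_sim_trans col_sim_sym sim simD by blast
    obtain t1 where "upper (row_lengths E) t1" by (rule UL_upper[OF E])
    moreover obtain t2 where "upper (row_lengths E') t2" using E' UL_upper by metis
    ultimately show "E' = E" using sim_upper_eq[OF _ _ s] UL_rows_diagram E E' by metis
  qed
qed

lemma float_diag_unimodal:
  assumes N: "unimodal N t"
  shows "float_diag (rows_diagram N) \<in> UL" "col_sim N (row_lengths (float_diag (rows_diagram N)))"
proof -
  obtain M t' where M: "upper M t'" "col_sim N M" using exists_upper_sim[OF N] by blast
  obtain d where d: "even d" "row_lengths (rows_diagram M) = shift_rows d M"
    using row_lengths_rows_diagram[OF upper_unimodal[OF M(1)]] by blast
  have s: "col_sim N (row_lengths (rows_diagram M))"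
    unfolding d(2) using col_sim_trans[OF M(2) col_sim_shift[OF d(1)]] .
  then show "float_diag (rows_diagram N) \<in> UL" "col_sim N (row_lengths (float_diag (rows_diagram N)))"
    using float_diag_eq[OF N upper_rows_diagram[OF M(1)] s] upper_rows_diagram[OF M(1)] by simp_all
qed

section \<open>Splitting in terms of rows\<close>

text \<open>The ray from \<open>(m, 0)\<close> has the cells with \<open>c \<le> r - m\<close>
  weakly below it, which are \<open>nat (r - m + 1)\<close> columns of row \<open>r\<close>;
  truncation gives none for the rows above \<open>m\<close>.\<close>

definition L_rows :: "int \<Rightarrow> (int \<Rightarrow> nat) \<Rightarrow> int \<Rightarrow> nat" where
  "L_rows m N = (\<lambda>r. min (N r) (nat (r - m + 1)))"

definition U_rows :: "int \<Rightarrow> (int \<Rightarrow> nat) \<Rightarrow> int \<Rightarrow> nat" where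
  "U_rows m N = (\<lambda>r. N r - nat (r - m + 1))"

text \<open>The partition cut off by the ray: column \<open>c\<close> of the part weakly below the
  ray starts in row \<open>m + c\<close>, and top-aligning removes this offset.\<close>

definition strip :: "int \<Rightarrow> (int \<Rightarrow> nat) \<Rightarrow> (nat \<times> nat) set" where
  "strip m N = {(r, c). c < N (m + int r + int c)}"

text \<open>The ray of the splitting starts in row \<open>m\<close>, which is the topmost or the second row.\<close>

locale splitting =
  fixes N :: "int \<Rightarrow> nat" and t m :: int
  assumes N: "upper N t" and zero: "\<And>r. r < m - 1 \<Longrightarrow> N r = 0" and mt: "m - 1 \<le> t"
    and Nm: "N m = 0 \<Longrightarrow> t = m - 1"
begin

lemmas uni = upper_unimodal[OF N]

lemma fin: "finite {r. 0 < N r}"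
  using N by (simp add: upper_def)

lemma fin_U: "finite {r. 0 < U_rows m N r}"
  by (rule finite_subset[OF _ fin]) (auto simp: U_rows_def)

lemma fin_L: "finite {r. 0 < L_rows m N r}"
  by (rule finite_subset[OF _ fin]) (auto simp: L_rows_def)

text \<open>Row \<open>m\<close> is non-empty if the range is, and rows above the peak grow
  strictly, so the ray stays inside the diagram at least down to row \<open>t\<close>.\<close>

lemma diag_le_t: "m \<le> r \<Longrightarrow> r \<le> t \<Longrightarrow> r - m + 1 \<le> int (N r)"
proof (induction r rule: int_ge_induct)
  case base
  then show ?case using Nm by (cases "N m") auto
next
  case (step r)
  then have "N r < N (r + 1)" using N unfolding upper_def by force
  then show ?case using step by simp
qed

text \<open>From row \<open>m - 1\<close> on, each row loses one cell more than the row above it.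
  This turns strict growth above the peak into weak growth and weak decrease below it into strict
  decrease.\<close>

lemma lower_U: "lower (U_rows m N) t"
  unfolding lower_def
proof (intro conjI allI impI fin_U)
  fix r assume r: "r < t"
  show "U_rows m N r \<le> U_rows m N (r + 1)"
  proof (cases "N r = 0")
    case False
    then have "N r < N (r + 1)" using N r unfolding upper_def by force
    then show ?thesis unfolding U_rows_def by linarith
  qed (simp add: U_rows_def)
next
  fix r assume r: "t \<le> r"
  then have "N (r + 1) \<le> N r" using N unfolding upper_def by blast
  then show "U_rows m N (r + 1) = 0 \<or> U_rows m N (r + 1) < U_rows m N r"
    using r mt unfolding U_rows_def by linarith
qed

text \<open>The last row with a cell on the ray, or \<open>m - 1\<close> if there is none. It is a
  peak row of the part weakly below the ray, whose number of columns is
  \<open>ray_width\<close>.\<close>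

definition ray_row :: int where "ray_row = Max {r. m - 1 \<le> r \<and> r - m + 1 \<le> int (N r)}"

definition ray_width :: nat where "ray_width = nat (ray_row - m + 1)"

lemma ray_row_props: "m - 1 \<le> ray_row" "ray_row - m + 1 \<le> int (N ray_row)" "ray_row < r \<Longrightarrow> int (N r) < r - m + 1"
proof -
  let ?S = "{r. m - 1 \<le> r \<and> r - m + 1 \<le> int (N r)}"
  have f: "finite ?S" by (rule finite_subset[of _ "insert (m - 1) {r. 0 < N r}"]) (use fin in auto)
  have "m - 1 \<in> ?S" by simp
  then have ne: "?S \<noteq> {}" by blast
  show 1: "m - 1 \<le> ray_row" "ray_row - m + 1 \<le> int (N ray_row)" using Max_in[OF f ne] unfolding ray_row_def by auto
  show "int (N r) < r - m + 1" if "ray_row < r"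
  proof (rule ccontr)
    assume "\<not> ?thesis"
    then have "r \<in> ?S" using that 1 by simp
    then show False using Max_ge[OF f] that unfolding ray_row_def by force
  qed
qed

lemma t_le_ray_row: "t \<le> ray_row"
  using ray_row_props(1) ray_row_props(3)[of t] diag_le_t[of t] mt by (cases "t = m - 1") force+

lemma diag_iff: "m - 1 \<le> r \<Longrightarrow> r - m + 1 \<le> int (N r) \<longleftrightarrow> r \<le> ray_row"
proof
  assume "m - 1 \<le> r" "r - m + 1 \<le> int (N r)"
  then show "r \<le> ray_row" using ray_row_props(3)[of r] by force
next
  assume r: "m - 1 \<le> r" "r \<le> ray_row"
  consider "r = m - 1" | "m \<le> r" "r \<le> t" | "t \<le> r" using r by linarith
  then show "r - m + 1 \<le> int (N r)"
  proof cases
    case 3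
    then have "N ray_row \<le> N r" using unimodal_down[OF uni _ r(2)] by simp
    then show ?thesis using ray_row_props(2) r by linarith
  qed (use diag_le_t in auto)
qed

lemma int_ray_width: "int ray_width = ray_row - m + 1"
  using ray_row_props(1) by (simp add: ray_width_def)

lemma ray_width_le: "ray_width \<le> N ray_row"
  using ray_row_props(2) int_ray_width by simp

lemma le_ray_width: "N (ray_row + 1) \<le> ray_width"
  using ray_row_props(3)[of "ray_row + 1"] int_ray_width by simp

lemma unimodal_L: "unimodal (L_rows m N) ray_row"
  unfolding unimodal_def
proof (intro conjI allI impI fin_L)
  fix r assume r: "r < ray_row"
  show "L_rows m N r \<le> L_rows m N (r + 1)"
  proof (cases "r < t")
    case True
    then show ?thesis using uni unfolding unimodal_def L_rows_def by (intro min.mono) auto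
  next
    case False
    then have "r + 1 - m + 1 \<le> int (N (r + 1))" using diag_iff[of "r + 1"] r mt by simp
    then show ?thesis unfolding L_rows_def by linarith
  qed
next
  fix r assume r: "ray_row \<le> r"
  have "int (N (r + 1)) < r + 1 - m + 1" using ray_row_props(3)[of "r + 1"] r by simp
  moreover have "N (r + 1) \<le> N r" using uni r t_le_ray_row unfolding unimodal_def by simp
  ultimately show "L_rows m N (r + 1) \<le> L_rows m N r" unfolding L_rows_def by linarith
qed

lemma L_U_rows: "L_rows m N r + U_rows m N r = N r"
  unfolding L_rows_def U_rows_def by simp

lemma L_zero_iff: "L_rows m N = (\<lambda>_. 0) \<longleftrightarrow> N m = 0"
proof
  assume "L_rows m N = (\<lambda>_. 0)"
  then have "L_rows m N m = 0" by simp
  then show "N m = 0" by (simp add: L_rows_def)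
next
  assume "N m = 0"
  then have "N r = 0" if "m \<le> r" for r using unimodal_down[OF uni, of m r] Nm that by simp
  note 0 = this
  show "L_rows m N = (\<lambda>_. 0)"
  proof
    show "L_rows m N r = 0" for r using 0[of r] by (cases "m \<le> r") (auto simp: L_rows_def)
  qed
qed

lemma split_diag_eq:
  assumes k: "of_int m = k"
  shows "split_diag k (rows_diagram N) = (rows_diagram (L_rows m N), float_diag (rows_diagram (U_rows m N)))"
proof -
  let ?D = "rows_diagram N"
  obtain d where d: "even d" "row_lengths ?D = shift_rows d N"
    using row_lengths_rows_diagram[OF uni] by blast
  have cD: "cells ?D = {(r, c). c < N (r - d)}" unfolding cells_eq d(2) cells_of_def shift_rows_def ..
  let ?A = "{\<rho>. (\<rho>, 0) \<in> cells ?D \<and> of_int \<rho> = k}"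
  have colour: "of_int \<rho> = k \<longleftrightarrow> even (\<rho> - m)" for \<rho> unfolding k[symmetric] of_int_bit_eq_iff ..
  \<comment> \<open>The only row above \<open>m\<close> that may be non-empty is
    \<open>m - 1\<close>, and it has the other colour.\<close>
  have ge: "m + d \<le> \<rho>" if "\<rho> \<in> ?A" for \<rho>
  proof (rule ccontr)
    assume "\<not> ?thesis"
    then have "\<rho> - d \<le> m - 1" by simp
    moreover have "\<not> \<rho> - d < m - 1" using zero[of "\<rho> - d"] that unfolding cD by auto
    ultimately have "\<rho> = m + d - 1" by simp
    then show False using that d(1) unfolding colour by simp
  qed
  show ?thesis
  proof (cases "N m = 0")
    case True
    then have N0: "N r = 0" if "m \<le> r" for r using unimodal_down[OF uni, of m r] Nm that by simp
    then have A: "?A = {}" using ge unfolding cD by fastforce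
    \<comment> \<open>Here \<open>split_diag\<close> returns the diagram without floating it, so
      floating has to be seen to fix upper ledge diagrams.\<close>
    have "U_rows m N = N"
    proof
      show "U_rows m N r = N r" for r using N0[of r] by (cases "m \<le> r") (auto simp: U_rows_def)
    qed
    moreover have "float_diag ?D = ?D"
      by (rule float_diag_eq[OF uni upper_rows_diagram[OF N]]) (simp add: d col_sim_shift)
    ultimately show ?thesis using A L_zero_iff True unfolding split_diag_def by (simp add: Let_def)
  next
    case False
    have fA: "finite ?A"
      by (rule finite_subset[of _ "(\<lambda>r. r + d) ` {r. 0 < N r}"]) (use fin in \<open>auto simp: cD image_iff intro!: exI[of _ "x - d" for x]\<close>)
    have mA: "m + d \<in> ?A" unfolding cD colour using False d(1) by auto
    have Min: "Min ?A = m + d" by (rule Min_eqI[OF fA ge mA])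
    let ?L = "{(\<rho>, c). (\<rho>, c) \<in> cells ?D \<and> \<rho> - int c \<ge> Min ?A}"
    have L: "?L = cells_of (shift_rows d (L_rows m N))"
      unfolding Min unfolding cD cells_of_def shift_rows_def L_rows_def by auto
    have fsL: "finite {r. 0 < shift_rows d (L_rows m N) r}"
      by (rule finite_subset[of _ "(\<lambda>r. r + d) ` {r. 0 < L_rows m N r}"])
        (use fin_L in \<open>auto simp: shift_rows_def image_iff intro!: exI[of _ "x - d" for x]\<close>)
    have lj: "left_justify ?L = rows_diagram (L_rows m N)"
      unfolding L left_justify_cells_of[OF fsL] by (rule rows_diagram_shift[OF fin_L d(1)])
    have "finite (cells ?D - ?L)" unfolding cells_eq using finite_cells_of[OF finite_row_lengths] by simp
    moreover have "(\<lambda>r. card {c. (r, c) \<in> cells ?D - ?L}) = shift_rows d (U_rows m N)"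
    proof
      fix r
      have "{c. (r, c) \<in> cells ?D - ?L} = {nat (r - d - m + 1)..<N (r - d)}"
        unfolding Min unfolding cD by auto
      then show "card {c. (r, c) \<in> cells ?D - ?L} = shift_rows d (U_rows m N) r"
        by (simp add: U_rows_def shift_rows_def)
    qed
    ultimately have "left_justify (cells ?D - ?L) = rows_diagram (U_rows m N)"
      using left_justify_eq[of "cells ?D - ?L"] rows_diagram_shift[OF fin_U d(1)] by simp
    moreover have "split_diag k ?D = (left_justify ?L, float_diag (left_justify (cells ?D - ?L)))"
    proof -
      have "?A \<noteq> {}" using mA by blast
      then show ?thesis unfolding split_diag_def Let_def by (rule if_not_P)
    qed
    ultimately show ?thesis using lj by simp
  qed
qed

text \<open>Rows between \<open>m\<close> and the peak contain their cell on the ray, so a column of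
  the part weakly below the ray has no gap up to the ray. This is what makes \<open>strip\<close> a
  partition.\<close>

lemma strip_down:
  assumes "c < N r" "m + int c \<le> r'" "r' \<le> r"
  shows "c < N r'"
proof (cases "t \<le> r'")
  case True
  then show ?thesis using unimodal_down[OF uni True assms(3)] assms(1) by simp
next
  case False
  then show ?thesis using diag_le_t[of r'] assms(2) by simp
qed

lemma top_align_L: "top_align (rows_diagram (L_rows m N)) = strip m N"
proof -
  obtain d where d: "even d" "row_lengths (rows_diagram (L_rows m N)) = shift_rows d (L_rows m N)"
    using row_lengths_rows_diagram[OF unimodal_L] by blast
  have "r < card {\<rho>. (\<rho>, c) \<in> cells (rows_diagram (L_rows m N))} \<longleftrightarrow> c < N (m + int r + int c)" for r c
  proof -
    let ?X = "{\<rho>. m + int c \<le> \<rho> \<and> c < N \<rho>}"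
    have fX: "finite ?X" using column_finite[OF uni, of c] by simp
    have "{\<rho>. (\<rho>, c) \<in> cells (rows_diagram (L_rows m N))} = (\<lambda>r. r + d) ` ?X"
      (is "?Y = _")
    proof (rule set_eqI)
      fix \<rho>
      have "\<rho> \<in> ?Y \<longleftrightarrow> c < N (\<rho> - d) \<and> m + int c \<le> \<rho> - d"
        unfolding cells_eq d(2) unfolding cells_of_def shift_rows_def L_rows_def by auto
      also have "\<dots> \<longleftrightarrow> \<rho> \<in> (\<lambda>r. r + d) ` ?X"
      proof
        assume "c < N (\<rho> - d) \<and> m + int c \<le> \<rho> - d"
        then show "\<rho> \<in> (\<lambda>r. r + d) ` ?X" by (intro image_eqI[of _ _ "\<rho> - d"]) auto
      qed auto
      finally show "\<rho> \<in> ?Y \<longleftrightarrow> \<rho> \<in> (\<lambda>r. r + d) ` ?X" .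
    qed
    then have card: "card {\<rho>. (\<rho>, c) \<in> cells (rows_diagram (L_rows m N))} = card ?X"
      by (simp add: card_image)
    show ?thesis
    proof (cases "?X = {}")
      case True
      then have "card ?X = 0" by (simp only: card.empty)
      moreover have "m + int r + int c \<notin> ?X" using True by blast
      ultimately show ?thesis unfolding card by simp
    next
      case False
      define M where "M = Max ?X"
      have M: "m + int c \<le> M" "c < N M" using Max_in[OF fX False] unfolding M_def by auto
      have X: "?X = {m + int c..M}"
        using Max_ge[OF fX] strip_down[OF M(2)] unfolding M_def[symmetric] by auto
      then have "card ?X = card {m + int c..M}" by (rule arg_cong)
      then have "card ?X = nat (M - (m + int c) + 1)" by (simp only: card_atLeastAtMost_int)
      then have "r < card ?X \<longleftrightarrow> m + int r + int c \<le> M" using M(1) by auto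
      also have "\<dots> \<longleftrightarrow> m + int r + int c \<in> ?X" unfolding X by simp
      finally show ?thesis unfolding card by simp
    qed
  qed
  then show ?thesis unfolding top_align_def strip_def by simp
qed

lemma shear_strip:
  assumes k: "of_int m = k"
  shows "shear k (strip m N) = rows_diagram (L_rows m N)"
proof -
  \<comment> \<open>The height used in \<open>shear\<close>; it has the parity of \<open>m\<close>,
    since both rows have colour \<open>k\<close>.\<close>
  define k' :: int where "k' = (if k = 0 then 0 else 1)"
  have "of_int k' = k" by (cases k) (simp_all add: k'_def)
  then have ev: "even (k' - m)" unfolding k[symmetric] of_int_bit_eq_iff .
  have "{(k' + int r + int c, c) | r c. (r, c) \<in> strip m N} = cells_of (shift_rows (k' - m) (L_rows m N))"
  proof -
    have "(\<exists>r. \<rho> = k' + int r + int c \<and> (r, c) \<in> strip m N) \<longleftrightarrow> c < shift_rows (k' - m) (L_rows m N) \<rho>" for \<rho> c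
    proof
      assume "c < shift_rows (k' - m) (L_rows m N) \<rho>"
      then have "c < N (\<rho> - (k' - m))" "int c \<le> \<rho> - k'" by (auto simp: shift_rows_def L_rows_def)
      then have "\<rho> = k' + int (nat (\<rho> - k' - int c)) + int c \<and> (nat (\<rho> - k' - int c), c) \<in> strip m N"
        by (simp add: strip_def algebra_simps)
      then show "\<exists>r. \<rho> = k' + int r + int c \<and> (r, c) \<in> strip m N" by blast
    qed (auto simp: shift_rows_def L_rows_def strip_def algebra_simps)
    note * = this
    show ?thesis unfolding cells_of_def using * by auto
  qed
  moreover have "finite {r. 0 < shift_rows (k' - m) (L_rows m N) r}"
    by (rule finite_subset[of _ "(\<lambda>r. r + (k' - m)) ` {r. 0 < L_rows m N r}"])
      (use fin_L in \<open>auto simp: shift_rows_def image_iff intro!: exI[of _ "x - (k' - m)" for x]\<close>)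
  ultimately have "shear k (strip m N) = rows_diagram (shift_rows (k' - m) (L_rows m N))"
    using left_justify_cells_of unfolding shear_def k'_def by simp
  then show ?thesis using rows_diagram_shift[OF fin_L ev] by simp
qed

end


section \<open>Addable and removable boxes\<close>

lemma residue_eq: "residue \<kappa> (t, r, c) = \<kappa> t + of_int (int r + int c)"
proof -
  have "residue \<kappa> (t, r, c) = \<kappa> t + (of_int (int c) - of_int (int r))"
    by (simp only: residue.simps of_int_of_nat_eq add_diff_eq)
  also have "(of_int (int c) - of_int (int r) :: bit) = of_int (int c - int r)" by (simp only: of_int_diff)
  also have "\<dots> = (of_int (int r + int c) :: bit)" unfolding of_int_bit_eq_iff by simp
  finally show ?thesis .
qed

lemma residue_eq_iff: "residue \<kappa> (t, r, c) = residue \<kappa> (t, r', c') \<longleftrightarrow> even (int r + int c - (int r' + int c'))"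
  unfolding residue_eq add_left_cancel of_int_bit_eq_iff ..

lemma young_remove:
  assumes "young Y" "(r, c) \<in> Y"
  shows "young (Y - {(r, c)}) \<longleftrightarrow> (Suc r, c) \<notin> Y \<and> (r, Suc c) \<notin> Y"
proof
  assume y: "young (Y - {(r, c)})"
  have False if "(Suc r, c) \<in> Y - {(r, c)} \<or> (r, Suc c) \<in> Y - {(r, c)}"
  proof -
    have "(r, c) \<in> Y - {(r, c)}"
      using that y unfolding young_def by (meson le_SucI le_refl)
    then show False by simp
  qed
  then show "(Suc r, c) \<notin> Y \<and> (r, Suc c) \<notin> Y" by auto
next
  assume n: "(Suc r, c) \<notin> Y \<and> (r, Suc c) \<notin> Y"
  have fin: "finite Y" and Y: "\<And>r c r' c'. (r, c) \<in> Y \<Longrightarrow> r' \<le> r \<Longrightarrow> c' \<le> c \<Longrightarrow> (r', c') \<in> Y"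
    using assms(1) unfolding young_def by blast+
  have "(r', c') \<in> Y - {(r, c)}" if "(a, b) \<in> Y - {(r, c)}" "r' \<le> a" "c' \<le> b" for a b r' c'
  proof -
    have "(r', c') \<noteq> (r, c)"
    proof
      assume "(r', c') = (r, c)"
      then have "Suc r \<le> a \<or> Suc c \<le> b" using that by auto
      then show False using Y[of a b "Suc r" c] Y[of a b r "Suc c"] that \<open>(r', c') = (r, c)\<close> n by auto
    qed
    then show ?thesis using Y[of a b r' c'] that by auto
  qed
  then show "young (Y - {(r, c)})" using fin unfolding young_def by blast
qed

lemma young_insert:
  assumes "young Y" "(r, c) \<notin> Y"
  shows "young (insert (r, c) Y) \<longleftrightarrow> (r = 0 \<or> (r - 1, c) \<in> Y) \<and> (c = 0 \<or> (r, c - 1) \<in> Y)"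
proof
  assume y: "young (insert (r, c) Y)"
  have "(r - 1, c) \<in> insert (r, c) Y" "(r, c - 1) \<in> insert (r, c) Y"
    using y unfolding young_def by (meson diff_le_self insertI1 le_refl)+
  then show "(r = 0 \<or> (r - 1, c) \<in> Y) \<and> (c = 0 \<or> (r, c - 1) \<in> Y)" by auto
next
  assume n: "(r = 0 \<or> (r - 1, c) \<in> Y) \<and> (c = 0 \<or> (r, c - 1) \<in> Y)"
  have fin: "finite Y" and Y: "\<And>r c r' c'. (r, c) \<in> Y \<Longrightarrow> r' \<le> r \<Longrightarrow> c' \<le> c \<Longrightarrow> (r', c') \<in> Y"
    using assms(1) unfolding young_def by blast+
  have "(r', c') \<in> insert (r, c) Y" if "(a, b) \<in> insert (r, c) Y" "r' \<le> a" "c' \<le> b" for a b r' c'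
  proof (cases "(a, b) = (r, c)")
    case True
    show ?thesis
    proof (cases "(r', c') = (r, c)")
      case False
      then have "r' \<le> r - 1 \<and> c' \<le> c \<and> r \<noteq> 0 \<or> r' \<le> r \<and> c' \<le> c - 1 \<and> c \<noteq> 0" using that True by auto
      then show ?thesis using n Y by blast
    qed simp
  next
    case False
    then show ?thesis using that Y by blast
  qed
  then show "young (insert (r, c) Y)" using fin unfolding young_def by blast
qed

lemma MP_young: "\<mu> \<in> MP \<Longrightarrow> young (\<mu> t)"
  by (simp add: MP_def)

lemma MP_update: "\<mu> \<in> MP \<Longrightarrow> \<mu>(t := Y) \<in> MP \<longleftrightarrow> young Y"
proof
  assume "\<mu> \<in> MP" "young Y"
  moreover have "{t'. (\<mu>(t := Y)) t' \<noteq> {}} \<subseteq> insert t {t. \<mu> t \<noteq> {}}" by auto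
  ultimately have "finite {t'. (\<mu>(t := Y)) t' \<noteq> {}}" using finite_subset unfolding MP_def by blast
  then show "\<mu>(t := Y) \<in> MP" using \<open>\<mu> \<in> MP\<close> \<open>young Y\<close> unfolding MP_def by simp
qed (auto simp: MP_def dest: spec[of _ t])

lemma removable_iff:
  assumes "\<mu> \<in> MP"
  shows "(t, r, c) \<in> removable \<kappa> i \<mu> \<longleftrightarrow>
    (r, c) \<in> \<mu> t \<and> residue \<kappa> (t, r, c) = i \<and> (Suc r, c) \<notin> \<mu> t \<and> (r, Suc c) \<notin> \<mu> t"
  unfolding removable_def mp_boxes_def del_box.simps mem_Collect_eq MP_update[OF assms]
  using young_remove[OF MP_young[OF assms, of t]] by auto

lemma addable_iff:
  assumes "\<mu> \<in> MP"
  shows "(t, r, c) \<in> addable \<kappa> i \<mu> \<longleftrightarrow>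
    (r, c) \<notin> \<mu> t \<and> residue \<kappa> (t, r, c) = i \<and> (r = 0 \<or> (r - 1, c) \<in> \<mu> t) \<and> (c = 0 \<or> (r, c - 1) \<in> \<mu> t)"
  unfolding addable_def mp_boxes_def add_box.simps mem_Collect_eq MP_update[OF assms]
  using young_insert[OF MP_young[OF assms, of t]] by auto

text \<open>The neighbours of \<open>u\<close> have the other residue, so for residue
  \<open>i\<close> only \<open>u\<close> itself changes its status.\<close>

lemma add_box_removable_addable:
  assumes \<mu>: "\<mu> \<in> MP" and u: "u \<in> addable \<kappa> i \<mu>"
  shows "removable \<kappa> i (add_box u \<mu>) = insert u (removable \<kappa> i \<mu>)"
    "addable \<kappa> i (add_box u \<mu>) = addable \<kappa> i \<mu> - {u}" "add_box u \<mu> \<in> MP"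
proof -
  obtain t r c where utrc: "u = (t, r, c)" by (metis surj_pair)
  let ?\<mu>' = "add_box u \<mu>"
  show M: "?\<mu>' \<in> MP" using u by (simp add: addable_def)
  have ures: "residue \<kappa> (t, r, c) = i" and un: "(r, c) \<notin> \<mu> t"
    using u unfolding utrc addable_iff[OF \<mu>] by auto
  have nb: "(r, c) \<noteq> (a, b)" if "residue \<kappa> (t, r', c') = i" "odd (int a + int b - (int r' + int c'))" for a b r' c'
    using that ures residue_eq_iff[of \<kappa> t r c r' c'] by auto
  have m': "b \<in> ?\<mu>' t' \<longleftrightarrow> b \<in> \<mu> t' \<or> t' = t \<and> b = (r, c)" for b t'
    unfolding utrc by auto
  have Y: "(r', c') \<in> \<mu> t" if "(a, b) \<in> \<mu> t" "r' \<le> a" "c' \<le> b" for a b r' c'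
    using MP_young[OF \<mu>, of t] that unfolding young_def by blast
  have "v \<in> removable \<kappa> i ?\<mu>' \<longleftrightarrow> v = u \<or> v \<in> removable \<kappa> i \<mu>" for v
  proof -
    obtain t' r' c' where v: "v = (t', r', c')" by (metis surj_pair)
    show ?thesis
    proof (cases "residue \<kappa> (t', r', c') = i \<and> t' = t")
      case True
      then have t: "t' = t" and res: "residue \<kappa> (t, r', c') = i" by auto
      have "(r, c) \<noteq> (Suc r', c')" "(r, c) \<noteq> (r', Suc c')" using nb[OF res, of "Suc r'" c'] nb[OF res, of r' "Suc c'"] by auto
      moreover have "(Suc r, c) \<notin> \<mu> t" "(r, Suc c) \<notin> \<mu> t" using Y un by (meson le_SucI le_refl)+
      ultimately show ?thesis unfolding v removable_iff[OF M] removable_iff[OF \<mu>] m' unfolding utrc t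
        using res by auto
    next
      case False
      then show ?thesis unfolding v removable_iff[OF M] removable_iff[OF \<mu>] m' unfolding utrc using ures by auto
    qed
  qed
  then show "removable \<kappa> i ?\<mu>' = insert u (removable \<kappa> i \<mu>)" by blast
  have "v \<in> addable \<kappa> i ?\<mu>' \<longleftrightarrow> v \<noteq> u \<and> v \<in> addable \<kappa> i \<mu>" for v
  proof -
    obtain t' r' c' where v: "v = (t', r', c')" by (metis surj_pair)
    show ?thesis
    proof (cases "residue \<kappa> (t', r', c') = i \<and> t' = t")
      case True
      then have t: "t' = t" and res: "residue \<kappa> (t, r', c') = i" by auto
      have "r' = 0 \<or> (r, c) \<noteq> (r' - 1, c')" "c' = 0 \<or> (r, c) \<noteq> (r', c' - 1)"
        using nb[OF res, of "r' - 1" c'] nb[OF res, of r' "c' - 1"] by (auto simp: of_nat_diff)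
      then show ?thesis unfolding v addable_iff[OF M] addable_iff[OF \<mu>] m' unfolding utrc t
        using res by auto
    next
      case False
      then show ?thesis unfolding v addable_iff[OF M] addable_iff[OF \<mu>] m' unfolding utrc using ures by auto
    qed
  qed
  then show "addable \<kappa> i ?\<mu>' = addable \<kappa> i \<mu> - {u}" by blast
qed

section \<open>Words of multipartitions\<close>

text \<open>A finite word cannot list infinitely many addable boxes. From component \<open>T\<close>
  on the only boxes that matter are the first boxes of components of charge \<open>i\<close>; these
  stay outside the word and precede it in reading order.\<close>

definition mpword :: "(nat \<Rightarrow> bit) \<Rightarrow> bit \<Rightarrow> multipartition \<Rightarrow> nat \<Rightarrow> (bool \<times> node) list \<Rightarrow> bool" where
  "mpword \<kappa> i \<mu> T xs \<longleftrightarrow> sorted_wrt above (map snd xs) \<and> (\<forall>u \<in> snd ` set xs. fst u < T) \<and>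
     removable \<kappa> i \<mu> = {u. (False, u) \<in> set xs} \<and>
     addable \<kappa> i \<mu> = {(t, 0, 0) | t. T \<le> t \<and> \<kappa> t = i} \<union> {u. (True, u) \<in> set xs}"

lemma above_asym: "above x y \<Longrightarrow> \<not> above y x"
  by (cases x; cases y) auto

lemma above_irrefl: "\<not> above x x"
  using above_asym by blast

lemma sorted_above_distinct: "sorted_wrt above xs \<Longrightarrow> distinct xs"
  by (induction xs) (auto simp: above_irrefl)

lemma mp_parts:
  assumes w: "mpword \<kappa> i \<mu> T xs" and red: "reduce xs = (As, Rs)"
  shows "mp_unarced \<kappa> i \<mu> \<inter> removable \<kappa> i \<mu> = set Rs"
    "mp_unarced \<kappa> i \<mu> \<inter> addable \<kappa> i \<mu> = {(t, 0, 0) | t. T \<le> t \<and> \<kappa> t = i} \<union> set As"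
    "sorted_wrt above As" "sorted_wrt above Rs"
    "\<And>x y. x \<in> {(t, 0, 0) | t. T \<le> t \<and> \<kappa> t = i} \<Longrightarrow> y \<in> snd ` set xs \<Longrightarrow> above x y \<and> x \<noteq> y"
proof -
  let ?I = "{(t, 0 :: nat, 0 :: nat) | t. T \<le> t \<and> \<kappa> t = i}"
  have s: "sorted_wrt above (map snd xs)" and lt: "\<forall>u \<in> snd ` set xs. fst u < T"
    and R: "removable \<kappa> i \<mu> = {u. (False, u) \<in> set xs}" and A: "addable \<kappa> i \<mu> = ?I \<union> {u. (True, u) \<in> set xs}"
    using w unfolding mpword_def by blast+
  show I: "above x y \<and> x \<noteq> y" if "x \<in> ?I" "y \<in> snd ` set xs" for x y
  proof -
    have "fst y < T" using that lt by blast
    then show ?thesis using that(1) by (cases y) auto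
  qed
  show "mp_unarced \<kappa> i \<mu> \<inter> removable \<kappa> i \<mu> = set Rs" "mp_unarced \<kappa> i \<mu> \<inter> addable \<kappa> i \<mu> = ?I \<union> set As"
    unfolding mp_unarced_def
    using unarced_word_parts[OF s sorted_above_distinct[OF s] R A I above_asym red] by simp_all
  show "sorted_wrt above As" "sorted_wrt above Rs" using sorted_reduce[OF red s] by auto
qed

lemma mp_eps_eq:
  assumes "mpword \<kappa> i \<mu> T xs" "reduce xs = (As, Rs)"
  shows "mp_eps \<kappa> i \<mu> = int (length Rs)"
  unfolding mp_eps_def mp_parts(1)[OF assms]
  using distinct_card[OF sorted_above_distinct[OF mp_parts(4)[OF assms]]] by simp

lemma mp_f_eq:
  assumes "mpword \<kappa> i \<mu> T xs" "reduce xs = (As, Rs)" "As \<noteq> []"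
  shows "mp_f \<kappa> i \<mu> = add_box (last As) \<mu>" "last As \<in> addable \<kappa> i \<mu>"
proof -
  have sub: "set As \<subseteq> snd ` set xs" using reduce_label_set[OF assms(2)] by simp
  have "last_box above ({(t, 0, 0) | t. T \<le> t \<and> \<kappa> t = i} \<union> set As) = last As"
    using mp_parts(5)[OF assms(1,2)] sub
    by (intro last_box_sorted[OF above_asym mp_parts(3)[OF assms(1,2)] assms(3)]) blast+
  then show "mp_f \<kappa> i \<mu> = add_box (last As) \<mu>" unfolding mp_f_def mp_parts(2)[OF assms(1,2)] by simp
  have "last As \<in> mp_unarced \<kappa> i \<mu> \<inter> addable \<kappa> i \<mu>" unfolding mp_parts(2)[OF assms(1,2)] using assms(3) by simp
  then show "last As \<in> addable \<kappa> i \<mu>" by blast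
qed

lemma mp_e_eq:
  assumes "mpword \<kappa> i \<mu> T xs" "reduce xs = (As, Rs)"
  shows "mp_e \<kappa> i \<mu> = (if Rs = [] then None else Some (del_box (hd Rs) \<mu>))"
  unfolding mp_e_def mp_parts(1)[OF assms]
  using first_box_sorted[OF above_asym mp_parts(4)[OF assms]] by (auto simp: Let_def)

text \<open>The charge \<open>i\<close> recurs, so the nearest addable box outside the word can be
  put at its front. Read first, it survives, whence \<open>mp_f\<close> always finds a box to
  add.\<close>

lemma mpword_extend:
  assumes "multicharge \<kappa>" "mpword \<kappa> i \<mu> T xs"
  obtains T' xs' where "mpword \<kappa> i \<mu> T' xs'" "fst (reduce xs') \<noteq> []" "snd (reduce xs') = snd (reduce xs)"
    "\<exists>x. reduce xs' = (x # fst (reduce xs), snd (reduce xs))"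
proof -
  have "infinite {t. \<kappa> t = i}" using assms(1) by (cases i) (auto simp: multicharge_def)
  then have ex: "\<exists>t. T \<le> t \<and> \<kappa> t = i" unfolding finite_nat_set_iff_bounded by (metis leI mem_Collect_eq)
  define t0 where "t0 = (LEAST t. T \<le> t \<and> \<kappa> t = i)"
  have t0: "T \<le> t0" "\<kappa> t0 = i" using LeastI_ex[OF ex] unfolding t0_def by auto
  have least: "t0 \<le> t" if "T \<le> t" "\<kappa> t = i" for t using that unfolding t0_def by (simp add: Least_le)
  let ?xs = "(True, (t0, 0, 0)) # xs"
  have *: "(T \<le> t \<and> \<kappa> t = i) \<longleftrightarrow> (Suc t0 \<le> t \<and> \<kappa> t = i) \<or> t = t0" for t
    using least[of t] t0 by (cases "t = t0") auto
  have lt: "\<forall>u \<in> snd ` set xs. fst u < T" using assms(2) unfolding mpword_def by blast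
  have "above (t0, 0, 0) u" if "u \<in> snd ` set xs" for u
    using that lt t0(1) by (cases u) fastforce
  moreover have "fst u < Suc t0" if "u \<in> snd ` set xs" for u
    using that lt t0(1) by fastforce
  moreover have "{(t, 0 :: nat, 0 :: nat) | t. T \<le> t \<and> \<kappa> t = i} = insert (t0, 0, 0) {(t, 0, 0) | t. Suc t0 \<le> t \<and> \<kappa> t = i}"
    unfolding * by auto
  ultimately have "mpword \<kappa> i \<mu> (Suc t0) ?xs"
    using assms(2) unfolding mpword_def by auto
  moreover have "reduce ?xs = ((t0, 0, 0) # fst (reduce xs), snd (reduce xs))"
    by (rule reduce_cons_True) simp
  ultimately show ?thesis using that by simp
qed

lemma mp_f_addable:
  assumes "multicharge \<kappa>" "mpword \<kappa> i \<mu> T xs"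
  obtains u where "u \<in> addable \<kappa> i \<mu>" "mp_f \<kappa> i \<mu> = add_box u \<mu>"
  using mpword_extend[OF assms] mp_f_eq by (metis prod.collapse)

text \<open>Adding the box only turns its letter around. By \<open>flip_last\<close> it becomes the
  first surviving \<open>False\<close>, which is the box that \<open>mp_e\<close> deletes.\<close>

lemma mp_e_mp_f:
  assumes \<kappa>: "multicharge \<kappa>" and \<mu>: "\<mu> \<in> MP" and w: "mpword \<kappa> i \<mu> T xs"
  shows "mp_e \<kappa> i (mp_f \<kappa> i \<mu>) = Some \<mu>"
proof -
  obtain T xs where w: "mpword \<kappa> i \<mu> T xs" and ne: "fst (reduce xs) \<noteq> []"
    using mpword_extend[OF \<kappa> w] by metis
  obtain As Rs where red: "reduce xs = (As, Rs)" by fastforce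
  have ne: "As \<noteq> []" using ne red by simp
  let ?u = "last As"
  note f = mp_f_eq[OF w red ne]
  have "(True, ?u) \<in> set xs" using reduce_labels(1)[OF red] ne by auto
  from split_list[OF this] obtain p q where pq: "xs = p @ (True, ?u) # q" by blast
  have s: "sorted_wrt above (map snd xs)" using w unfolding mpword_def by blast
  note d = sorted_above_distinct[OF s]
  let ?xs = "p @ (False, ?u) # q"
  have red': "reduce ?xs = (butlast As, ?u # Rs)"
    using flip_last[of p ?u q As Rs] red d ne unfolding pq[symmetric] by simp
  note ra = add_box_removable_addable[OF \<mu> f(2)]
  have notin: "?u \<notin> snd ` (set p \<union> set q)" using d unfolding pq by auto
  have uI: "?u \<notin> {(t, 0, 0) | t. T \<le> t \<and> \<kappa> t = i}"
    using mp_parts(5)[OF w red, of ?u ?u] pq by force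
  have w': "mpword \<kappa> i (add_box ?u \<mu>) T ?xs"
  proof -
    have "{u. (False, u) \<in> set (p @ (False, x) # q)} = insert x {u. (False, u) \<in> set (p @ (True, x) # q)}" for x
      by auto
    from this[of ?u] have F: "{u. (False, u) \<in> set ?xs} = insert ?u {u. (False, u) \<in> set xs}" unfolding pq[symmetric] .
    have "{u. (True, u) \<in> set (p @ (False, x) # q)} = {u. (True, u) \<in> set (p @ (True, x) # q)} - {x}"
      if "x \<notin> snd ` (set p \<union> set q)" for x
      using that by force
    from this[OF notin] have Tr: "{u. (True, u) \<in> set ?xs} = {u. (True, u) \<in> set xs} - {?u}" unfolding pq[symmetric] .
    have "map snd (p @ (False, x) # q) = map snd (p @ (True, x) # q)"
      "snd ` set (p @ (False, x) # q) = snd ` set (p @ (True, x) # q)" for x by simp_all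
    from this[of ?u] have "map snd ?xs = map snd xs" "snd ` set ?xs = snd ` set xs" unfolding pq[symmetric] by simp_all
    note m = this
    have Re: "removable \<kappa> i \<mu> = {u. (False, u) \<in> set xs}"
      and Ad: "addable \<kappa> i \<mu> = {(t, 0, 0) | t. T \<le> t \<and> \<kappa> t = i} \<union> {u. (True, u) \<in> set xs}"
      and lt: "\<forall>u \<in> snd ` set xs. fst u < T"
      using w unfolding mpword_def by simp_all
    have D: "(I \<union> X) - {x} = I \<union> (X - {x})" if "x \<notin> I" for I X :: "node set" and x using that by blast
    show ?thesis unfolding mpword_def m F Tr ra Re Ad D[OF uI] using s lt by simp
  qed
  have "mp_e \<kappa> i (add_box ?u \<mu>) = Some (del_box ?u (add_box ?u \<mu>))"
    using mp_e_eq[OF w' red'] by simp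
  also have "del_box ?u (add_box ?u \<mu>) = \<mu>"
    using f(2) by (cases ?u) (auto simp: addable_def mp_boxes_def fun_eq_iff)
  finally show ?thesis using f(1) by simp
qed

section \<open>Adding a component\<close>

lemma case_nat_update: "(case_nat Y \<mu>)(0 := Z) = case_nat Z \<mu>" "(case_nat Y \<mu>)(Suc t := Z) = case_nat Y (\<mu>(t := Z))"
  by (auto simp: fun_eq_iff split: nat.split)

lemma case_nat_MP: "case_nat Y \<mu> \<in> MP \<longleftrightarrow> young Y \<and> \<mu> \<in> MP"
proof -
  have "{t. case_nat Y \<mu> t \<noteq> {}} = (if Y = {} then {} else {0}) \<union> Suc ` {t. \<mu> t \<noteq> {}}" (is "?l = ?r")
  proof (rule set_eqI)
    show "t \<in> ?l \<longleftrightarrow> t \<in> ?r" for t by (cases t) auto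
  qed
  then have "finite {t. case_nat Y \<mu> t \<noteq> {}} \<longleftrightarrow> finite {t. \<mu> t \<noteq> {}}"
    by (simp add: finite_image_iff)
  moreover have "(\<forall>t. young (case_nat Y \<mu> t)) \<longleftrightarrow> young Y \<and> (\<forall>t. young (\<mu> t))"
    by (metis nat.case nat.exhaust)
  ultimately show ?thesis unfolding MP_def by blast
qed

lemma residue_Suc: "residue \<kappa> (Suc t, b) = residue (\<kappa> \<circ> Suc) (t, b)"
  by (cases b) simp

lemma removable_case_nat:
  assumes "case_nat Y \<mu> \<in> MP"
  shows "(0, b) \<in> removable \<kappa> i (case_nat Y \<mu>) \<longleftrightarrow> b \<in> Y \<and> residue \<kappa> (0, b) = i \<and> young (Y - {b})"
    "(Suc t, b) \<in> removable \<kappa> i (case_nat Y \<mu>) \<longleftrightarrow> (t, b) \<in> removable (\<kappa> \<circ> Suc) i \<mu>"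
  using assms unfolding removable_def mp_boxes_def mem_Collect_eq del_box.simps case_nat_update case_nat_MP residue_Suc
  by auto

lemma addable_case_nat:
  assumes "case_nat Y \<mu> \<in> MP"
  shows "(0, b) \<in> addable \<kappa> i (case_nat Y \<mu>) \<longleftrightarrow> b \<notin> Y \<and> residue \<kappa> (0, b) = i \<and> young (insert b Y)"
    "(Suc t, b) \<in> addable \<kappa> i (case_nat Y \<mu>) \<longleftrightarrow> (t, b) \<in> addable (\<kappa> \<circ> Suc) i \<mu>"
  using assms unfolding addable_def mp_boxes_def mem_Collect_eq add_box.simps case_nat_update case_nat_MP residue_Suc
  by auto

definition compword :: "bit \<Rightarrow> bit \<Rightarrow> (nat \<times> nat) set \<Rightarrow> (bool \<times> nat \<times> nat) list \<Rightarrow> bool" where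
  "compword k i Y ys \<longleftrightarrow> sorted_wrt (\<lambda>b b'. fst b < fst b') (map snd ys) \<and>
     {b. (False, b) \<in> set ys} = {b \<in> Y. residue (\<lambda>_. k) (0, b) = i \<and> young (Y - {b})} \<and>
     {b. (True, b) \<in> set ys} = {b. b \<notin> Y \<and> residue (\<lambda>_. k) (0, b) = i \<and> young (insert b Y)}"

lemma residue_const: "residue (\<lambda>_. \<kappa> 0) (0, b) = residue \<kappa> (0, b)"
  by (cases b) simp

text \<open>Component 0 is at the bottom, so its letters are read after those of all other
  components.\<close>

lemma mpword_case_nat:
  assumes M: "case_nat Y \<mu> \<in> MP" and w: "mpword (\<kappa> \<circ> Suc) i \<mu> T xs" and c: "compword (\<kappa> 0) i Y ys"
  shows "mpword \<kappa> i (case_nat Y \<mu>) (Suc T) (map (apsnd (apfst Suc)) xs @ map (apsnd (Pair 0)) ys)"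
    (is "mpword _ _ ?\<mu> _ ?ws")
proof -
  let ?I = "{(t, 0 :: nat, 0 :: nat) | t. T \<le> t \<and> (\<kappa> \<circ> Suc) t = i}"
  let ?J = "{(t, 0 :: nat, 0 :: nat) | t. Suc T \<le> t \<and> \<kappa> t = i}"
  have s: "sorted_wrt above (map snd xs)" and lt: "\<forall>u \<in> snd ` set xs. fst u < T"
    and R: "\<And>u. u \<in> removable (\<kappa> \<circ> Suc) i \<mu> \<longleftrightarrow> (False, u) \<in> set xs"
    and A: "\<And>u. u \<in> addable (\<kappa> \<circ> Suc) i \<mu> \<longleftrightarrow> u \<in> ?I \<or> (True, u) \<in> set xs"
    using w unfolding mpword_def by blast+
  have sc: "sorted_wrt (\<lambda>b b'. fst b < fst b') (map snd ys)"
    and Rc: "\<And>b. (False, b) \<in> set ys \<longleftrightarrow> b \<in> Y \<and> residue \<kappa> (0, b) = i \<and> young (Y - {b})"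
    and Ac: "\<And>b. (True, b) \<in> set ys \<longleftrightarrow> b \<notin> Y \<and> residue \<kappa> (0, b) = i \<and> young (insert b Y)"
    using c unfolding compword_def residue_const by blast+
  have ws: "(b, t, x) \<in> set ?ws \<longleftrightarrow> (case t of 0 \<Rightarrow> (b, x) \<in> set ys | Suc t \<Rightarrow> (b, t, x) \<in> set xs)" for b t x
    by (cases t) (force simp: image_iff)+
  have "sorted_wrt above (map snd ?ws)"
  proof -
    have 1: "sorted_wrt above (map (apfst Suc) (map snd xs))"
      unfolding sorted_wrt_map using s[unfolded sorted_wrt_map]
      by (rule sorted_wrt_mono_rel[rotated]) auto
    have 2: "sorted_wrt above (map (Pair 0) (map snd ys))"
      unfolding sorted_wrt_map using sc[unfolded sorted_wrt_map]
      by (rule sorted_wrt_mono_rel[rotated]) auto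
    have "map snd ?ws = map (apfst Suc) (map snd xs) @ map (Pair 0) (map snd ys)" by simp
    moreover have "above x y" if "x \<in> set (map (apfst Suc) (map snd xs))" "y \<in> set (map (Pair 0) (map snd ys))" for x y
      using that by auto
    ultimately show ?thesis using 1 2 by (simp only: sorted_wrt_append) blast
  qed
  moreover have "\<forall>u \<in> snd ` set ?ws. fst u < Suc T" using lt by auto
  moreover have "v \<in> removable \<kappa> i ?\<mu> \<longleftrightarrow> (False, v) \<in> set ?ws" for v
  proof -
    obtain t x where v: "v = (t, x)" by (rule prod.exhaust)
    show ?thesis unfolding v ws using removable_case_nat[OF M] R Rc by (cases t) auto
  qed
  moreover have "v \<in> addable \<kappa> i ?\<mu> \<longleftrightarrow> v \<in> ?J \<or> (True, v) \<in> set ?ws" for v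
  proof -
    obtain t x where v: "v = (t, x)" by (rule prod.exhaust)
    show ?thesis unfolding v ws using addable_case_nat[OF M] A Ac by (cases t) auto
  qed
  ultimately show ?thesis unfolding mpword_def by blast
qed

lemma multicharge_Suc: "multicharge \<kappa> \<Longrightarrow> multicharge (\<kappa> \<circ> Suc)"
proof -
  have "{t. \<kappa> t = k} \<subseteq> insert 0 (Suc ` {t. (\<kappa> \<circ> Suc) t = k})" for k
  proof
    fix t assume "t \<in> {t. \<kappa> t = k}"
    then show "t \<in> insert 0 (Suc ` {t. (\<kappa> \<circ> Suc) t = k})" by (cases t) auto
  qed
  then have "infinite {t. \<kappa> t = k} \<Longrightarrow> infinite {t. (\<kappa> \<circ> Suc) t = k}" for k
    by (metis finite.insertI finite_imageI finite_subset)
  then show "multicharge \<kappa> \<Longrightarrow> multicharge (\<kappa> \<circ> Suc)" unfolding multicharge_def by blast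
qed

lemma add_box_case_nat: "add_box (0, b) (case_nat Y \<mu>) = case_nat (insert b Y) \<mu>"
  "add_box (apfst Suc u) (case_nat Y \<mu>) = case_nat Y (add_box u \<mu>)"
  by (cases u; simp add: case_nat_update)+

text \<open>This is the tensor product rule for crystals.\<close>

lemma mp_f_case_nat:
  assumes \<kappa>: "multicharge \<kappa>" and M: "case_nat Y \<mu> \<in> MP" and w: "mpword (\<kappa> \<circ> Suc) i \<mu> T xs"
    and c: "compword (\<kappa> 0) i Y ys" and redx: "reduce xs = (As, Rs)" and redy: "reduce ys = (A, R)"
  shows "length Rs < length A \<Longrightarrow> mp_f \<kappa> i (case_nat Y \<mu>) = case_nat (insert (last A) Y) \<mu>"
    "length A \<le> length Rs \<Longrightarrow> mp_f \<kappa> i (case_nat Y \<mu>) = case_nat Y (mp_f (\<kappa> \<circ> Suc) i \<mu>)"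
proof -
  \<comment> \<open>The extra letter \<open>x\<close> guarantees a surviving \<open>True\<close> in
    the upper components even if \<open>As\<close> is empty.\<close>
  obtain T' xs' x where w': "mpword (\<kappa> \<circ> Suc) i \<mu> T' xs'" and red': "reduce xs' = (x # As, Rs)"
    using mpword_extend[OF multicharge_Suc[OF \<kappa>] w] redx by (metis fst_conv snd_conv)
  let ?ws = "map (apsnd (apfst Suc)) xs' @ map (apsnd (Pair (0 :: nat))) ys"
  note W = mpword_case_nat[OF M w' c]
  have "reduce (map (apsnd (apfst Suc)) xs') = (map (apfst Suc) (x # As), map (apfst Suc) Rs)"
    "reduce (map (apsnd (Pair (0 :: nat))) ys) = (map (Pair 0) A, map (Pair 0) R)"
    unfolding reduce_map red' redy by simp_all
  from reduce_append[OF this] have red: "reduce ?ws = (map (apfst Suc) (x # As) @ drop (length Rs) (map (Pair 0) A),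
      take (length Rs - length A) (map (apfst Suc) Rs) @ map (Pair 0) R)" by simp
  have f: "mp_f \<kappa> i (case_nat Y \<mu>) = add_box (last (map (apfst Suc) (x # As) @ drop (length Rs) (map (Pair 0) A))) (case_nat Y \<mu>)"
    using mp_f_eq(1)[OF W red] by simp
  show "mp_f \<kappa> i (case_nat Y \<mu>) = case_nat (insert (last A) Y) \<mu>" if "length Rs < length A"
  proof -
    have "last (map (apfst Suc) (x # As) @ drop (length Rs) (map (Pair 0) A)) = (0, last A)"
      using that by (cases "A = []") (simp_all add: last_drop last_map)
    then show ?thesis using f add_box_case_nat by simp
  qed
  show "mp_f \<kappa> i (case_nat Y \<mu>) = case_nat Y (mp_f (\<kappa> \<circ> Suc) i \<mu>)" if "length A \<le> length Rs"
  proof -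
    have "last (map (apfst Suc) (x # As) @ drop (length Rs) (map (Pair 0) A)) = apfst Suc (last (x # As))"
      using that by (simp add: last_map)
    then show ?thesis using f add_box_case_nat mp_f_eq(1)[OF w' red'] by simp
  qed
qed


section \<open>Comparing signatures before and after splitting\<close>

lemma colword_block:
  assumes "\<And>c. lo \<le> c \<Longrightarrow> c < hi \<Longrightarrow> col_bot N c = r"
  shows "map (apsnd (col_bot N)) (colword i N lo hi) = replicate (hi - lo) (of_int r \<noteq> i, r)"
proof -
  have "map (apsnd (col_bot N)) (colword i N lo hi) = map (\<lambda>c. (of_int r \<noteq> i, r)) (rev [lo..<hi])"
    unfolding colword_def using assms by simp
  then show ?thesis by (simp add: map_replicate_const)
qed

text \<open>Signatures with letters labelled by rows instead of columns, \<open>n r\<close> being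
  the number of columns that end in row \<open>r\<close>. Unlike column numbers, these labels are
  unchanged when the part above the ray is left-justified.\<close>

definition blocks :: "bit \<Rightarrow> (int \<Rightarrow> nat) \<Rightarrow> int \<Rightarrow> int \<Rightarrow> (bool \<times> int) list" where
  "blocks i n a b = concat (map (\<lambda>r. replicate (n r) (of_int r \<noteq> i, r)) [a..b])"

lemma blocks_step: "a \<le> b + 1 \<Longrightarrow> blocks i n a (b + 1) = blocks i n a b @ replicate (n (b + 1)) (of_int (b + 1) \<noteq> i, b + 1)"
  by (simp add: blocks_def upto_rec2 del: of_int_add)

lemma blocks_empty: "b < a \<Longrightarrow> blocks i n a b = []"
  by (simp add: blocks_def)

lemma blocks_cong: "(\<And>r. a \<le> r \<Longrightarrow> r \<le> b \<Longrightarrow> n r = n' r) \<Longrightarrow> blocks i n a b = blocks i n' a b"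
  unfolding blocks_def by (intro arg_cong[of _ _ concat] map_cong) auto

text \<open>The columns ending in row \<open>r\<close> are those from \<open>N (r + 1)\<close> up to
  \<open>N r - 1\<close>, except that all remaining ones end in \<open>t\<close>; read from right to
  left they give the rows from the peak downwards. The last block may be cut short by
  \<open>lo\<close>, as happens in row \<open>ray_row\<close>.\<close>

lemma colword_blocks:
  assumes N: "unimodal N t" and "t \<le> z" and "N (z + 1) \<le> lo" "lo \<le> N z"
  shows "map (apsnd (col_bot N)) (colword i N lo (N t)) =
    blocks i (\<lambda>r. N r - N (r + 1)) t (z - 1) @ replicate (N z - lo) (of_int z \<noteq> i, z)"
  using assms(2,3,4)
proof (induction z arbitrary: lo rule: int_ge_induct)
  case base
  have "col_bot N c = t" if "lo \<le> c" "c < N t" for c using that base by (intro bot_eqI[OF N]) auto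
  from colword_block[of lo "N t" N t i, OF this] show ?case by (simp add: blocks_empty)
next
  case (step z)
  have "map (apsnd (col_bot N)) (colword i N (N (z + 1)) (N t)) =
      blocks i (\<lambda>r. N r - N (r + 1)) t (z - 1) @ replicate (N z - N (z + 1)) (of_int z \<noteq> i, z)"
    using step.IH[of "N (z + 1)"] N step.hyps by (simp add: unimodal_def)
  also have "\<dots> = blocks i (\<lambda>r. N r - N (r + 1)) t z"
    using blocks_step[of t "z - 1" i] step.hyps by simp
  finally have 1: "map (apsnd (col_bot N)) (colword i N (N (z + 1)) (N t)) = blocks i (\<lambda>r. N r - N (r + 1)) t z" .
  have "col_bot N c = z + 1" if "lo \<le> c" "c < N (z + 1)" for c
    using that step.prems step.hyps by (intro bot_eqI[OF N]) (auto simp: add.commute add.left_commute)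
  note 2 = colword_block[of lo "N (z + 1)" N "z + 1" i, OF this]
  have "colword i N lo (N t) = colword i N (N (z + 1)) (N t) @ colword i N lo (N (z + 1))"
    using colword_append[of lo "N (z + 1)" "N t"] step.prems unimodal_le[OF N] by simp
  then show ?case using 1 2 by simp
qed

lemma reduce_replicate: "reduce (replicate n (True, l)) = (replicate n l, [])" "reduce (replicate n (False, l)) = ([], replicate n l)"
  using reduce_sorted_word[of "replicate n l" "[]"] reduce_sorted_word[of "[]" "replicate n l"]
  by (simp_all add: map_replicate)

text \<open>The letters added to consecutive blocks cancel in pairs.\<close>

lemma reduce_blocks_Suc:
  assumes "t - 1 \<le> b" and "reduce (blocks i n t b) = (As, Rs)"
  shows "reduce (blocks i (\<lambda>r. Suc (n r)) t b) =
    ((if t \<le> b \<and> of_int t \<noteq> i then [t] else []) @ As, Rs @ (if t \<le> b \<and> of_int b = i then [b] else []))"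
  using assms
proof (induction b arbitrary: As Rs rule: int_ge_induct)
  case base
  then show ?case by (simp add: blocks_empty)
next
  case (step b)
  obtain P Q where PQ: "reduce (blocks i n t b) = (P, Q)" by fastforce
  note IH = step.IH[OF PQ]
  let ?x = "of_int (b + 1) \<noteq> i"
  let ?pre = "if t \<le> b \<and> of_int t \<noteq> i then [t] else []"
  let ?ex = "if t \<le> b \<and> of_int b = i then [b] else []"
  let ?n = "n (b + 1)"
  have t: "t \<le> b + 1" using step.hyps by simp
  have e1: "reduce (blocks i n t (b + 1)) = fold step (replicate ?n (?x, b + 1)) (P, Q)"
    unfolding blocks_step[OF t] using PQ by (simp add: reduce_def)
  have e2: "reduce (blocks i (\<lambda>r. Suc (n r)) t (b + 1)) = fold step (replicate (Suc ?n) (?x, b + 1)) (?pre @ P, Q @ ?ex)"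
    unfolding blocks_step[OF t] using IH by (simp add: reduce_def)
  show ?case
  proof (cases ?x)
    case True
    then have i: "of_int b = i" using of_int_bit_succ_eq_iff[of b i] by blast
    have AR: "As = P @ drop (length Q) (replicate ?n (b + 1))" "Rs = take (length Q - ?n) Q"
      using e1 step.prems fold_step[OF reduce_replicate(1), of ?n "b + 1" P Q] True by (simp_all del: of_int_add)
    show ?thesis
    proof (cases "t \<le> b")
      case tb: True
      have "fold step (replicate (Suc ?n) (True, b + 1)) (?pre @ P, Q @ [b]) =
          fold step (replicate ?n (True, b + 1)) (?pre @ P, Q)" by simp
      then show ?thesis
        using e2 True tb i AR fold_step[OF reduce_replicate(1), of ?n "b + 1" "?pre @ P" Q] t
        by (simp del: of_int_add)
    next
      case False
      then have bt: "b + 1 = t" using t by simp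
      have "blocks i n t b = []" using False by (simp add: blocks_empty)
      then have "P = []" "Q = []" using PQ by auto
      then show ?thesis
        using e2 True False AR fold_step[OF reduce_replicate(1), of "Suc ?n" "b + 1" "[]" "[]"] bt
        by (simp add: replicate_append_same[symmetric] del: of_int_add)
    qed
  next
    case False
    then have i: "of_int b \<noteq> i" using of_int_bit_succ_eq_iff[of b i] by blast
    have AR: "As = P" "Rs = Q @ replicate ?n (b + 1)"
      using e1 step.prems fold_step[OF reduce_replicate(2), of ?n "b + 1" P Q] False by (simp_all del: of_int_add)
    have "?pre = (if t \<le> b + 1 \<and> of_int t \<noteq> i then [t] else [])"
      using t False by (cases "t = b + 1") auto
    then show ?thesis
      using e2 False i AR fold_step[OF reduce_replicate(2), of "Suc ?n" "b + 1" "?pre @ P" Q] t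
      by (simp add: replicate_append_same del: of_int_add)
  qed
qed

section \<open>Words of the two parts of a split diagram\<close>

context splitting
begin

lemma U_ray_row: "U_rows m N ray_row = N ray_row - ray_width" "ray_row < r \<Longrightarrow> U_rows m N r = 0"
  using ray_row_props(1) ray_row_props(3)[of r] unfolding U_rows_def ray_width_def by auto

lemma U_diff: "t \<le> r \<Longrightarrow> r < ray_row \<Longrightarrow> U_rows m N r - U_rows m N (r + 1) = Suc (N r - N (r + 1))"
proof -
  assume r: "t \<le> r" "r < ray_row"
  have "N (r + 1) \<le> N r" using uni r unfolding unimodal_def by simp
  moreover have "r + 1 - m + 1 \<le> int (N (r + 1))" using diag_iff[of "r + 1"] r mt by simp
  ultimately show ?thesis using r mt unfolding U_rows_def by linarith
qed

text \<open>
  The word of the component cut off by the splitting, labelled by columns.  Each of its columns,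
  being strictly shorter than the previous one, contributes one letter; the extra letter is the
  addable box in the first empty column.
\<close>

definition lamword :: "bit \<Rightarrow> (bool \<times> nat) list" where
  "lamword i = (if of_int ray_row \<noteq> i then [(True, ray_width)] else []) @ colword i N 0 ray_width"

text \<open>The addable box in the first empty column lies in grid row \<open>m + ray_width\<close>,
  one below \<open>ray_row\<close>; so \<open>ray_row\<close> acts as the bottom of that
  column.\<close>

definition lamrow :: "nat \<Rightarrow> int" where
  "lamrow c = (if c = ray_width then ray_row else col_bot N c)"

lemma labels_lamword: "map snd (lamword i) = (if of_int ray_row \<noteq> i then [ray_width] else []) @ rev [0..<ray_width]"
  by (simp add: lamword_def labels_colword)

lemma distinct_lamword: "distinct (map snd (lamword i))"
  unfolding labels_lamword by simp

lemma ray_width_le_width: "ray_width \<le> N t"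
  using ray_width_le unimodal_le[OF uni, of ray_row] by simp

lemma map_lamrow: "map (apsnd lamrow) (lamword i) =
   (if of_int ray_row \<noteq> i then [(True, ray_row)] else []) @ map (apsnd (col_bot N)) (colword i N 0 ray_width)"
  by (simp add: lamword_def lamrow_def colword_def)

text \<open>All blocks but that of \<open>ray_row\<close> have one letter more in
  \<open>U_rows m N\<close> than in \<open>N\<close>. If row \<open>ray_row\<close> does not have
  colour \<open>i\<close>, the extra letter of the component completes the pattern; otherwise the
  lengthened blocks end, if there are any, with a block of letters \<open>True\<close>. Either way
  \<open>reduce_blocks_Suc\<close> leaves no \<open>False\<close> over, only possibly a
  \<open>True\<close> of row \<open>t\<close> in front.\<close>

lemma U_word_reduce:
  assumes "reduce (map (apsnd (col_bot N)) (colword i N ray_width (N t))) = (As, Rs)"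
  shows "reduce (map (apsnd (col_bot (U_rows m N))) (colword i (U_rows m N) 0 (U_rows m N t)) @
      (if of_int ray_row \<noteq> i then [(True, ray_row)] else [])) = ((if of_int t \<noteq> i \<and> (t < ray_row \<or> of_int ray_row \<noteq> i) then [t] else []) @ As, Rs)"
proof -
  let ?U = "U_rows m N"
  define n where "n r = (if r = ray_row then N ray_row - ray_width else N r - N (r + 1))" for r
  have N1: "map (apsnd (col_bot N)) (colword i N ray_width (N t)) = blocks i n t ray_row"
  proof -
    have "blocks i (\<lambda>r. N r - N (r + 1)) t (ray_row - 1) = blocks i n t (ray_row - 1)"
      by (rule blocks_cong) (simp add: n_def)
    then show ?thesis
      using colword_blocks[OF uni t_le_ray_row le_ray_width ray_width_le, of i] blocks_step[of t "ray_row - 1" i n] t_le_ray_row by (simp add: n_def)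
  qed
  have U1: "map (apsnd (col_bot ?U)) (colword i ?U 0 (?U t)) = blocks i (\<lambda>r. Suc (n r)) t (ray_row - 1) @ replicate (n ray_row) (of_int ray_row \<noteq> i, ray_row)"
  proof -
    have "blocks i (\<lambda>r. ?U r - ?U (r + 1)) t (ray_row - 1) = blocks i (\<lambda>r. Suc (n r)) t (ray_row - 1)"
      by (rule blocks_cong) (simp add: n_def U_diff)
    then show ?thesis
      using colword_blocks[OF lower_unimodal[OF lower_U] t_le_ray_row, of 0 i] U_ray_row by (simp add: n_def)
  qed
  show ?thesis
  proof (cases "of_int ray_row \<noteq> i")
    case True
    have "map (apsnd (col_bot ?U)) (colword i ?U 0 (?U t)) @ [(True, ray_row)] = blocks i (\<lambda>r. Suc (n r)) t ray_row"
      unfolding U1 using blocks_step[of t "ray_row - 1" i "\<lambda>r. Suc (n r)"] t_le_ray_row True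
      by (simp add: replicate_append_same)
    then show ?thesis
      using reduce_blocks_Suc[of t ray_row i n As Rs] assms N1 t_le_ray_row True by simp
  next
    case False
    obtain P Q where PQ: "reduce (blocks i n t (ray_row - 1)) = (P, Q)" by fastforce
    have "of_int (ray_row - 1) \<noteq> i" using False of_int_bit_pred_eq_iff[of ray_row i] by blast
    then have 1: "reduce (blocks i (\<lambda>r. Suc (n r)) t (ray_row - 1)) = ((if t \<le> ray_row - 1 \<and> of_int t \<noteq> i then [t] else []) @ P, Q)"
      using reduce_blocks_Suc[OF _ PQ] t_le_ray_row by (simp del: of_int_diff)
    have 2: "blocks i n t ray_row = blocks i n t (ray_row - 1) @ replicate (n ray_row) (of_int ray_row \<noteq> i, ray_row)"
      using blocks_step[of t "ray_row - 1" i n] t_le_ray_row by simp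
    obtain A R where AR: "reduce (replicate (n ray_row) (of_int ray_row \<noteq> i, ray_row)) = (A, R)" by fastforce
    show ?thesis using reduce_append[OF PQ AR] reduce_append[OF 1 AR] assms N1 2 U1 False by auto
  qed
qed

text \<open>Both words end with the columns of \<open>N\<close> before \<open>ray_width\<close>, and
  \<open>U_word_reduce\<close> compares what precedes them. The list \<open>p\<close> holds the
  surplus letter of the peak row; it is harmless by \<open>f_row_last\<close>.\<close>

lemma signature_split:
  assumes N': "reduce (colword i N 0 (N t)) = (As, Rs)"
    and U': "reduce (colword i (U_rows m N) 0 (U_rows m N t)) = (As', Rs')"
    and L': "reduce (lamword i) = (A, R)"
  shows "\<exists>p. (p = [] \<or> p = [t] \<and> of_int t \<noteq> i) \<and>
      p @ map (col_bot N) As = map (col_bot (U_rows m N)) As' @ drop (length Rs') (map lamrow A)"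
    "map (col_bot N) Rs = take (length Rs' - length A) (map (col_bot (U_rows m N)) Rs') @ map lamrow R"
proof -
  let ?U = "U_rows m N"
  let ?u = "map (apsnd (col_bot N)) (colword i N ray_width (N t))"
  let ?v = "map (apsnd (col_bot N)) (colword i N 0 ray_width)"
  let ?Uw = "map (apsnd (col_bot ?U)) (colword i ?U 0 (?U t))"
  let ?ext = "if of_int ray_row \<noteq> i then [(True, ray_row)] else []"
  let ?p = "if of_int t \<noteq> i \<and> (t < ray_row \<or> of_int ray_row \<noteq> i) then [t] else []"
  obtain Au Ru where u: "reduce ?u = (Au, Ru)" by fastforce
  obtain Av Rv where v: "reduce ?v = (Av, Rv)" by fastforce
  have "colword i N 0 (N t) = colword i N ray_width (N t) @ colword i N 0 ray_width"
    using colword_append[of 0 ray_width "N t" i N] ray_width_le_width by simp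
  then have "reduce (?u @ ?v) = (map (col_bot N) As, map (col_bot N) Rs)"
    using reduce_map[of "col_bot N" "colword i N 0 (N t)"] N' by simp
  then have 1: "map (col_bot N) As = Au @ drop (length Ru) Av" "map (col_bot N) Rs = take (length Ru - length Av) Ru @ Rv"
    using reduce_append[OF u v] by auto
  have "reduce ((?Uw @ ?ext) @ ?v) = (?p @ Au @ drop (length Ru) Av, take (length Ru - length Av) Ru @ Rv)"
    using reduce_append[OF U_word_reduce[OF u] v] by simp
  moreover have "(?Uw @ ?ext) @ ?v = ?Uw @ map (apsnd lamrow) (lamword i)" unfolding map_lamrow by simp
  moreover have "reduce (?Uw @ map (apsnd lamrow) (lamword i)) =
     (map (col_bot ?U) As' @ drop (length Rs') (map lamrow A), take (length Rs' - length A) (map (col_bot ?U) Rs') @ map lamrow R)"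
    using reduce_append[of ?Uw "map (col_bot ?U) As'" "map (col_bot ?U) Rs'" "map (apsnd lamrow) (lamword i)" "map lamrow A" "map lamrow R"]
    unfolding reduce_map U' L' by simp
  ultimately have 2: "?p @ map (col_bot N) As = map (col_bot ?U) As' @ drop (length Rs') (map lamrow A)"
    "map (col_bot N) Rs = take (length Rs' - length A) (map (col_bot ?U) Rs') @ map lamrow R"
    using 1 by auto
  have "?p = [] \<or> ?p = [t] \<and> of_int t \<noteq> i" by simp
  with 2 show "\<exists>p. (p = [] \<or> p = [t] \<and> of_int t \<noteq> i) \<and>
      p @ map (col_bot N) As = map (col_bot ?U) As' @ drop (length Rs') (map lamrow A)"
    "map (col_bot N) Rs = take (length Rs' - length A) (map (col_bot ?U) Rs') @ map lamrow R" by blast+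
qed

text \<open>If no letter of \<open>N\<close> survives and row \<open>t\<close> does not have colour
  \<open>i\<close>, the peak rule adds the box in row \<open>t + 1\<close>, just as a surviving
  letter of row \<open>t\<close> would.\<close>

lemma f_row_last:
  assumes N': "reduce (colword i N 0 (N t)) = (As, Rs)"
    and p: "p = [] \<or> p = [t] \<and> of_int t \<noteq> i" and ne: "p @ map (col_bot N) As \<noteq> []"
  shows "f_row i N t = last (p @ map (col_bot N) As) + 1"
  using p ne by (cases "As = []") (auto simp: f_row_def N' last_map)

lemma bot_ge_ray_row: "c < ray_width \<Longrightarrow> ray_row \<le> col_bot N c" "c < ray_width \<Longrightarrow> c < N t"
proof -
  assume c: "c < ray_width"
  then show ct: "c < N t" using ray_width_le_width by simp
  show "ray_row \<le> col_bot N c" using column_iff(3)[OF uni ct, of ray_row] c ray_width_le by simp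
qed

text \<open>The box of the partition that belongs to a letter: the bottom of the column if it has
  colour \<open>i\<close>, else the place below it. Subtracting \<open>m\<close> and
  \<open>c\<close> passes from grid rows to rows of the top-aligned component.\<close>

definition lambox :: "bit \<Rightarrow> nat \<Rightarrow> nat \<times> nat" where
  "lambox i c = (nat ((if of_int (lamrow c) = i then lamrow c else lamrow c + 1) - m - int c), c)"

lemma set_lamword: "(b, c) \<in> set (lamword i) \<longleftrightarrow>
    (c = ray_width \<and> b \<and> of_int ray_row \<noteq> i) \<or> (c < ray_width \<and> b = (of_int (col_bot N c) \<noteq> i))"
  by (auto simp: lamword_def set_colword)

text \<open>The extra letter counts as the right end of the block of \<open>ray_row\<close>: if the
  column to its left ends there, the two equal letters are adjacent. So the last survivor is at the
  left end of its block, as for diagrams.\<close>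

lemma last_lamword:
  assumes L': "reduce (lamword i) = (A, R)" and ne: "A \<noteq> []"
  shows "N (lamrow (last A) + 1) = last A" "m + int (last A) \<le> lamrow (last A) + 1" "of_int (lamrow (last A)) \<noteq> i"
proof -
  let ?c = "last A"
  have "(True, ?c) \<in> set (lamword i)" using reduce_labels(1)[OF L'] ne by auto
  then have c: "?c = ray_width \<and> of_int ray_row \<noteq> i \<or> ?c < ray_width \<and> of_int (col_bot N ?c) \<noteq> i" unfolding set_lamword by auto
  then show "of_int (lamrow ?c) \<noteq> i" by (auto simp: lamrow_def)
  show "m + int ?c \<le> lamrow ?c + 1" using c bot_ge_ray_row(1)[of ?c] int_ray_width by (auto simp: lamrow_def)
  show "N (lamrow ?c + 1) = ?c"
  proof (cases "?c = ray_width")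
    case True
    then have i: "of_int ray_row \<noteq> i" using c by auto
    show ?thesis
    proof (rule ccontr)
      assume "N (lamrow ?c + 1) \<noteq> ?c"
      then have "N (ray_row + 1) < ray_width" using le_ray_width True by (simp add: lamrow_def)
      then obtain s' where s': "ray_width = Suc s'" "N (ray_row + 1) \<le> s'" by (cases ray_width) auto
      have "col_bot N s' = ray_row" using s' ray_width_le t_le_ray_row by (intro bot_eqI[OF uni]) auto
      then have e: "lamword i = [] @ [(True, ray_width), (True, s')] @ colword i N 0 s'"
        using colword_split[of 0 s' ray_width i N] s'(1) i by (simp add: lamword_def colword_empty)
      show False using last_unarced_followed[OF L'[unfolded e] distinct_lamword[of i, unfolded e] ne] True by simp
    qed
  next
    case False
    then have cs: "?c < ray_width" "of_int (col_bot N ?c) \<noteq> i" using c by auto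
    show ?thesis
      using leftmost_if_last_unarced[OF uni L'[unfolded lamword_def] ne distinct_lamword[of i, unfolded lamword_def] ray_width_le_width cs] False
      by (simp add: lamrow_def)
  qed
qed

text \<open>By \<open>signature_split\<close> the last survivor of the whole word comes from the
  component. The new box therefore lies weakly below the ray and leaves the upper part
  alone.\<close>

lemma f_step_lambda:
  assumes N': "reduce (colword i N 0 (N t)) = (As, Rs)"
    and U': "reduce (colword i (U_rows m N) 0 (U_rows m N t)) = (As', Rs')"
    and L': "reduce (lamword i) = (A, R)" and lt: "length Rs' < length A"
  shows "U_rows m (inc (f_row i N t) N) = U_rows m N"
    "strip m (inc (f_row i N t) N) = insert (lambox i (last A)) (strip m N)"
proof -
  have ne: "A \<noteq> []" using lt by auto
  obtain p where p: "p = [] \<or> p = [t] \<and> of_int t \<noteq> i"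
    and e: "p @ map (col_bot N) As = map (col_bot (U_rows m N)) As' @ drop (length Rs') (map lamrow A)"
    using signature_split(1)[OF N' U' L'] by blast
  let ?c = "last A" and ?\<rho> = "f_row i N t"
  have "drop (length Rs') (map lamrow A) \<noteq> []" using lt by simp
  then have "last (p @ map (col_bot N) As) = lamrow ?c" unfolding e using ne lt by (simp add: last_drop last_map)
  moreover have "p @ map (col_bot N) As \<noteq> []" unfolding e using lt by simp
  ultimately have \<rho>: "?\<rho> = lamrow ?c + 1" using f_row_last[OF N' p] by simp
  note l = last_lamword[OF L' ne]
  have N\<rho>: "N ?\<rho> = ?c" and m\<rho>: "m + int ?c \<le> ?\<rho>" using l \<rho> by simp_all
  show "U_rows m (inc ?\<rho> N) = U_rows m N"
    unfolding U_rows_def inc_def using N\<rho> m\<rho> by (auto simp: fun_eq_iff)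
  have box: "lambox i ?c = (nat (?\<rho> - m - int ?c), ?c)" unfolding lambox_def \<rho> using l(3) by simp
  have "c < inc ?\<rho> N (m + int r + int c) \<longleftrightarrow> c < N (m + int r + int c) \<or> (r, c) = lambox i ?c" for r c
  proof -
    have "c < inc ?\<rho> N (m + int r + int c) \<longleftrightarrow> c < N (m + int r + int c) \<or> (m + int r + int c = ?\<rho> \<and> c = ?c)"
      unfolding inc_def using N\<rho> by auto
    also have "(m + int r + int c = ?\<rho> \<and> c = ?c) \<longleftrightarrow> (r, c) = lambox i ?c"
      unfolding box using m\<rho> by auto
    finally show ?thesis .
  qed
  then show "strip m (inc ?\<rho> N) = insert (lambox i ?c) (strip m N)" unfolding strip_def by auto
qed

text \<open>All letters \<open>True\<close> of the component cancel against the upper part, so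
  \<open>N\<close> and \<open>U_rows m N\<close> receive their boxes in the same row. It remains to
  see that the new box lies strictly above the ray.\<close>

lemma f_step_rest:
  assumes N': "reduce (colword i N 0 (N t)) = (As, Rs)"
    and U': "reduce (colword i (U_rows m N) 0 (U_rows m N t)) = (As', Rs')"
    and L': "reduce (lamword i) = (A, R)" and le: "length A \<le> length Rs'"
  shows "U_rows m (inc (f_row i N t) N) = inc (f_row i (U_rows m N) t) (U_rows m N)"
    "strip m (inc (f_row i N t) N) = strip m N"
proof -
  let ?U = "U_rows m N"
  note uU = lower_unimodal[OF lower_U]
  obtain p where p: "p = [] \<or> p = [t] \<and> of_int t \<noteq> i"
    and e: "p @ map (col_bot N) As = map (col_bot ?U) As'"
    using signature_split(1)[OF N' U' L'] le by auto
  let ?\<rho> = "f_row i N t"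
  have eq: "f_row i ?U t = ?\<rho>"
  proof (cases "As' = []")
    case True
    then show ?thesis using e U' N' by (simp add: f_row_def)
  next
    case False
    then have "?\<rho> = col_bot ?U (last As') + 1" using f_row_last[OF N' p] e by (simp add: last_map)
    then show ?thesis using f_row_unarced(2)[OF uU U' False] by simp
  qed
  \<comment> \<open>The addable box in the first empty column is the first letter of
    \<open>lamword\<close>, where nothing can cancel it.\<close>
  have A: "A \<noteq> []" if "of_int ray_row \<noteq> i"
  proof -
    obtain A' R' where r: "reduce (colword i N 0 ray_width) = (A', R')" by fastforce
    show ?thesis using reduce_cons_True[OF r, of ray_width] L' that by (auto simp: lamword_def)
  qed
  \<comment> \<open>A box below \<open>ray_row\<close> would lie in a row that is empty in the upper
    part. That is only possible if no \<open>False\<close> survives there and row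
    \<open>ray_row\<close> has the other colour, but then \<open>A\<close> would be longer than
    \<open>Rs'\<close>.\<close>
  have "?\<rho> \<le> ray_row"
  proof (rule ccontr)
    assume gt: "\<not> ?\<rho> \<le> ray_row"
    have "Rs' = [] \<and> of_int ray_row \<noteq> i"
    proof (cases "As' = []")
      case True
      then have "?\<rho> = (if of_int t = i then t else t + 1)" "?U ?\<rho> = ?U t"
        using f_row_no_unarced[OF uU, of i] U' eq by simp_all
      note \<rho> = this
      have i: "of_int t \<noteq> i" "?\<rho> = t + 1" using \<rho>(1) gt t_le_ray_row by (auto split: if_splits)
      then have tz: "t = ray_row" using gt t_le_ray_row by simp
      have "?U t = 0" using \<rho>(2) gt U_ray_row(2)[of ?\<rho>] by simp
      with i(1) tz have "of_int ray_row \<noteq> i" "?U t = 0" by simp_all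
      then show ?thesis using U' by (simp add: colword_empty)
    next
      case False
      let ?c = "last As'"
      note fr = f_row_unarced[OF uU U' False]
      have "ray_row \<le> col_bot ?U ?c" using fr(2) eq gt by simp
      moreover have "0 < ?U (col_bot ?U ?c)" using bot_in[OF uU fr(1)] by simp
      ultimately have bz: "col_bot ?U ?c = ray_row" using U_ray_row(2)[of "col_bot ?U ?c"] by (cases "ray_row < col_bot ?U ?c") auto
      then have c0: "?c = 0" using fr(3) U_ray_row(2)[of "ray_row + 1"] by simp
      obtain P Q where PQ: "reduce (colword i ?U 1 (?U t)) = (P, Q)" by fastforce
      have "colword i ?U 0 (?U t) = colword i ?U 1 (?U t) @ [(True, 0)]"
        using colword_split[of 0 0 "?U t" i ?U] fr(1,4) c0 by (simp add: colword_empty)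
      then have st: "step (True, 0) (P, Q) = (As', Rs')" using U' PQ by (simp add: reduce_snoc)
      have "0 \<notin> set P" using reduce_label_set(1)[OF PQ] by (auto simp: colword_def)
      moreover have "0 \<in> set As'" using last_in_set[OF False] c0 by simp
      ultimately have "Q = []" using st by (auto split: if_splits)
      then show ?thesis using st fr(4) bz by auto
    qed
    then show False using A le by simp
  qed
  moreover have "t \<le> ?\<rho>" using f_row_ge[OF uni] .
  ultimately have N\<rho>: "?\<rho> - m + 1 \<le> int (N ?\<rho>)" using diag_iff[of ?\<rho>] mt by simp
  show "U_rows m (inc ?\<rho> N) = inc (f_row i ?U t) ?U"
    unfolding eq unfolding U_rows_def inc_def using N\<rho> by (auto simp: fun_eq_iff)
  have "c < inc ?\<rho> N (m + int r + int c) \<longleftrightarrow> c < N (m + int r + int c)" for r c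
    unfolding inc_def using N\<rho> by auto
  then show "strip m (inc ?\<rho> N) = strip m N" unfolding strip_def by simp
qed

text \<open>No box is ever added above row \<open>t\<close>, so the ray keeps its starting row
  \<open>m\<close>.\<close>

lemma splitting_inc: "\<exists>t'. splitting (inc (f_row i N t) N) t' m"
proof -
  let ?\<rho> = "f_row i N t"
  obtain t' where t': "t' = t \<or> t' = t + 1" "upper (inc ?\<rho> N) t'" "?\<rho> = t \<longrightarrow> t' = t"
    using upper_inc[OF N, of i] by blast
  note ge = f_row_ge[OF uni, of i]
  have "splitting (inc ?\<rho> N) t' m"
  proof
    show "upper (inc ?\<rho> N) t'" by fact
    show "inc ?\<rho> N r = 0" if "r < m - 1" for r using zero[OF that] that ge mt by (simp add: inc_def)
    show "m - 1 \<le> t'" using t' mt by auto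
    assume 0: "inc ?\<rho> N m = 0"
    then have Nm0: "N m = 0" "?\<rho> \<noteq> m" by (auto simp: inc_def split: if_splits)
    then have t: "t = m - 1" using Nm by simp
    have "N (?\<rho> - 1) = 0" if "m < ?\<rho>"
      using unimodal_down[OF uni, of m "?\<rho> - 1"] that Nm0 t by simp
    then have "?\<rho> = t" using f_row_cases[OF uni, of i] Nm0 t by auto
    then show "t' = m - 1" using t'(3) t by simp
  qed
  then show ?thesis ..
qed

section \<open>Addable and removable boxes of the component cut off\<close>

lemma young_strip: "young (strip m N)"
proof -
  have "(\<lambda>(r, c). (m + int r + int c, c)) ` strip m N \<subseteq> cells_of N"
    by (auto simp: strip_def cells_of_def)
  moreover have "inj_on (\<lambda>(r, c). (m + int r + int c, c)) (strip m N)" by (auto simp: inj_on_def)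
  ultimately have "finite (strip m N)" using finite_cells_of[OF fin] finite_subset finite_imageD by blast
  moreover have "(r', c') \<in> strip m N" if "(r, c) \<in> strip m N" "r' \<le> r" "c' \<le> c" for r c r' c'
    using that strip_down[of c' "m + int r + int c" "m + int r' + int c'"] by (simp add: strip_def)
  ultimately show ?thesis unfolding young_def by blast
qed

text \<open>The right and the lower neighbour of box \<open>(r, c)\<close> of the strip lie in the
  same grid row \<open>m + r + c + 1\<close>, so both are missing as soon as that row has length at
  most \<open>c\<close>. Removable boxes are thus bottoms of columns.\<close>

lemma strip_bot_iff: "c < N (m + int r + int c) \<and> N (m + int r + int c + 1) \<le> c \<longleftrightarrow>
   c < ray_width \<and> col_bot N c = m + int r + int c"
proof
  let ?\<rho> = "m + int r + int c"
  assume *: "c < N ?\<rho> \<and> N (?\<rho> + 1) \<le> c"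
  have "t \<le> ?\<rho>"
  proof (rule ccontr)
    assume "\<not> t \<le> ?\<rho>"
    then have "N ?\<rho> = 0 \<or> N ?\<rho> < N (?\<rho> + 1)" using N unfolding upper_def by simp
    then show False using * by linarith
  qed
  then have b: "col_bot N c = ?\<rho>" using * by (intro bot_eqI[OF uni]) auto
  have "c < N (m + int c)" using strip_down[of c ?\<rho> "m + int c"] * by simp
  then have "m + int c \<le> ray_row" using diag_iff[of "m + int c"] by simp
  then show "c < ray_width \<and> col_bot N c = ?\<rho>" using b int_ray_width by simp
next
  assume *: "c < ray_width \<and> col_bot N c = m + int r + int c"
  then show "c < N (m + int r + int c) \<and> N (m + int r + int c + 1) \<le> c"
    using bot_in[OF uni, of c] bot_succ[OF uni, of c] bot_ge_ray_row(2)[of c] by simp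
qed

text \<open>Now the left and the upper neighbour share the grid row \<open>m + r + c - 1\<close>.
  For \<open>r = 0\<close> only the left one is required, and this yields the additional box in
  column \<open>ray_width\<close>.\<close>

lemma strip_addable_iff:
  "N (m + int r + int c) \<le> c \<and> (r = 0 \<or> c < N (m + int r + int c - 1)) \<and> (c = 0 \<or> c - 1 < N (m + int r + int c - 1))
    \<longleftrightarrow> r = 0 \<and> c = ray_width \<or> c < ray_width \<and> col_bot N c + 1 = m + int r + int c"
proof (cases r)
  case (Suc r')
  have "c = 0 \<or> c - 1 < N (m + int r + int c - 1)" if "c < N (m + int r + int c - 1)" using that by auto
  then show ?thesis using strip_bot_iff[of c r'] Suc by (auto simp: add.commute add.left_commute)
next
  case 0
  have "N (m + int c) \<le> c \<longleftrightarrow> ray_width \<le> c" using diag_iff[of "m + int c"] int_ray_width by auto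
  moreover have "c - 1 < N (m + int c - 1) \<longleftrightarrow> c \<le> ray_width" if "c \<noteq> 0"
    using that diag_iff[of "m + int c - 1"] int_ray_width by auto
  moreover have "col_bot N c + 1 \<noteq> m + int c" if "c < ray_width" using bot_ge_ray_row(1)[OF that] that int_ray_width by simp
  ultimately show ?thesis using 0 by auto
qed

lemma lambox_eq_iff:
  assumes "c < ray_width \<or> c = ray_width \<and> of_int ray_row \<noteq> i"
  shows "(r, c') = lambox i c \<longleftrightarrow> c' = c \<and>
    (if of_int (lamrow c) = i then lamrow c else lamrow c + 1) = m + int r + int c"
proof -
  have "m + int c \<le> (if of_int (lamrow c) = i then lamrow c else lamrow c + 1)"
    using assms bot_ge_ray_row(1)[of c] int_ray_width by (auto simp: lamrow_def)
  then show ?thesis unfolding lambox_def by auto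
qed

lemma compword_lamword:
  assumes k: "of_int m = k"
  shows "compword k i (strip m N) (map (apsnd (lambox i)) (lamword i))"
proof -
  have res: "residue (\<lambda>_. k) (0, r, c) = of_int (m + int r + int c)" for r c
    unfolding residue_eq k[symmetric] by (simp only: of_int_add add.assoc)
  have mem: "(b, r, c) \<in> set (map (apsnd (lambox i)) (lamword i)) \<longleftrightarrow> (b, c) \<in> set (lamword i) \<and> (r, c) = lambox i c" for b r c
    by (force simp: lambox_def)
  have strip: "(r, c) \<in> strip m N \<longleftrightarrow> c < N (m + int r + int c)" for r c by (simp add: strip_def)
  have F: "(False, r, c) \<in> set (map (apsnd (lambox i)) (lamword i)) \<longleftrightarrow>
      (r, c) \<in> strip m N \<and> residue (\<lambda>_. k) (0, r, c) = i \<and> young (strip m N - {(r, c)})" for r c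
  proof -
    have "(r, c) \<in> strip m N \<and> young (strip m N - {(r, c)}) \<longleftrightarrow> (r, c) \<in> strip m N \<and> (Suc r, c) \<notin> strip m N \<and> (r, Suc c) \<notin> strip m N"
      using young_remove[OF young_strip] by blast
    also have "\<dots> \<longleftrightarrow> c < N (m + int r + int c) \<and> N (m + int r + int c + 1) \<le> c"
      unfolding strip by (auto simp: algebra_simps)
    also have "\<dots> \<longleftrightarrow> c < ray_width \<and> col_bot N c = m + int r + int c" by (rule strip_bot_iff)
    finally have *: "(r, c) \<in> strip m N \<and> young (strip m N - {(r, c)}) \<longleftrightarrow> c < ray_width \<and> col_bot N c = m + int r + int c" .
    show ?thesis
    proof (cases "c < ray_width")
      case True
      then show ?thesis using * unfolding mem set_lamword res
        using lambox_eq_iff[of c i r c] by (auto simp: lamrow_def)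
    next
      case False
      then show ?thesis using * unfolding mem set_lamword by auto
    qed
  qed
  have T: "(True, r, c) \<in> set (map (apsnd (lambox i)) (lamword i)) \<longleftrightarrow>
      (r, c) \<notin> strip m N \<and> residue (\<lambda>_. k) (0, r, c) = i \<and> young (insert (r, c) (strip m N))" for r c
  proof -
    have "(r, c) \<notin> strip m N \<and> young (insert (r, c) (strip m N)) \<longleftrightarrow> (r, c) \<notin> strip m N \<and>
        (r = 0 \<or> (r - 1, c) \<in> strip m N) \<and> (c = 0 \<or> (r, c - 1) \<in> strip m N)"
      using young_insert[OF young_strip] by blast
    also have "\<dots> \<longleftrightarrow> N (m + int r + int c) \<le> c \<and> (r = 0 \<or> c < N (m + int r + int c - 1)) \<and> (c = 0 \<or> c - 1 < N (m + int r + int c - 1))"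
      unfolding strip by (cases r; cases c) (auto simp: algebra_simps)
    also have "\<dots> \<longleftrightarrow> r = 0 \<and> c = ray_width \<or> c < ray_width \<and> col_bot N c + 1 = m + int r + int c" by (rule strip_addable_iff)
    finally have *: "(r, c) \<notin> strip m N \<and> young (insert (r, c) (strip m N)) \<longleftrightarrow>
       r = 0 \<and> c = ray_width \<or> c < ray_width \<and> col_bot N c + 1 = m + int r + int c" .
    consider "c < ray_width" | "c = ray_width" | "ray_width < c" by linarith
    then show ?thesis
    proof cases
      case 1
      have "of_int (m + int r + int c) = i \<longleftrightarrow> of_int (col_bot N c) \<noteq> i" if "col_bot N c + 1 = m + int r + int c"
        using of_int_bit_succ_eq_iff[of "col_bot N c" i] unfolding that .
      then show ?thesis using * 1 unfolding mem set_lamword res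
        using lambox_eq_iff[of c i r c] by (auto simp: lamrow_def simp del: of_int_add)
    next
      case 2
      have zs: "ray_row + 1 = m + int ray_width" using int_ray_width by simp
      have "of_int (m + int ray_width) = i \<longleftrightarrow> of_int ray_row \<noteq> i" using of_int_bit_succ_eq_iff[of ray_row i] unfolding zs .
      then show ?thesis using * 2 zs unfolding mem set_lamword res
        using lambox_eq_iff[of c i r c] by (auto simp: lamrow_def simp del: of_int_add)
    next
      case 3
      then show ?thesis using * unfolding mem set_lamword by auto
    qed
  qed
  \<comment> \<open>Bottoms move weakly up from left to right, and top-aligning lifts column
    \<open>c\<close> by \<open>c\<close> more, so the rows of the boxes become strictly
    ordered.\<close>
  have sorted: "sorted_wrt (\<lambda>b b'. fst b < fst b') (map snd (map (apsnd (lambox i)) (lamword i)))"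
  proof -
    have srt: "sorted_wrt (\<lambda>c' c. c < c') (map snd (lamword i))"
      unfolding labels_lamword by (auto simp: sorted_wrt_rev sorted_wrt_append)
    have "fst (lambox i c') < fst (lambox i c)"
      if c: "c < c'" and mem: "c' \<in> set (map snd (lamword i))" for c c'
    proof -
      have c': "c' < ray_width \<or> c' = ray_width \<and> of_int ray_row \<noteq> i" using mem unfolding labels_lamword by (auto split: if_splits)
      then have cs: "c < ray_width" using c by auto
      let ?g = "\<lambda>c. if of_int (lamrow c) = i then lamrow c else lamrow c + 1"
      have rc: "lamrow c = col_bot N c" using cs by (simp add: lamrow_def)
      have ge: "lamrow c' \<le> lamrow c"
        using c' c bot_antimono[OF uni, of c c'] bot_ge_ray_row[of c] bot_ge_ray_row(2)[of c'] cs by (auto simp: lamrow_def)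
      then have g: "?g c' \<le> ?g c" by (cases "lamrow c' = lamrow c") auto
      have "m + int c' \<le> ?g c'"
        using c' bot_ge_ray_row(1)[of c'] int_ray_width by (auto simp: lamrow_def)
      then have "nat (?g c' - m - int c') < nat (?g c - m - int c)" using g c by linarith
      then show ?thesis unfolding lambox_def by simp
    qed
    then have "sorted_wrt (\<lambda>c' c. fst (lambox i c') < fst (lambox i c)) (map snd (lamword i))"
      by (rule sorted_wrt_mono_rel[OF _ srt])
    then show ?thesis by (simp add: sorted_wrt_map)
  qed
  show ?thesis
    unfolding compword_def
  proof (intro conjI sorted)
    show "{b. (False, b) \<in> set (map (apsnd (lambox i)) (lamword i))} =
        {b \<in> strip m N. residue (\<lambda>_. k) (0, b) = i \<and> young (strip m N - {b})}" (is "?l = ?r")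
    proof (rule set_eqI)
      show "x \<in> ?l \<longleftrightarrow> x \<in> ?r" for x using F[of "fst x" "snd x"] unfolding mem_Collect_eq prod.collapse .
    qed
    show "{b. (True, b) \<in> set (map (apsnd (lambox i)) (lamword i))} =
        {b. b \<notin> strip m N \<and> residue (\<lambda>_. k) (0, b) = i \<and> young (insert b (strip m N))}" (is "?l = ?r")
    proof (rule set_eqI)
      show "x \<in> ?l \<longleftrightarrow> x \<in> ?r" for x using T[of "fst x" "snd x"] unfolding mem_Collect_eq prod.collapse .
    qed
  qed
qed

end


section \<open>Floating commutes with raising\<close>

lemma less_inc: "c < inc \<rho> N r \<longleftrightarrow> c < N r \<or> r = \<rho> \<and> c = N \<rho>"
  by (auto simp: inc_def)

text \<open>Equal signatures select the same column. If the box starts a new column, the shift of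
  that column is still free and is set to the difference of the two rows, which is even as both have
  colour \<open>i\<close>.\<close>

lemma col_sim_inc:
  assumes N: "unimodal N t" and M: "unimodal M t'" and sim: "col_sim N M"
  shows "col_sim (inc (f_row i N t) N) (inc (f_row i M t') M)"
proof -
  obtain s where s: "sim_by s N M" using sim unfolding col_sim_def by blast
  have ev: "even (s c)" and e: "c < N r \<longleftrightarrow> c < M (r + s c)" for r c using s unfolding sim_by_def by blast+
  note w = sim_width[OF N M s]
  have cw: "colword i M 0 (M t') = colword i N 0 (N t)" using colword_sim[OF N M sim] w by simp
  obtain As Rs where red: "reduce (colword i N 0 (N t)) = (As, Rs)" by fastforce
  show ?thesis
  proof (cases "As = []")
    case True
    let ?\<rho> = "f_row i N t" and ?\<sigma> = "f_row i M t'"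
    have \<rho>: "N ?\<rho> = N t" using f_row_no_unarced(2)[OF N] red True by simp
    have \<sigma>: "M ?\<sigma> = N t" using f_row_no_unarced(2)[OF M] red True cw w by simp
    have "of_int ?\<rho> = (of_int ?\<sigma> :: bit)" using f_row_colour[OF N, of i] f_row_colour[OF M, of i] by simp
    then have "even (?\<sigma> - ?\<rho>)" unfolding of_int_bit_eq_iff by simp
    moreover have "c < inc ?\<rho> N r \<longleftrightarrow> c < inc ?\<sigma> M (r + (s(N t := ?\<sigma> - ?\<rho>)) c)" for c r
    proof (cases "c = N t")
      case True
      have "\<not> N t < N r" "\<not> N t < M x" for x using unimodal_le[OF N, of r] unimodal_le[OF M, of x] w by auto
      then show ?thesis unfolding less_inc using True \<rho> \<sigma> by auto
    next
      case False
      then show ?thesis unfolding less_inc using \<rho> \<sigma> e by auto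
    qed
    ultimately have "sim_by (s(N t := ?\<sigma> - ?\<rho>)) (inc ?\<rho> N) (inc ?\<sigma> M)" unfolding sim_by_def using ev by simp
    then show ?thesis unfolding col_sim_def by blast
  next
    case False
    have redM: "reduce (colword i M 0 (M t')) = (As, Rs)" using red cw by simp
    note fN = f_row_unarced[OF N red False]
    note fM = f_row_unarced[OF M redM False]
    have "col_bot M (last As) = col_bot N (last As) + s (last As)" using sim_bot[OF N M s fN(1)] .
    then have "sim_by s (inc (f_row i N t) N) (inc (f_row i M t') M)"
      unfolding sim_by_def less_inc using ev e fN(2,3) fM(2,3) by auto
    then show ?thesis unfolding col_sim_def by blast
  qed
qed

text \<open>The right-hand side is an upper ledge diagram obtained from the enlarged
  \<open>U\<close> by even column shifts, and there is only one.\<close>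

lemma ul_f_float:
  assumes U: "lower U t" and U': "unimodal (inc (f_row i U t) U) t'"
  shows "float_diag (rows_diagram (inc (f_row i U t) U)) = ul_f i (float_diag (rows_diagram U))"
proof (rule float_diag_eq[OF U'])
  let ?E = "float_diag (rows_diagram U)"
  note E = float_diag_unimodal[OF lower_unimodal[OF U]]
  show E': "ul_f i ?E \<in> UL" by (rule ul_f_closed[OF E(1)])
  obtain tE where tE: "upper (row_lengths ?E) tE" by (rule UL_upper[OF E(1)])
  obtain t2 where t2: "upper (inc (f_row i (row_lengths ?E) tE) (row_lengths ?E)) t2" using upper_inc[OF tE, of i] by blast
  obtain d where "even d" "row_lengths (ul_f i ?E) = shift_rows d (inc (f_row i (row_lengths ?E) tE) (row_lengths ?E))"
    using row_lengths_rows_diagram[OF upper_unimodal[OF t2]] ul_f_eq_normalized[OF E(1) tE, of i] by auto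
  then show "col_sim (inc (f_row i U t) U) (row_lengths (ul_f i ?E))"
    using col_sim_trans[OF col_sim_inc[OF lower_unimodal[OF U] upper_unimodal[OF tE] E(2), of i] col_sim_shift] by simp
qed

section \<open>Gluing inverts splitting\<close>

context splitting
begin

lemma splitting_shift: "splitting (shift_rows d N) (t + d) (m + d)"
proof
  show "upper (shift_rows d N) (t + d)" by (rule upper_shift[OF N])
  show "shift_rows d N r = 0" if "r < m + d - 1" for r using zero[of "r - d"] that by (simp add: shift_rows_def)
qed (use mt Nm in \<open>auto simp: shift_rows_def\<close>)

text \<open>Strictly between the peak and the ray's last row every row of the upper part is longer
  than the next one by \<open>U_diff\<close>, so its first column ends in \<open>ray_row\<close> or
  one row earlier. The parity then decides where \<open>glue\<close> has to stop.\<close>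

lemma U_bot:
  assumes "0 < U_rows m N t"
  shows "ray_row - 1 \<le> col_bot (U_rows m N) 0" "c < U_rows m N t \<Longrightarrow> col_bot (U_rows m N) c \<le> ray_row"
proof -
  let ?U = "U_rows m N"
  note uU = lower_unimodal[OF lower_U]
  show "c < ?U t \<Longrightarrow> col_bot ?U c \<le> ray_row"
    using bot_in[OF uU, of c] U_ray_row(2)[of "col_bot ?U c"] by (cases "ray_row < col_bot ?U c") auto
  show "ray_row - 1 \<le> col_bot ?U 0"
  proof (cases "t = ray_row")
    case True
    then show ?thesis using column_iff(2)[OF uU assms] by simp
  next
    case False
    then have "0 < ?U (ray_row - 1)" using U_diff[of "ray_row - 1"] t_le_ray_row by simp
    then show ?thesis using column_iff(3)[OF uU assms, of "ray_row - 1"] by simp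
  qed
qed

lemma L_ray_row: "L_rows m N ray_row = ray_width"
  using ray_width_le unfolding L_rows_def ray_width_def by simp

lemma ray_width_pos: "N m \<noteq> 0 \<Longrightarrow> 0 < ray_width"
  using diag_iff[of m] int_ray_width by auto

lemma col_top_L:
  assumes "N m \<noteq> 0"
  shows "col_top (L_rows m N) 0 = m"
proof -
  let ?L = "L_rows m N"
  have L0: "0 < ?L ray_row" and mz: "m \<le> ray_row" using L_ray_row ray_width_pos[OF assms] int_ray_width by auto
  have "0 < ?L m" "?L (m - 1) = 0" using assms by (simp_all add: L_rows_def)
  then show ?thesis
    using column_iff(1,2)[OF unimodal_L L0] column_iff(3)[OF unimodal_L L0, of m]
      column_iff(3)[OF unimodal_L L0, of "m - 1"] mz by auto
qed

text \<open>Floating moved the columns of \<open>U_rows m N\<close> up by even amounts. Their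
  original bottoms respect the two bounds in \<open>glue\<close> and miss the tighter one by at most
  a row (\<open>U_bot\<close>, \<open>lower_bot_step\<close>), so moving down in steps of two as far
  as possible restores them.\<close>

lemma glue_normalized:
  assumes Nm: "N m \<noteq> 0" and norm: "top_row (rows_diagram (L_rows m N)) = m"
    and E: "E \<in> UL" "E \<noteq> []" and sim: "col_sim (U_rows m N) (row_lengths E)"
  shows "glue (rows_diagram (L_rows m N)) E = rows_diagram N"
proof -
  let ?L = "L_rows m N" and ?U = "U_rows m N"
  let ?D = "rows_diagram ?L"
  note uU = lower_unimodal[OF lower_U]
  note s0 = ray_width_pos[OF Nm] and Lz = L_ray_row
  have "m \<le> ray_row" using s0 int_ray_width by simp
  have L0: "0 < ?L ray_row" using Lz s0 by simp
  note topL = col_top_L[OF Nm]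
  obtain d where d: "row_lengths ?D = shift_rows d ?L" "top_row ?D = m + d"
    using row_lengths_rows_diagram[OF unimodal_L] L0 topL by auto
  then have rl: "row_lengths ?D = ?L" using norm by (simp add: shift_rows_def)
  have supp: "{r. 0 < ?L r} = {m..col_bot ?L 0}" using unimodal_support[OF unimodal_L L0] topL by simp
  note nth = rows_diagram_nth[OF supp]
  have len: "int (length ?D) = col_bot ?L 0 - m + 1"
    unfolding rows_diagram_interval[OF supp] using column_iff(2)[OF unimodal_L L0] \<open>m \<le> ray_row\<close> by simp
  have Dne: "?D \<noteq> []" using len column_iff(2)[OF unimodal_L L0] \<open>m \<le> ray_row\<close> by auto
  have zlen: "nat (ray_row - m) < length ?D" using len column_iff(2)[OF unimodal_L L0] \<open>m \<le> ray_row\<close> by linarith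
  have fstz: "fst (?D ! nat (ray_row - m)) = ray_width" using nth[OF zlen] Lz \<open>m \<le> ray_row\<close> by simp
  have width: "width ?D = ray_width"
    unfolding width_def
  proof (rule Max_eqI)
    show "ray_width \<in> fst ` set ?D" using fstz zlen by (metis image_eqI nth_mem)
    fix x assume "x \<in> fst ` set ?D"
    then obtain j where "j < length ?D" "x = fst (?D ! j)" by (auto simp: in_set_conv_nth)
    then show "x \<le> ray_width" using nth[of j] unimodal_le[OF unimodal_L] Lz by simp
  qed simp
  have peak: "uppermost_peak_row ?D = nat (ray_row - m)"
    unfolding uppermost_peak_row_def width
  proof (rule Least_equality)
    show "nat (ray_row - m) < length ?D \<and> fst (?D ! nat (ray_row - m)) = ray_width" using zlen fstz by simp
    fix j assume j: "j < length ?D \<and> fst (?D ! j) = ray_width"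
    then have "min (N (m + int j)) (nat (int j + 1)) = ray_width" using nth[of j] by (simp add: L_rows_def)
    then have "ray_width \<le> nat (int j + 1)" by linarith
    then show "nat (ray_row - m) \<le> j" using int_ray_width by linarith
  qed
  define p where "p = (if snd (hd ?D) = snd (hd E) then m else m - 1)"
  have evp: "even (p - top_row E)"
  proof -
    have 1: "snd (hd ?D) = of_int m" "snd (hd E) = of_int (top_row E)" using of_int_top_row[of ?D] of_int_top_row[of E] norm by simp_all
    show ?thesis
    proof (cases "(of_int m :: bit) = of_int (top_row E)")
      case True
      then have "even (m - top_row E)" unfolding of_int_bit_eq_iff .
      then show ?thesis using True 1 by (simp add: p_def)
    next
      case False
      then have "odd (m - top_row E)" unfolding of_int_bit_eq_iff .
      then show ?thesis using False 1 by (simp add: p_def)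
    qed
  qed
  define M where "M = shift_rows (p - top_row E) (row_lengths E)"
  obtain tE where tE: "upper (row_lengths E) tE" by (rule UL_upper[OF E(1)])
  define tM where "tM = tE + (p - top_row E)"
  have M: "upper M tM" unfolding M_def tM_def by (rule upper_shift[OF tE])
  note uM = upper_unimodal[OF M]
  have "col_sim ?U M" unfolding M_def using col_sim_trans[OF sim col_sim_shift[OF evp]] .
  then obtain \<sigma> where \<sigma>: "sim_by \<sigma> ?U M" unfolding col_sim_def by blast
  have ev: "even (\<sigma> c)" and e: "c < ?U r \<longleftrightarrow> c < M (r + \<sigma> c)" for r c using \<sigma> unfolding sim_by_def by blast+
  note w = sim_width[OF uU uM \<sigma>]
  let ?S = "place p E"
  have S: "?S = cells_of M" unfolding place_eq M_def ..
  have cb: "column_bottom ?S c = col_bot M c" for c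
    unfolding S column_bottom_def cells_of_def col_bot_def by simp
  have M0: "{r. 0 < M r} = {p..p + int (length E) - 1}"
  proof (rule set_eqI)
    fix r
    have "0 < row_lengths E x \<longleftrightarrow> top_row E \<le> x \<and> x \<le> top_row E + int (length E) - 1" for x
      using UL_support[OF E(1)] by (metis atLeastAtMost_iff mem_Collect_eq)
    from this[of "r - (p - top_row E)"] show "r \<in> {r. 0 < M r} \<longleftrightarrow> r \<in> {p..p + int (length E) - 1}"
      by (auto simp: M_def shift_rows_def)
  qed
  have lenE: "0 < int (length E)" using E(2) by simp
  have topM: "col_top M 0 = p" unfolding col_top_def M0 using lenE by (intro Min_eqI) auto
  have "p \<in> {r. 0 < M r}" unfolding M0 using lenE by simp
  then have "0 < M p" by simp
  then have w0: "0 < ?U t" using unimodal_le[OF uM, of p] w by simp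
  have botM: "col_bot M c = col_bot ?U c + \<sigma> c" if "c < ?U t" for c using sim_bot[OF uU uM \<sigma> that] .
  \<comment> \<open>Shifts are even, so a bound of 1 suffices. The top of column 0 comes from row
    \<open>m - 1\<close> or below to row \<open>p \<le> m\<close>; further tops descend by at most
    one per column after floating, and weakly before it.\<close>
  have \<sigma>0: "\<sigma> c \<le> 0" if "c < ?U t" for c
    using that
  proof (induction c)
    case 0
    have "col_top ?U 0 \<ge> m - 1"
    proof (rule ccontr)
      assume "\<not> ?thesis"
      then have "?U (col_top ?U 0) = 0" using zero[of "col_top ?U 0"] by (simp add: U_rows_def)
      then show False using top_in[OF uU w0] by simp
    qed
    moreover have "p = col_top ?U 0 + \<sigma> 0" using sim_top[OF uU uM \<sigma> w0] topM by simp
    moreover have "p \<le> m" by (simp add: p_def)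
    ultimately have "\<sigma> 0 \<le> 1" by simp
    then show ?case using ev[of 0] by presburger
  next
    case (Suc c)
    have "col_top M (Suc c) = col_top ?U (Suc c) + \<sigma> (Suc c)" "col_top M c = col_top ?U c + \<sigma> c"
      using sim_top[OF uU uM \<sigma>] Suc.prems by auto
    moreover have "col_top M (Suc c) \<le> col_top M c + 1" using upper_top_step[OF M] Suc.prems w by simp
    moreover have "col_top ?U c \<le> col_top ?U (Suc c)" using top_mono[OF uU, of c "Suc c"] Suc.prems by simp
    moreover have "\<sigma> c \<le> 0" using Suc by simp
    ultimately have "\<sigma> (Suc c) \<le> 1" by simp
    then show ?case using ev[of "Suc c"] by presburger
  qed
  note botz = U_bot(2)[OF w0]
  have sb: "shifted_bottom ray_row ?S c = col_bot ?U c" if "c < ?U t" for c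
    using that
  proof (induction c)
    case 0
    show ?case
    proof (cases "col_bot M 0 < ray_row")
      case True
      have "Max {x \<in> {col_bot M 0..ray_row}. even (x - col_bot M 0)} = col_bot ?U 0"
      proof (rule Max_eqI)
        show "col_bot ?U 0 \<in> {x \<in> {col_bot M 0..ray_row}. even (x - col_bot M 0)}"
          using botM[OF w0] \<sigma>0[OF w0] ev[of 0] botz[OF w0] by simp
        fix x assume "x \<in> {x \<in> {col_bot M 0..ray_row}. even (x - col_bot M 0)}"
        then have "x \<le> ray_row" "even (x - col_bot ?U 0)" using botM[OF w0] ev[of 0] by auto
        then show "x \<le> col_bot ?U 0" using U_bot(1)[OF w0] by presburger
      next
        show "finite {x \<in> {col_bot M 0..ray_row}. even (x - col_bot M 0)}"
          by (rule finite_subset[of _ "{col_bot M 0..ray_row}"]) auto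
      qed
      then show ?thesis using True by (simp add: cb)
    next
      case False
      then show ?thesis using botM[OF w0] \<sigma>0[OF w0] botz[OF w0] by (simp add: cb)
    qed
  next
    case (Suc c)
    have c: "c < ?U t" using Suc.prems by simp
    note IH = Suc.IH[OF c]
    let ?b = "col_bot M (Suc c)" and ?u = "col_bot ?U (Suc c)"
    show ?case
    proof (cases "\<exists>c' \<le> Suc c. col_bot M c' < ray_row")
      case True
      have "Max {x \<in> {?b..ray_row}. even (x - ?b) \<and> x \<le> col_bot ?U c} = ?u"
      proof (rule Max_eqI)
        show "?u \<in> {x \<in> {?b..ray_row}. even (x - ?b) \<and> x \<le> col_bot ?U c}"
          using botM[OF Suc.prems] \<sigma>0[OF Suc.prems] ev[of "Suc c"] botz[OF Suc.prems] bot_antimono[OF uU _ Suc.prems, of c] by simp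
        fix x assume "x \<in> {x \<in> {?b..ray_row}. even (x - ?b) \<and> x \<le> col_bot ?U c}"
        then have "x \<le> col_bot ?U c" "even (x - ?u)" using botM[OF Suc.prems] ev[of "Suc c"] by auto
        \<comment> \<open>The left neighbour ends at most one row lower than \<open>?u\<close>, so
          parity excludes any row beyond \<open>?u\<close>.\<close>
        then show "x \<le> ?u" using lower_bot_step[OF lower_U Suc.prems] by presburger
      next
        show "finite {x \<in> {?b..ray_row}. even (x - ?b) \<and> x \<le> col_bot ?U c}"
          by (rule finite_subset[of _ "{?b..ray_row}"]) auto
      qed
      then show ?thesis using True IH by (simp add: cb)
    next
      case False
      \<comment> \<open>No column so far ends above \<open>ray_row\<close>, so none is moved by
        \<open>glue\<close>; and as \<open>?u\<close> lies between \<open>?b\<close> and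
        \<open>ray_row\<close>, floating had not moved this one either.\<close>
      then have "ray_row \<le> ?b" by force
      then have b: "?b = ?u" using botM[OF Suc.prems] \<sigma>0[OF Suc.prems] botz[OF Suc.prems] by simp
      show ?thesis using False unfolding shifted_bottom.simps cb Let_def by (simp only: if_False b)
    qed
  qed
  let ?R = "{(\<rho> + (shifted_bottom ray_row ?S c - column_bottom ?S c), ray_width + c) | \<rho> c. (\<rho>, c) \<in> ?S}"
  have R: "(r, x) \<in> ?R \<longleftrightarrow> ray_width \<le> x \<and> x - ray_width < ?U r" for r x
  proof
    assume "(r, x) \<in> ?R"
    then obtain \<rho> c where *: "r = \<rho> + (shifted_bottom ray_row ?S c - column_bottom ?S c)" "x = ray_width + c" "c < M \<rho>"
      unfolding S cells_of_def by auto
    have c: "c < ?U t" using *(3) unimodal_le[OF uM, of \<rho>] w by simp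
    have "r = \<rho> - \<sigma> c" using *(1) sb[OF c] cb botM[OF c] by simp
    then show "ray_width \<le> x \<and> x - ray_width < ?U r" using e[of c r] * by simp
  next
    assume *: "ray_width \<le> x \<and> x - ray_width < ?U r"
    let ?c = "x - ray_width"
    have c: "?c < ?U t" using * unimodal_le[OF uU, of r] by simp
    have "(r + \<sigma> ?c, ?c) \<in> ?S" using e[of ?c r] * unfolding S cells_of_def by simp
    moreover have "r = (r + \<sigma> ?c) + (shifted_bottom ray_row ?S ?c - column_bottom ?S ?c)" using sb[OF c] cb botM[OF c] by simp
    moreover have "x = ray_width + ?c" using * by simp
    ultimately show "(r, x) \<in> ?R" by blast
  qed
  have pl: "place m ?D = cells_of ?L" unfolding place_eq norm rl by (simp add: shift_rows_def)
  have "glue ?D E = left_justify (place m ?D \<union> ?R)"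
    unfolding glue_def Let_def norm width peak using Dne E(2) \<open>m \<le> ray_row\<close> by (simp add: p_def)
  also have "\<dots> = rows_diagram (\<lambda>r. card {x. (r, x) \<in> place m ?D \<union> ?R})"
  proof (rule left_justify_eq)
    have "?R = (\<lambda>(\<rho>, c). (\<rho> + (shifted_bottom ray_row ?S c - column_bottom ?S c), ray_width + c)) ` ?S" by auto
    moreover have "finite ?S" unfolding S using M finite_cells_of by (simp add: upper_def)
    ultimately have "finite ?R" by (simp only: finite_imageI)
    moreover have "finite (place m ?D)" unfolding pl by (rule finite_cells_of[OF fin_L])
    ultimately show "finite (place m ?D \<union> ?R)" by blast
  qed
  also have "(\<lambda>r. card {x. (r, x) \<in> place m ?D \<union> ?R}) = N"
  proof
    fix r
    \<comment> \<open>There may be a gap before column \<open>ray_width\<close>; counting cells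
      closes it, as left-justifying does.\<close>
    have "{x. (r, x) \<in> place m ?D \<union> ?R} = {..<?L r} \<union> {ray_width..<ray_width + ?U r}"
    proof (rule set_eqI)
      fix x
      have "x \<in> {x. (r, x) \<in> place m ?D \<union> ?R} \<longleftrightarrow> x < ?L r \<or> ray_width \<le> x \<and> x - ray_width < ?U r"
        using R[of r x] unfolding pl cells_of_def by blast
      then show "x \<in> {x. (r, x) \<in> place m ?D \<union> ?R} \<longleftrightarrow> x \<in> {..<?L r} \<union> {ray_width..<ray_width + ?U r}" by auto
    qed
    moreover have "{..<?L r} \<inter> {ray_width..<ray_width + ?U r} = {}" using unimodal_le[OF unimodal_L, of r] Lz by auto
    ultimately show "card {x. (r, x) \<in> place m ?D \<union> ?R} = N r"
      by (simp add: card_Un_disjoint L_U_rows)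
  qed
  finally show ?thesis .
qed

lemma shift_L_U: "L_rows (m + d) (shift_rows d N) = shift_rows d (L_rows m N)"
  "U_rows (m + d) (shift_rows d N) = shift_rows d (U_rows m N)"
  by (auto simp: L_rows_def U_rows_def shift_rows_def fun_eq_iff algebra_simps)

lemma glue_L_E:
  assumes E: "E \<in> UL" and sim: "col_sim (U_rows m N) (row_lengths E)"
  shows "glue (rows_diagram (L_rows m N)) E = rows_diagram N"
proof -
  let ?L = "L_rows m N" and ?U = "U_rows m N"
  obtain tE where tE: "upper (row_lengths E) tE" by (rule UL_upper[OF E])
  consider (1) "N m = 0" | (2) "N m \<noteq> 0" "E = []" | (3) "N m \<noteq> 0" "E \<noteq> []" by blast
  then show ?thesis
  proof cases
    case 1
    then have L: "?L = (\<lambda>_. 0)" using L_zero_iff by simp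
    then have "?U = N" using L_U_rows by (simp add: fun_eq_iff)
    then have "rows_diagram (row_lengths E) = rows_diagram N" using sim_upper_eq[OF N tE] sim by simp
    then show ?thesis using L UL_rows_diagram[OF E] by (simp add: glue_def)
  next
    case 2
    obtain \<sigma> where "sim_by \<sigma> ?U (row_lengths E)" using sim unfolding col_sim_def by blast
    then have "\<not> c < ?U r" for c r using 2 unfolding sim_by_def by simp
    then have "?L = N" using L_U_rows by (auto simp: fun_eq_iff) (metis add.right_neutral not_gr_zero)
    then show ?thesis using 2 by (simp add: glue_def)
  next
    case 3
    have Lz: "0 < L_rows m N ray_row" using L_ray_row ray_width_pos[OF 3(1)] by simp
    note topL = col_top_L[OF 3(1)]
    obtain d where d: "even d" "top_row (rows_diagram ?L) = m + d"
      using row_lengths_rows_diagram[OF unimodal_L] Lz topL by auto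
    interpret sh: splitting "shift_rows d N" "t + d" "m + d" by (rule splitting_shift)
    have "glue (rows_diagram (L_rows (m + d) (shift_rows d N))) E = rows_diagram (shift_rows d N)"
    proof (rule sh.glue_normalized)
      show "shift_rows d N (m + d) \<noteq> 0" using 3(1) by (simp add: shift_rows_def)
      show "top_row (rows_diagram (L_rows (m + d) (shift_rows d N))) = m + d"
        unfolding shift_L_U rows_diagram_shift[OF fin_L d(1)] by (rule d(2))
      show "col_sim (U_rows (m + d) (shift_rows d N)) (row_lengths E)"
        unfolding shift_L_U using col_sim_trans[OF col_sim_sym[OF col_sim_shift[OF d(1)]] sim] .
    qed (use E 3 in auto)
    then show ?thesis unfolding shift_L_U rows_diagram_shift[OF fin_L d(1)] rows_diagram_shift[OF fin d(1)] .
  qed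
qed

end


section \<open>Induction along the splitting\<close>

text \<open>The ray starts in the topmost row or the next one, whichever has colour
  \<open>k\<close>. The last clause, that a top row of colour \<open>k\<close> is really cut, is
  what lets the recursion along the multicharge end.\<close>

lemma UL_splitting:
  assumes D: "D \<in> UL"
  obtains t m where "splitting (row_lengths D) t m" "of_int m = k"
    "D \<noteq> [] \<Longrightarrow> snd (hd D) = k \<Longrightarrow> row_lengths D m \<noteq> 0"
proof (cases "D = []")
  case True
  define m :: int where "m = (if k = 0 then 0 else 1)"
  have "of_int m = k" by (cases k) (simp_all add: m_def)
  moreover have "splitting (row_lengths D) (m - 1) m"
    by standard (simp_all add: True upper_def)
  ultimately show ?thesis using that True by blast
next
  case False
  let ?N = "row_lengths D" and ?a = "top_row D"
  obtain t where "upper ?N t" "D \<noteq> [] \<Longrightarrow> ?a \<le> t" "D \<noteq> [] \<Longrightarrow> 0 < ?N t" using UL_upper[OF D] by metis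
  then have t: "upper ?N t" "?a \<le> t" "0 < ?N t" using False by auto
  have supp: "0 < ?N r \<longleftrightarrow> ?a \<le> r \<and> r \<le> ?a + int (length D) - 1" for r
    using UL_support[OF D] by (metis atLeastAtMost_iff mem_Collect_eq)
  have pos: "0 < ?N r" if "?a \<le> r" "r \<le> t" for r using that supp t(3) by auto
  define m where "m = (if of_int ?a = k then ?a else ?a + 1)"
  have m: "of_int m = k" using of_int_bit_succ_eq_iff[of ?a k] by (auto simp: m_def)
  have "splitting ?N t m"
  proof
    show "?N r = 0" if "r < m - 1" for r using supp[of r] that by (auto simp: m_def split: if_splits)
    show "m - 1 \<le> t" using t(2) by (simp add: m_def)
    assume "?N m = 0"
    then have "\<not> (?a \<le> m \<and> m \<le> t)" using pos[of m] by auto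
    then show "t = m - 1" using t(2) by (auto simp: m_def split: if_splits)
  qed (rule t(1))
  moreover have "?N m \<noteq> 0" if "snd (hd D) = k"
    using that of_int_top_row[of D] pos[of ?a] t(2) by (simp add: m_def)
  ultimately show ?thesis using that m by blast
qed

lemma card_cells_of_col_sim:
  assumes "col_sim N M"
  shows "card (cells_of M) = card (cells_of N)"
proof -
  obtain s where s: "\<And>r c. c < N r \<longleftrightarrow> c < M (r + s c)" using assms unfolding col_sim_def sim_by_def by blast
  let ?h = "\<lambda>(r, c). (r + s c, c)"
  have "cells_of M = ?h ` cells_of N"
  proof (rule set_eqI)
    fix x :: cell
    obtain r c where x: "x = (r, c)" by fastforce
    have "x \<in> cells_of M \<longleftrightarrow> (r - s c, c) \<in> cells_of N" using s[of c "r - s c"] unfolding x cells_of_def by simp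
    also have "\<dots> \<longleftrightarrow> x \<in> ?h ` cells_of N" unfolding x by force
    finally show "x \<in> cells_of M \<longleftrightarrow> x \<in> ?h ` cells_of N" .
  qed
  moreover have "inj_on ?h (cells_of N)" by (auto simp: inj_on_def)
  ultimately show ?thesis by (simp add: card_image)
qed

lemma split_diag_UL:
  assumes D: "D \<in> UL"
  shows "snd (split_diag k D) \<in> UL"
    "card (cells (snd (split_diag k D))) < card (cells D) \<or> snd (split_diag k D) = D \<and> (D \<noteq> [] \<longrightarrow> snd (hd D) \<noteq> k)"
proof -
  let ?N = "row_lengths D" and ?E = "snd (split_diag k D)"
  obtain t m where sp: "splitting ?N t m" and m: "of_int m = k"
    and lead: "D \<noteq> [] \<Longrightarrow> snd (hd D) = k \<Longrightarrow> ?N m \<noteq> 0" using UL_splitting[OF D] by metis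
  interpret splitting ?N t m by (rule sp)
  have E: "?E = float_diag (rows_diagram (U_rows m ?N))"
    using split_diag_eq[OF m] UL_rows_diagram[OF D] by simp
  note fl = float_diag_unimodal[OF lower_unimodal[OF lower_U], folded E]
  show "?E \<in> UL" by (rule fl(1))
  show "card (cells ?E) < card (cells D) \<or> ?E = D \<and> (D \<noteq> [] \<longrightarrow> snd (hd D) \<noteq> k)"
  proof (cases "?N m = 0")
    case True
    then have "U_rows m ?N = ?N" using L_zero_iff L_U_rows by (simp add: fun_eq_iff)
    moreover obtain tE where "upper (row_lengths ?E) tE" by (rule UL_upper[OF fl(1)])
    ultimately have "?E = D"
      using sim_upper_eq[OF N] fl(2) UL_rows_diagram[OF D] UL_rows_diagram[OF fl(1)] by simp
    then show ?thesis using lead True by blast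
  next
    case False
    have "card (cells ?E) = card (cells_of (U_rows m ?N))"
      unfolding cells_eq by (rule card_cells_of_col_sim[OF fl(2)])
    also have "\<dots> < card (cells D)"
    proof (rule psubset_card_mono)
      show "finite (cells D)" unfolding cells_eq by (rule finite_cells_of[OF finite_row_lengths])
      have "U_rows m ?N r \<le> ?N r" for r by (simp add: U_rows_def)
      then have "cells_of (U_rows m ?N) \<subseteq> cells D"
        unfolding cells_eq cells_of_def using less_le_trans by blast
      moreover have "(m, ?N m - 1) \<in> cells D" "(m, ?N m - 1) \<notin> cells_of (U_rows m ?N)"
        unfolding cells_eq cells_of_def using False by (simp_all add: U_rows_def)
      ultimately show "cells_of (U_rows m ?N) \<subset> cells D" by blast
    qed
    finally show ?thesis by blast
  qed
qed

text \<open>The size of the diagram is not enough as a measure, since splitting may leave the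
  diagram as it is. The inner induction runs over the distance to a charge equal to the colour of
  the top row, where the size must drop at the latest.\<close>

lemma split_induct [consumes 2, case_names Nil split]:
  assumes "multicharge \<kappa>" "D \<in> UL"
    and Nil: "\<And>\<kappa>. multicharge \<kappa> \<Longrightarrow> P \<kappa> []"
    and split: "\<And>\<kappa> D. multicharge \<kappa> \<Longrightarrow> D \<in> UL \<Longrightarrow> D \<noteq> [] \<Longrightarrow>
      P (\<kappa> \<circ> Suc) (snd (split_diag (\<kappa> 0) D)) \<Longrightarrow> P \<kappa> D"
  shows "P \<kappa> D"
  using assms(1,2)
proof (induction "card (cells D)" arbitrary: \<kappa> D rule: less_induct)
  case less
  show ?case
  proof (cases "D = []")
    case True
    then show ?thesis using Nil less.prems by simp
  next
    case False
    have "infinite {t. \<kappa> t = snd (hd D)}" using less.prems(1) unfolding multicharge_def by (cases "snd (hd D)") auto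
    then obtain n where "\<kappa> n = snd (hd D)" using not_finite_existsD by blast
    then show ?thesis using less.prems(1)
    proof (induction n arbitrary: \<kappa>)
      case 0
      have "card (cells (snd (split_diag (\<kappa> 0) D))) < card (cells D)"
        using split_diag_UL(2)[OF less.prems(2)] 0 False by metis
      then have "P (\<kappa> \<circ> Suc) (snd (split_diag (\<kappa> 0) D))"
        using less.hyps split_diag_UL(1)[OF less.prems(2)] multicharge_Suc[OF 0(2)] by blast
      then show ?case using split[OF 0(2) less.prems(2) False] by blast
    next
      case (Suc n)
      note mc = multicharge_Suc[OF Suc.prems(2)]
      have "P (\<kappa> \<circ> Suc) (snd (split_diag (\<kappa> 0) D))"
      proof (cases "card (cells (snd (split_diag (\<kappa> 0) D))) < card (cells D)")
        case True
        then show ?thesis using less.hyps split_diag_UL(1)[OF less.prems(2)] mc by blast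
      next
        case False
        then have "snd (split_diag (\<kappa> 0) D) = D" using split_diag_UL(2)[OF less.prems(2)] by metis
        moreover have "P (\<kappa> \<circ> Suc) D" by (rule Suc.IH[OF _ mc]) (simp add: Suc.prems(1))
        ultimately show ?thesis by simp
      qed
      then show ?case using split[OF Suc.prems(2) less.prems(2) False] by blast
    qed
  qed
qed

lemma ul_eps_float:
  assumes U: "unimodal U t" and red: "reduce (colword i U 0 (U t)) = (As, Rs)"
  shows "ul_eps i (float_diag (rows_diagram U)) = int (length Rs)"
proof -
  let ?E = "float_diag (rows_diagram U)"
  note E = float_diag_unimodal[OF U]
  obtain tE where tE: "upper (row_lengths ?E) tE" by (rule UL_upper[OF E(1)])
  note uE = upper_unimodal[OF tE]
  have w: "row_lengths ?E tE = U t" using E(2) sim_width[OF U uE] unfolding col_sim_def by blast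
  show ?thesis using ul_eps_eq[OF uE, of i As Rs] red w colword_sim[OF U uE E(2), of "U t" i 0] by simp
qed

section \<open>The map \<open>\<W>\<close>\<close>

lemma W_map_rec:
  "W_map \<kappa> D = case_nat (top_align (fst (split_diag (\<kappa> 0) D))) (W_map (\<kappa> \<circ> Suc) (snd (split_diag (\<kappa> 0) D)))"
  by (rule ext) (simp add: W_map_def split: nat.split)

lemma W_map_splitting:
  assumes "splitting N t m" "of_int m = \<kappa> 0"
  shows "W_map \<kappa> (rows_diagram N) =
    case_nat (strip m N) (W_map (\<kappa> \<circ> Suc) (float_diag (rows_diagram (U_rows m N))))"
proof -
  interpret splitting N t m by fact
  show ?thesis using W_map_rec[of \<kappa> "rows_diagram N"] split_diag_eq[OF assms(2)] top_align_L by simp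
qed

lemma W_map_Nil: "W_map \<kappa> [] = empty_mp"
proof -
  have "split_diag k [] = ([], [])" for k by (simp add: split_diag_def cells_eq cells_of_def)
  then have "split_seq \<kappa> [] t = []" for t by (induction t arbitrary: \<kappa>) simp_all
  then show ?thesis by (simp add: W_map_def empty_mp_def top_align_def cells_eq cells_of_def)
qed

lemma mpword_empty: "mpword \<kappa> i empty_mp 0 []"
proof -
  have M: "empty_mp \<in> MP" by (simp add: MP_def empty_mp_def young_def)
  have "u \<notin> removable \<kappa> i empty_mp" for u
    using removable_iff[OF M, of "fst u" "fst (snd u)" "snd (snd u)"] by (simp add: empty_mp_def)
  moreover have "u \<in> addable \<kappa> i empty_mp \<longleftrightarrow> u \<in> {(t, 0, 0) | t. 0 \<le> t \<and> \<kappa> t = i}" for u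
  proof -
    obtain t r c where u: "u = (t, r, c)" by (metis surj_pair)
    show ?thesis unfolding u addable_iff[OF M] by (auto simp: empty_mp_def)
  qed
  ultimately show ?thesis unfolding mpword_def by auto
qed

text \<open>Since \<open>glue_seq\<close> stops at the last non-empty entry, peeling off the first
  entry shifts that position, and the case of no later non-empty entry is separate.\<close>

lemma glue_seq_rec:
  assumes "finite {t. Ds t \<noteq> []}"
  shows "glue_seq Ds = glue (Ds 0) (glue_seq (Ds \<circ> Suc))"
proof (cases "\<forall>t. (Ds \<circ> Suc) t = []")
  case True
  then have s: "Ds t \<noteq> [] \<Longrightarrow> t = 0" for t by (cases t) auto
  show ?thesis
  proof (cases "Ds 0 = []")
    case True
    then have "\<forall>t. Ds t = []" using s by metis
    then show ?thesis by (simp add: glue_seq_def glue_def)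
  next
    case False
    then have "{t. Ds t \<noteq> []} = {0}" using s by auto
    then have "glue_seq Ds = glue (Ds 0) []" using False by (auto simp: glue_seq_def)
    then show ?thesis using True by (simp add: glue_seq_def)
  qed
next
  case False
  let ?X = "{t. (Ds \<circ> Suc) t \<noteq> []}"
  have eq: "{t. Ds t \<noteq> []} = (if Ds 0 = [] then {} else {0}) \<union> Suc ` ?X" (is "?l = ?r")
  proof (rule set_eqI)
    show "t \<in> ?l \<longleftrightarrow> t \<in> ?r" for t by (cases t) auto
  qed
  have "finite (Suc ` ?X)" using assms unfolding eq by simp
  then have fin: "finite ?X" by (simp add: finite_image_iff)
  have ne: "?X \<noteq> {}" using False by auto
  have "Max {t. Ds t \<noteq> []} = Suc (Max ?X)"
  proof (rule Max_eqI[OF assms])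
    show "Suc (Max ?X) \<in> {t. Ds t \<noteq> []}" using Max_in[OF fin ne] by simp
    fix y assume "y \<in> {t. Ds t \<noteq> []}"
    then show "y \<le> Suc (Max ?X)" using Max_ge[OF fin] by (cases y) auto
  qed
  moreover have "\<not> (\<forall>t. Ds t = [])" using False by auto
  ultimately have "glue_seq Ds = foldr glue (map Ds [0..<Suc (Suc (Max ?X))]) []"
    unfolding glue_seq_def by (simp only: if_False)
  also have "[0..<Suc (Suc (Max ?X))] = 0 # map Suc [0..<Suc (Max ?X)]"
    by (subst upt_conv_Cons) (simp_all only: zero_less_Suc map_Suc_upt)
  also have "foldr glue (map Ds \<dots>) [] = glue (Ds 0) (foldr glue (map (Ds \<circ> Suc) [0..<Suc (Max ?X)]) [])"
    by (simp only: list.map map_map foldr.simps o_apply)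
  also have "foldr glue (map (Ds \<circ> Suc) [0..<Suc (Max ?X)]) [] = glue_seq (Ds \<circ> Suc)"
    using False unfolding glue_seq_def by (simp only: if_False)
  finally show ?thesis .
qed

lemma shear_empty: "shear k {} = []"
  by (simp add: shear_def left_justify_def)

lemma Z_map_rec:
  assumes "case_nat Y \<mu> \<in> MP"
  shows "Z_map \<kappa> (case_nat Y \<mu>) = glue (shear (\<kappa> 0) Y) (Z_map (\<kappa> \<circ> Suc) \<mu>)"
proof -
  let ?Ds = "\<lambda>t. shear (\<kappa> t) (case_nat Y \<mu> t)"
  have "finite {t. ?Ds t \<noteq> []}"
    by (rule finite_subset[of _ "{t. case_nat Y \<mu> t \<noteq> {}}"]) (use assms shear_empty in \<open>auto simp: MP_def\<close>)
  from glue_seq_rec[OF this] show ?thesis unfolding Z_map_def by (simp add: comp_def)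
qed

lemma Z_map_empty: "Z_map \<kappa> empty_mp = []"
  by (simp add: Z_map_def glue_seq_def empty_mp_def shear_empty)

text \<open>The clause on words prepares the tensor product rule: of the upper components it only
  needs the number of surviving letters \<open>False\<close>, and this is \<open>ul_eps\<close> of
  the upper part of the diagram.\<close>

lemma W_map_facts:
  assumes "multicharge \<kappa>" "D \<in> UL"
  shows "W_map \<kappa> D \<in> MP \<and> Z_map \<kappa> (W_map \<kappa> D) = D \<and>
    (\<forall>i. \<exists>T xs. mpword \<kappa> i (W_map \<kappa> D) T xs \<and> ul_eps i D = int (length (snd (reduce xs))))"
  using assms
proof (induction rule: split_induct)
  case (Nil \<kappa>)
  have "empty_mp \<in> MP" by (simp add: MP_def empty_mp_def young_def)
  moreover have "ul_eps i [] = 0" for i by (simp add: ul_eps_def bottom_boxes_def cells_eq cells_of_def)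
  ultimately show ?case
    unfolding W_map_Nil Z_map_empty using mpword_empty by (metis reduce_Nil snd_conv list.size(3) of_nat_0)
next
  case (split \<kappa> D)
  let ?N = "row_lengths D"
  obtain t m where sp: "splitting ?N t m" and m: "of_int m = \<kappa> 0" using UL_splitting[OF split(2)] by metis
  interpret splitting ?N t m by (rule sp)
  define E where "E = snd (split_diag (\<kappa> 0) D)"
  let ?\<mu> = "W_map (\<kappa> \<circ> Suc) E"
  have E: "E = float_diag (rows_diagram (U_rows m ?N))"
    using split_diag_eq[OF m] UL_rows_diagram[OF split(2)] by (simp add: E_def)
  note fl = float_diag_unimodal[OF lower_unimodal[OF lower_U], folded E]
  have IH: "?\<mu> \<in> MP" "Z_map (\<kappa> \<circ> Suc) ?\<mu> = E"
    "\<And>i. \<exists>T xs. mpword (\<kappa> \<circ> Suc) i ?\<mu> T xs \<and> ul_eps i E = int (length (snd (reduce xs)))"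
    using split(4) unfolding E_def by blast+
  have W: "W_map \<kappa> D = case_nat (strip m ?N) ?\<mu>"
    using W_map_splitting[where \<kappa> = \<kappa>, OF sp m] UL_rows_diagram[OF split(2)] E by simp
  have MP: "W_map \<kappa> D \<in> MP" unfolding W case_nat_MP using young_strip IH(1) by simp
  have Z: "Z_map \<kappa> (W_map \<kappa> D) = D"
    using Z_map_rec[OF MP[unfolded W], of \<kappa>] glue_L_E[OF fl] IH(2) shear_strip[OF m] UL_rows_diagram[OF split(2)]
    by (simp add: W)
  have "\<exists>T xs. mpword \<kappa> i (W_map \<kappa> D) T xs \<and> ul_eps i D = int (length (snd (reduce xs)))" for i
  proof -
    obtain T xs where xs: "mpword (\<kappa> \<circ> Suc) i ?\<mu> T xs" "ul_eps i E = int (length (snd (reduce xs)))" using IH(3) by blast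
    obtain P Q where PQ: "reduce xs = (P, Q)" by fastforce
    obtain As Rs where N': "reduce (colword i ?N 0 (?N t)) = (As, Rs)" by fastforce
    let ?U = "U_rows m ?N"
    obtain As' Rs' where U': "reduce (colword i ?U 0 (?U t)) = (As', Rs')" by fastforce
    obtain A R where L': "reduce (lamword i) = (A, R)" by fastforce
    have "ul_eps i E = int (length Rs')" unfolding E by (rule ul_eps_float[OF lower_unimodal[OF lower_U] U'])
    then have Q: "length Q = length Rs'" using xs PQ by simp
    let ?ys = "map (apsnd (lambox i)) (lamword i)"
    let ?ws = "map (apsnd (apfst Suc)) xs @ map (apsnd (Pair (0 :: nat))) ?ys"
    have word: "mpword \<kappa> i (W_map \<kappa> D) (Suc T) ?ws"
      unfolding W by (rule mpword_case_nat[OF MP[unfolded W] xs(1) compword_lamword[OF m]])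
    have "reduce (map (apsnd (apfst Suc)) xs) = (map (apfst Suc) P, map (apfst Suc) Q)"
      "reduce (map (apsnd (Pair (0 :: nat))) ?ys) = (map (Pair 0) (map (lambox i) A), map (Pair 0) (map (lambox i) R))"
      unfolding reduce_map PQ L' by simp_all
    from reduce_append[OF this] have "length (snd (reduce ?ws)) = length Rs' - length A + length R"
      using Q by simp
    also have "\<dots> = length Rs" using arg_cong[OF signature_split(2)[OF N' U' L'], of length] by simp
    finally have "ul_eps i D = int (length (snd (reduce ?ws)))" using ul_eps_eq[OF uni N'] by simp
    then show ?thesis using word by blast
  qed
  then show ?case using MP Z by blast
qed

text \<open>The inductive step, by cases on where the tensor product rule puts the box. Splitting
  the empty diagram gives it back, so for the empty diagram with charge \<open>i\<close> nothing is
  assumed of the remainder; this is where \<open>W_map_ul_f_Nil\<close> starts.\<close>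

lemma W_map_ul_f_step:
  assumes \<kappa>: "multicharge \<kappa>" and D: "D \<in> UL"
    and rest: "D = [] \<and> \<kappa> 0 = i \<or> W_map (\<kappa> \<circ> Suc) (ul_f i (snd (split_diag (\<kappa> 0) D))) =
       mp_f (\<kappa> \<circ> Suc) i (W_map (\<kappa> \<circ> Suc) (snd (split_diag (\<kappa> 0) D)))"
  shows "W_map \<kappa> (ul_f i D) = mp_f \<kappa> i (W_map \<kappa> D)"
proof -
  let ?N = "row_lengths D"
  obtain t m where sp: "splitting ?N t m" and m: "of_int m = \<kappa> 0" using UL_splitting[OF D] by metis
  interpret splitting ?N t m by (rule sp)
  define E where "E = snd (split_diag (\<kappa> 0) D)"
  let ?\<mu> = "W_map (\<kappa> \<circ> Suc) E"
  have E: "E = float_diag (rows_diagram (U_rows m ?N))"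
    using split_diag_eq[OF m] UL_rows_diagram[OF D] by (simp add: E_def)
  note fl = float_diag_unimodal[OF lower_unimodal[OF lower_U], folded E]
  let ?U = "U_rows m ?N"
  have W: "W_map \<kappa> D = case_nat (strip m ?N) ?\<mu>"
    using W_map_splitting[where \<kappa> = \<kappa>, OF sp m] UL_rows_diagram[OF D] E by simp
  have MP: "case_nat (strip m ?N) ?\<mu> \<in> MP" using W_map_facts[OF \<kappa> D] unfolding W by blast
  obtain T xs where xs: "mpword (\<kappa> \<circ> Suc) i ?\<mu> T xs" "ul_eps i E = int (length (snd (reduce xs)))"
    using W_map_facts[OF multicharge_Suc[OF \<kappa>] fl(1)] by blast
  obtain P Q where PQ: "reduce xs = (P, Q)" by fastforce
  obtain As Rs where N': "reduce (colword i ?N 0 (?N t)) = (As, Rs)" by fastforce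
  obtain As' Rs' where U': "reduce (colword i ?U 0 (?U t)) = (As', Rs')" by fastforce
  obtain A R where L': "reduce (lamword i) = (A, R)" by fastforce
  have "ul_eps i E = int (length Rs')" unfolding E by (rule ul_eps_float[OF lower_unimodal[OF lower_U] U'])
  then have Q: "length Q = length Rs'" using xs PQ by simp
  let ?ys = "map (apsnd (lambox i)) (lamword i)"
  have ys: "reduce ?ys = (map (lambox i) A, map (lambox i) R)" unfolding reduce_map L' by simp
  note tensor = mp_f_case_nat[OF \<kappa> MP xs(1) compword_lamword[OF m] PQ ys]
  let ?\<rho> = "f_row i ?N t"
  obtain t' where sp': "splitting (inc ?\<rho> ?N) t' m" using splitting_inc by blast
  have Wf: "W_map \<kappa> (ul_f i D) = case_nat (strip m (inc ?\<rho> ?N)) (W_map (\<kappa> \<circ> Suc) (float_diag (rows_diagram (U_rows m (inc ?\<rho> ?N)))))"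
    using W_map_splitting[where \<kappa> = \<kappa>, OF sp' m] ul_f_eq_normalized[OF D N, of i] by simp
  show ?thesis
  proof (cases "length Rs' < length A")
    case True
    then have "A \<noteq> []" by auto
    then have "mp_f \<kappa> i (W_map \<kappa> D) = case_nat (insert (lambox i (last A)) (strip m ?N)) ?\<mu>"
      using tensor(1) True Q by (simp add: W last_map)
    then show ?thesis unfolding Wf using f_step_lambda[OF N' U' L' True] E by simp
  next
    case False
    then have le: "length A \<le> length Rs'" by simp
    \<comment> \<open>In this exceptional case the letter of the first box of component 0 survives
      and the upper part has no letter to cancel it, so the box would have gone to component
      0.\<close>
    have "\<not> (D = [] \<and> \<kappa> 0 = i)"
    proof
      assume *: "D = [] \<and> \<kappa> 0 = i"
      then have N0: "?N = (\<lambda>_. 0)" by simp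
      have "ray_row = m - 1" using diag_iff[of m] ray_row_props(1) N0 by auto
      then have "of_int ray_row \<noteq> i" using m * of_int_bit_pred_eq_iff[of m i] by simp
      then have "A \<noteq> []"
        using L' reduce_cons_True[of "colword i ?N 0 ray_width" _ _ ray_width] by (cases "reduce (colword i ?N 0 ray_width)") (auto simp: lamword_def)
      moreover have "?U t = 0" using N0 by (simp add: U_rows_def)
      then have "Rs' = []" using U' by (simp add: colword_empty)
      ultimately show False using le by simp
    qed
    then have r: "W_map (\<kappa> \<circ> Suc) (ul_f i E) = mp_f (\<kappa> \<circ> Suc) i ?\<mu>" using rest unfolding E_def by blast
    note fs = f_step_rest[OF N' U' L' le]
    interpret sp': splitting "inc ?\<rho> ?N" t' m by (rule sp')
    have "unimodal (inc (f_row i ?U t) ?U) t'" using lower_unimodal[OF sp'.lower_U] unfolding fs(1) .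
    from ul_f_float[OF lower_U this] have "float_diag (rows_diagram (inc (f_row i ?U t) ?U)) = ul_f i E" unfolding E .
    then show ?thesis unfolding Wf fs using tensor(2) le Q r by (simp add: W)
  qed
qed

text \<open>The empty diagram does not shrink under splitting, so the induction counts down to a
  component of charge \<open>i\<close> instead, at which the new box can no longer be passed
  on.\<close>

lemma W_map_ul_f_Nil:
  assumes "multicharge \<kappa>" "\<kappa> n = i"
  shows "W_map \<kappa> (ul_f i []) = mp_f \<kappa> i (W_map \<kappa> [])"
  using assms
proof (induction n arbitrary: \<kappa>)
  case 0
  then show ?case by (intro W_map_ul_f_step) (simp_all add: UL_def)
next
  case (Suc n)
  have "split_diag (\<kappa> 0) [] = ([], [])" by (simp add: split_diag_def cells_eq cells_of_def)
  moreover have "W_map (\<kappa> \<circ> Suc) (ul_f i []) = mp_f (\<kappa> \<circ> Suc) i (W_map (\<kappa> \<circ> Suc) [])"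
    by (rule Suc.IH[OF multicharge_Suc[OF Suc.prems(1)]]) (simp add: Suc.prems(2))
  ultimately show ?case by (intro W_map_ul_f_step[OF Suc.prems(1)]) (auto simp: UL_def)
qed

lemma W_map_ul_f:
  assumes "multicharge \<kappa>" "D \<in> UL"
  shows "W_map \<kappa> (ul_f i D) = mp_f \<kappa> i (W_map \<kappa> D)"
  using assms
proof (induction rule: split_induct)
  case (Nil \<kappa>)
  then have "infinite {t. \<kappa> t = i}" unfolding multicharge_def by (cases i) auto
  then obtain n where "\<kappa> n = i" using not_finite_existsD by blast
  then show ?case using W_map_ul_f_Nil Nil by blast
next
  case (split \<kappa> D)
  then show ?case using W_map_ul_f_step by blast
qed

section \<open>Contents\<close>

lemma ul_cont_ul_f:
  assumes D: "D \<in> UL"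
  shows "ul_cont (ul_f i D) j = ul_cont D j + (if j = i then 1 else 0)"
proof -
  let ?N = "row_lengths D"
  obtain t where t: "upper ?N t" by (rule UL_upper[OF D])
  let ?\<rho> = "f_row i ?N t"
  obtain t' where t': "upper (inc ?\<rho> ?N) t'" using upper_inc[OF t, of i] by blast
  obtain d where d: "even d" "row_lengths (ul_f i D) = shift_rows d (inc ?\<rho> ?N)"
    using row_lengths_rows_diagram[OF upper_unimodal[OF t']] ul_f_eq_normalized[OF D t, of i] by auto
  let ?S = "{(\<rho>, c). c < ?N \<rho> \<and> of_int \<rho> = j}"
  have "{(\<rho>, c) \<in> cells (ul_f i D). of_int \<rho> = j} =
      (\<lambda>(r, c). (r + d, c)) ` (if j = i then insert (?\<rho>, ?N ?\<rho>) ?S else ?S)" (is "?l = ?r")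
  proof (rule set_eqI)
    fix x :: cell
    obtain r c where x: "x = (r, c)" by fastforce
    have "(of_int r :: bit) = of_int (r - d)" unfolding of_int_bit_eq_iff using d(1) by simp
    then have "x \<in> ?l \<longleftrightarrow> c < inc ?\<rho> ?N (r - d) \<and> of_int (r - d) = j"
      unfolding x cells_eq cells_of_def d(2) shift_rows_def by simp
    also have "\<dots> \<longleftrightarrow> (r - d, c) \<in> (if j = i then insert (?\<rho>, ?N ?\<rho>) ?S else ?S)"
      using f_row_colour[OF upper_unimodal[OF t], of i] unfolding less_inc by (auto simp del: of_int_diff)
    also have "\<dots> \<longleftrightarrow> x \<in> ?r" unfolding x by (auto simp: image_iff intro!: bexI[of _ "(r - d, c)"] simp del: of_int_diff)
    finally show "x \<in> ?l \<longleftrightarrow> x \<in> ?r" .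
  qed
  then have "ul_cont (ul_f i D) j = int (card (if j = i then insert (?\<rho>, ?N ?\<rho>) ?S else ?S))"
    unfolding ul_cont_def by (simp only: card_image[OF inj_onI, of _ "\<lambda>(r, c). (r + d, c)"] split: prod.splits) (auto simp: card_image inj_on_def)
  moreover have "finite ?S"
    by (rule finite_subset[OF _ finite_cells_of[OF finite_row_lengths[of D]]]) (auto simp: cells_of_def)
  moreover have "ul_cont D j = int (card ?S)" unfolding ul_cont_def cells_eq cells_of_def by simp
  ultimately show ?thesis by (cases "j = i") simp_all
qed

text \<open>A non-empty diagram admits some \<open>ul_e\<close> by \<open>exists_ul_e\<close>, which
  \<open>ul_f\<close> undoes. This is what places the image of \<open>W_map\<close> inside the
  Kleshchev multipartitions.\<close>

lemma UL_generated:
  assumes "D \<in> UL"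
  shows "\<exists>is. D = fold ul_f is []"
  using assms
proof (induction "nat (ul_cont D 0 + ul_cont D 1)" arbitrary: D rule: less_induct)
  case less
  show ?case
  proof (cases "D = []")
    case True
    then show ?thesis by (intro exI[of _ "[]"]) simp
  next
    case False
    then obtain i D' where e: "ul_e i D = Some D'" using exists_ul_e less.prems by blast
    note D' = ul_e_Some[OF less.prems e]
    have nn: "0 \<le> ul_cont D' j" for j by (simp add: ul_cont_def)
    have "ul_cont D 0 + ul_cont D 1 = ul_cont D' 0 + ul_cont D' 1 + 1"
      using ul_cont_ul_f[OF D'(1), of i 0] ul_cont_ul_f[OF D'(1), of i 1] D'(2) by (cases i) auto
    then have "nat (ul_cont D' 0 + ul_cont D' 1) < nat (ul_cont D 0 + ul_cont D 1)"
      using nn[of 0] nn[of 1] by simp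
    then obtain "is" where "D' = fold ul_f is []" using less.hyps D'(1) by blast
    then have "D = fold ul_f (is @ [i]) []" using D'(2) by simp
    then show ?thesis by blast
  qed
qed

lemma fold_ul_f_closed: "fold ul_f is [] \<in> UL"
  by (induction "is" rule: rev_induct) (simp_all add: UL_def[symmetric] ul_f_closed, simp add: UL_def)

lemma W_map_fold:
  assumes "multicharge \<kappa>"
  shows "W_map \<kappa> (fold ul_f is []) = fold (mp_f \<kappa>) is empty_mp"
  by (induction "is" rule: rev_induct) (simp_all add: W_map_Nil W_map_ul_f[OF assms fold_ul_f_closed])

lemma W_map_image:
  assumes "multicharge \<kappa>"
  shows "W_map \<kappa> ` UL = MPK \<kappa>"
proof
  show "W_map \<kappa> ` UL \<subseteq> MPK \<kappa>"
    using UL_generated W_map_fold[OF assms] unfolding MPK_def by blast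
  show "MPK \<kappa> \<subseteq> W_map \<kappa> ` UL"
    using fold_ul_f_closed W_map_fold[OF assms] unfolding MPK_def by (auto simp: image_iff) metis
qed

lemma finite_mp_boxes: "\<mu> \<in> MP \<Longrightarrow> finite (mp_boxes \<mu>)"
proof -
  assume "\<mu> \<in> MP"
  moreover have "mp_boxes \<mu> = (SIGMA t:{t. \<mu> t \<noteq> {}}. \<mu> t)" by (auto simp: mp_boxes_def)
  ultimately show ?thesis by (simp add: MP_def young_def)
qed

lemma mp_cont_add_box:
  assumes "\<mu> \<in> MP" "u \<in> addable \<kappa> i \<mu>"
  shows "mp_cont \<kappa> (add_box u \<mu>) j = mp_cont \<kappa> \<mu> j + (if j = i then 1 else 0)"
proof -
  have "mp_boxes (add_box u \<mu>) = insert u (mp_boxes \<mu>)"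
    by (cases u) (auto simp: mp_boxes_def split: if_splits)
  moreover have u: "u \<notin> mp_boxes \<mu>" "residue \<kappa> u = i" using assms(2) by (auto simp: addable_def)
  ultimately have "{v \<in> mp_boxes (add_box u \<mu>). residue \<kappa> v = j} =
     (if j = i then insert u {v \<in> mp_boxes \<mu>. residue \<kappa> v = j} else {v \<in> mp_boxes \<mu>. residue \<kappa> v = j})" by auto
  moreover have "finite {v \<in> mp_boxes \<mu>. residue \<kappa> v = j}" using finite_mp_boxes[OF assms(1)] by simp
  ultimately show ?thesis using u by (cases "j = i") (simp_all add: mp_cont_def)
qed

text \<open>No cell needs to be followed through the splitting: along a word of operators generating
  \<open>D\<close>, each step adds one box of residue \<open>i\<close> on either side.\<close>

lemma mp_cont_W_map:
  assumes "multicharge \<kappa>" "D \<in> UL"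
  shows "mp_cont \<kappa> (W_map \<kappa> D) j = ul_cont D j"
proof -
  have "mp_cont \<kappa> (W_map \<kappa> (fold ul_f is [])) j = ul_cont (fold ul_f is []) j" for "is"
  proof (induction "is" rule: rev_induct)
    case Nil
    show ?case by (simp add: W_map_Nil mp_cont_def ul_cont_def mp_boxes_def empty_mp_def cells_eq cells_of_def)
  next
    case (snoc i "is")
    let ?D = "fold ul_f is []"
    note facts = W_map_facts[OF assms(1) fold_ul_f_closed[of "is"]]
    then obtain T xs where "mpword \<kappa> i (W_map \<kappa> ?D) T xs" by blast
    from mp_f_addable[OF assms(1) this] obtain u where
      "u \<in> addable \<kappa> i (W_map \<kappa> ?D)" "mp_f \<kappa> i (W_map \<kappa> ?D) = add_box u (W_map \<kappa> ?D)" by blast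
    then show ?case
      using mp_cont_add_box[of "W_map \<kappa> ?D" u \<kappa> i j] facts snoc
        W_map_ul_f[OF assms(1) fold_ul_f_closed[of "is"]] ul_cont_ul_f[OF fold_ul_f_closed[of "is"], of i j] by simp
  qed
  then show ?thesis using UL_generated[OF assms(2)] by blast
qed

section \<open>The crystal isomorphism and its inverse\<close>

lemma mp_eps_W_map:
  assumes "multicharge \<kappa>" "D \<in> UL"
  shows "mp_eps \<kappa> i (W_map \<kappa> D) = ul_eps i D"
  using W_map_facts[OF assms] mp_eps_eq by (metis prod.collapse)

text \<open>If \<open>ul_e\<close> gives \<open>D'\<close>, then \<open>W_map \<kappa> D\<close> is
  \<open>mp_f\<close> applied to the image of \<open>D'\<close>, and \<open>mp_e\<close> undoes it.
  If \<open>ul_e\<close> fails, no letter \<open>False\<close> survives on either side.\<close>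

lemma mp_e_W_map:
  assumes "multicharge \<kappa>" "D \<in> UL"
  shows "mp_e \<kappa> i (W_map \<kappa> D) = map_option (W_map \<kappa>) (ul_e i D)"
proof (cases "ul_e i D")
  case None
  obtain T xs where xs: "mpword \<kappa> i (W_map \<kappa> D) T xs" "ul_eps i D = int (length (snd (reduce xs)))"
    using W_map_facts[OF assms] by blast
  then have "snd (reduce xs) = []" using None ul_e_eq_None_iff[OF assms(2)] by simp
  then show ?thesis using None mp_e_eq[OF xs(1)] by (metis option.map_disc_iff prod.collapse)
next
  case (Some D')
  note D' = ul_e_Some[OF assms(2) Some]
  note facts = W_map_facts[OF assms(1) D'(1)]
  then obtain T xs where "mpword \<kappa> i (W_map \<kappa> D') T xs" by blast
  then show ?thesis using mp_e_mp_f[OF assms(1)] facts W_map_ul_f[OF assms(1) D'(1), of i] D'(2) Some by simp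
qed

lemma crystal_iso_W_map:
  assumes \<kappa>: "multicharge \<kappa>"
  shows "crystal_iso UL_crystal (MPK_crystal \<kappa>) (W_map \<kappa>)"
proof -
  have UL: "ops_closed UL_crystal"
    unfolding ops_closed_def UL_crystal_def using ul_e_Some(1) ul_f_closed by auto
  have MPK: "ops_closed (MPK_crystal \<kappa>)"
  proof -
    have "mp_f \<kappa> i \<mu> \<in> MPK \<kappa>" "set_option (mp_e \<kappa> i \<mu>) \<subseteq> MPK \<kappa>" if "\<mu> \<in> MPK \<kappa>" for i \<mu>
    proof -
      have "\<mu> \<in> W_map \<kappa> ` UL" unfolding W_map_image[OF \<kappa>] by (rule that)
      then obtain D where D: "D \<in> UL" "\<mu> = W_map \<kappa> D" by blast
      show "mp_f \<kappa> i \<mu> \<in> MPK \<kappa>"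
        using W_map_ul_f[OF \<kappa> D(1), of i] ul_f_closed[OF D(1), of i] W_map_image[OF \<kappa>] D(2) by (metis imageI)
      show "set_option (mp_e \<kappa> i \<mu>) \<subseteq> MPK \<kappa>"
        unfolding D(2) mp_e_W_map[OF \<kappa> D(1)] using ul_e_Some(1)[OF D(1)] W_map_image[OF \<kappa>]
        by (auto simp: option.set_map)
    qed
    then show ?thesis unfolding ops_closed_def MPK_crystal_def by auto
  qed
  have "inj_on (W_map \<kappa>) UL"
    by (rule inj_on_inverseI[of _ "Z_map \<kappa>"]) (simp add: W_map_facts[OF \<kappa>])
  then have "bij_betw (W_map \<kappa>) UL (MPK \<kappa>)"
    using W_map_image[OF \<kappa>] unfolding bij_betw_def by blast
  then show ?thesis
    unfolding crystal_iso_def using UL MPK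
    by (simp add: UL_crystal_def MPK_crystal_def mp_cont_W_map[OF \<kappa>] mp_eps_W_map[OF \<kappa>] mp_e_W_map[OF \<kappa>] W_map_ul_f[OF \<kappa>])
qed

lemma crystal_iso_inverse:
  assumes iso: "crystal_iso B C h" and inv: "\<And>b. b \<in> elems B \<Longrightarrow> g (h b) = b"
  shows "crystal_iso C B g"
proof -
  have bij: "bij_betw h (elems B) (elems C)" and cl: "ops_closed B" "ops_closed C" using iso by (auto simp: crystal_iso_def)
  have "bij_betw g (elems C) (elems B)"
  proof -
    have C: "elems C = h ` elems B" using bij by (simp add: bij_betw_def)
    have "g ` h ` elems B = elems B" using inv by (force simp: image_iff)
    moreover have "inj_on g (h ` elems B)" using inv by (auto simp: inj_on_def)
    ultimately show ?thesis unfolding bij_betw_def C by blast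
  qed
  moreover have "wt B (g c) = wt C c \<and> (\<forall>i. eps B i (g c) = eps C i c \<and> phi B i (g c) = phi C i c \<and>
      e_op B i (g c) = map_option g (e_op C i c) \<and> f_op B i (g c) = map_option g (f_op C i c))" if "c \<in> elems C" for c
  proof -
    have "c \<in> h ` elems B" using bij that by (simp add: bij_betw_def)
    then obtain b where b: "b \<in> elems B" "c = h b" by blast
    have "map_option g (map_option h x) = x" if "set_option x \<subseteq> elems B" for x
      using that inv by (cases x) auto
    moreover have "set_option (e_op B i b) \<subseteq> elems B" "set_option (f_op B i b) \<subseteq> elems B" for i
      using cl(1) b(1) unfolding ops_closed_def by blast+
    ultimately show ?thesis using iso b inv unfolding crystal_iso_def by simp
  qed
  ultimately show ?thesis using cl unfolding crystal_iso_def by blast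
qed

theorem theoremG:
  fixes \<kappa> :: "nat \<Rightarrow> bit"
  assumes "multicharge \<kappa>"
  shows "W_map \<kappa> ` UL = MPK \<kappa>
    \<and> crystal_iso UL_crystal (MPK_crystal \<kappa>) (W_map \<kappa>)
    \<and> crystal_iso (MPK_crystal \<kappa>) UL_crystal (Z_map \<kappa>)
    \<and> (\<forall>D \<in> UL. Z_map \<kappa> (W_map \<kappa> D) = D)
    \<and> (\<forall>\<mu> \<in> MPK \<kappa>. W_map \<kappa> (Z_map \<kappa> \<mu>) = \<mu>)"
proof -
  have ZW: "\<And>D. D \<in> UL \<Longrightarrow> Z_map \<kappa> (W_map \<kappa> D) = D" using W_map_facts[OF assms] by blast
  have "crystal_iso (MPK_crystal \<kappa>) UL_crystal (Z_map \<kappa>)"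
    using crystal_iso_inverse[OF crystal_iso_W_map[OF assms]] ZW by (simp add: UL_crystal_def)
  then show ?thesis using W_map_image[OF assms] crystal_iso_W_map[OF assms] ZW by (auto simp flip: W_map_image[OF assms])
qed

end
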